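(* Let $\alpha\in[\frac12,1)$ and let $X$ be a strictly $\alpha$-stable process on $\mathbb{R}$ (as defined in the context) whose positivity coefficient $\rho$ satisfies $1-\rho=\frac1\alpha-1$. Let $\tau=\inf\{t\ge0:X_t\notin(0,\infty)\}$. Then: (i) for every $t>0$, $$\mathbb{E}^1e^{-t\tau}=\frac{\sin(\alpha\pi)}{\pi}\,\Gamma(\alpha)\,\Gamma(1-\alpha,t^{1/\alpha})\,e^{t^{1/\alpha}};$$ (ii) for every $x>0$, $$\mathbb{E}^1\frac1{x+\tau}=\int_0^\infty e^{-u}\left(\frac{e^{u^{1/\alpha}x^{-1/\alpha}}}{x}-\frac{u^{1/\alpha-1}}{x^{1/\alpha}}\,\frac{{}_1F_1(1,2-\alpha,u^{1/\alpha}x^{-1/\alpha})}{\Gamma(2-\alpha)}\right)du .$$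
   Context: For $\alpha\in(0,1)$ and $\beta\in[-1,1]$, the strictly $\alpha$-stable process $X=(X_t)_{t\ge0}$ is the real Lévy process with $$\mathbb{E}^0 e^{izX_t}=\exp\left[-t|z|^\alpha\left(1-i\beta\tan\frac{\pi\alpha}{2}\operatorname{sgn}z\right)\right],\quad z\in\mathbb{R};$$ $\mathbb{P}^x,\mathbb{E}^x$ refer to the process started from $X_0=x$. The positivity coefficient is $\rho=\mathbb{P}^0(X_t\ge0)=\frac12+\frac1{\pi\alpha}\arctan\left(\beta\tan\frac{\pi\alpha}2\right)$. (Processes with $\alpha\in[\frac12,1)$ and $1-\rho=1/\alpha-1$ form the class denoted $\hat C_{1,1}$, the duals of processes of Doney's class $C_{1,1}$.) $\Gamma(a,z)=\int_z^\infty t^{a-1}e^{-t}\,dt$ is the incomplete Gamma function, and ${}_1F_1(a,b,z)=\sum_{k=0}^\infty\frac{(a)_kz^k}{(b)_kk!}$ is the confluent hypergeometric function, with $(a)_k=a(a+1)\cdots(a+k-1)$, $(a)_0=1$.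
   Formalization: In (i) and (ii) τ is replaced by cτ, c = σ|1−iβ tan(πα/2)|, where σ>0 is an added factor in the exponent (σ=1: the given process). With plain τ the claim fails: for α=1/2, β=−1, τ is |N(0,1)| and E e^{−tτ}=e^{t²/2}erfc(t/√2), not e^{t²}erfc(t). *)

theory Defs
  imports "HOL-Probability.Probability"
begin

definition cadlag :: "(real \<Rightarrow> real) \<Rightarrow> bool" where
  "cadlag f \<longleftrightarrow>
     (\<forall>t\<ge>0. (f \<longlongrightarrow> f t) (at_right t)) \<and>
     (\<forall>t>0. \<exists>l. (f \<longlongrightarrow> l) (at_left t))"

(* Real Levy process started from 0; only the times t >= 0 matter. *)
definition levy_process :: "'a measure \<Rightarrow> (real \<Rightarrow> 'a \<Rightarrow> real) \<Rightarrow> bool" where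
  "levy_process M X \<longleftrightarrow>
     prob_space M \<and>
     (\<forall>t\<ge>0. X t \<in> borel_measurable M) \<and>
     (AE \<omega> in M. X 0 \<omega> = 0) \<and>
     (\<forall>(ts :: nat \<Rightarrow> real) n. 0 \<le> ts 0 \<and> mono ts \<longrightarrow>
        prob_space.indep_vars M (\<lambda>_. borel)
          (\<lambda>k \<omega>. X (ts (Suc k)) \<omega> - X (ts k) \<omega>) {..<n}) \<and>
     (\<forall>s\<ge>0. \<forall>t\<ge>0. distr M borel (\<lambda>\<omega>. X (s + t) \<omega> - X s \<omega>) = distr M borel (X t)) \<and>
     (AE \<omega> in M. cadlag (\<lambda>t. X t \<omega>))"

(* char N z is the integral of exp (i z x) with respect to N(dx).  The parameter \<sigma> only
   rescales time: \<sigma> = 1 is the parametrisation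
   E exp (i z X_t) = exp (- t |z|^\<alpha> (1 - i \<beta> tan (\<pi>\<alpha>/2) sgn z)). *)
definition strictly_stable_process ::
    "'a measure \<Rightarrow> (real \<Rightarrow> 'a \<Rightarrow> real) \<Rightarrow> real \<Rightarrow> real \<Rightarrow> real \<Rightarrow> bool" where
  "strictly_stable_process M X \<alpha> \<beta> \<sigma> \<longleftrightarrow>
     0 < \<alpha> \<and> \<alpha> < 1 \<and> -1 \<le> \<beta> \<and> \<beta> \<le> 1 \<and> 0 < \<sigma> \<and>
     levy_process M X \<and>
     (\<forall>t\<ge>0. \<forall>z. char (distr M borel (X t)) z =
        exp (- (complex_of_real (t * \<sigma> * \<bar>z\<bar> powr \<alpha>) *
                 (1 - \<i> * complex_of_real (\<beta> * tan (pi * \<alpha> / 2) * sgn z)))))"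

(* The modulus at z = 1 of the characteristic exponent.  The explicit formulas for the law of
   the exit time from (0, \<infinity>) are those of the process normalised so that this modulus is 1,
   i.e. with characteristic exponent |z|^\<alpha> exp (i \<pi> \<alpha> (1/2 - \<rho>) sgn z).  In general the
   time-changed process X_{t/c}, c = exponent_modulus \<alpha> \<beta> \<sigma>, is so normalised, and its exit
   time is c times that of X. *)
definition exponent_modulus :: "real \<Rightarrow> real \<Rightarrow> real \<Rightarrow> real" where
  "exponent_modulus \<alpha> \<beta> \<sigma> =
     \<sigma> * cmod (1 - \<i> * complex_of_real (\<beta> * tan (pi * \<alpha> / 2)))"

(* By strict stability P(X_t >= 0) is the same for all t > 0. *)
definition positivity_coefficient :: "'a measure \<Rightarrow> (real \<Rightarrow> 'a \<Rightarrow> real) \<Rightarrow> real" where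
  "positivity_coefficient M X = measure M {\<omega> \<in> space M. X 1 \<omega> \<ge> 0}"

(* Equal to \<infinity> on paths that never leave (0, \<infinity>). *)
definition exit_time :: "(real \<Rightarrow> 'a \<Rightarrow> real) \<Rightarrow> 'a \<Rightarrow> ereal" where
  "exit_time Y \<omega> = Inf {ereal t | t. 0 \<le> t \<and> Y t \<omega> \<notin> {0<..}}"

(* The expectation of F(\<tau>), \<tau> the exit time from (0, \<infinity>), for the process started from x.
   Without the usual conditions, \<tau> is only measurable with respect to the completion. *)
definition exit_expectation ::
    "'a measure \<Rightarrow> (real \<Rightarrow> 'a \<Rightarrow> real) \<Rightarrow> real \<Rightarrow> (ereal \<Rightarrow> real) \<Rightarrow> real" where
  "exit_expectation M X x F =
     (LINT \<omega>|completion M. F (exit_time (\<lambda>t \<omega>. x + X t \<omega>) \<omega>))"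

definition exp_minus :: "ereal \<Rightarrow> real" where
  "exp_minus s = (if s = \<infinity> then 0 else exp (- real_of_ereal s))"

definition upper_incomplete_Gamma :: "real \<Rightarrow> real \<Rightarrow> real" where
  "upper_incomplete_Gamma a z = (LINT t:{z<..}|lborel. t powr (a - 1) * exp (- t))"

definition hypergeom_1F1 :: "real \<Rightarrow> real \<Rightarrow> real \<Rightarrow> real" where
  "hypergeom_1F1 a b z = (\<Sum>k. pochhammer a k * z ^ k / (pochhammer b k * fact k))"

end

theory Submission
  imports Defs "HOL-Complex_Analysis.Complex_Analysis"
begin

text \<open>After scaling space, let \<open>Y\<close> be the process with \<open>E exp (i z Y\<^sub>s) = exp (- q s \<Psi>(z))\<close>, where
  \<open>\<Psi>(z) = - p powr \<alpha> * exp (- i \<pi> \<alpha>)\<close>, \<open>p = - i z\<close>, for \<open>z > 0\<close>; that \<open>\<Psi>\<close> has this form is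
  Zolotarev's formula for the positivity coefficient. With \<open>W\<close> the Laplace transform
  \<open>W(p) = (1 - p powr \<alpha>) / (1 - p)\<close> of an explicit density \<open>w\<close> on \<open>(0, \<infinity>)\<close>, one has
  \<open>(1 + \<Psi>(z)) W(i z) = (1 - 2 cos (\<pi> \<alpha>) p powr \<alpha> + p powr (2 \<alpha>)) / (1 + p)\<close>, and the right-hand side,
  divided by \<open>\<eta> + p\<close>, is the transform of a signed density on \<open>(0, \<infinity>)\<close>. By Fourier uniqueness this says
  that \<open>l(y) = \<integral>\<^sub>i\<^sub>>\<^sub>y exp (- \<eta> (i - y)) w(i) di\<close>, which is \<open>W(\<eta>) exp (\<eta> y)\<close> for \<open>y \<le> 0\<close>, is the
  \<open>q\<close>-potential of a function vanishing on \<open>[0, \<infinity>)\<close>. Stopping at the first time of the grid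
  \<open>2\<^sup>-\<^sup>n \<nat>\<close> at which \<open>y + Y\<close> is nonpositive needs only independence of the increments along the grid; letting
  \<open>n \<rightarrow> \<infinity>\<close> and then \<open>\<eta> \<rightarrow> 0\<close> identifies the Laplace transform of the first dyadic hitting time of
  \<open>(-\<infinity>, 0]\<close> as the tail \<open>\<integral>\<^sub>i\<^sub>>\<^sub>y w(i) di\<close>, for almost every \<open>y\<close>. Monotonicity in \<open>y\<close> and continuity of the
  tail extend this to every \<open>y\<close> and show that the exit time agrees almost surely with the dyadic hitting time.
  The second formula follows from the first by integrating against \<open>exp (- x t) dt\<close>.\<close>

section \<open>Finite densities and their Fourier transforms\<close>

text \<open>The identity for \<open>W\<close> is a Wiener-Hopf factorisation: \<open>w\<close> is
  the density of minus the infimum of \<open>Y\<close> up to an independent exponential time of rate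
  \<open>q\<close>, so its tail is the transform sought. The hypothesis on the positivity
  coefficient makes the factor explicit: it fixes the argument of \<Psi> so that
  \<open>1 + \<Psi>\<close> and \<open>1 - (i z) powr \<alpha>\<close> multiply to a real quadratic
  in \<open>p powr \<alpha>\<close>. For \<alpha> \<ge> 1/2 its middle coefficient is nonnegative
  and \<open>p powr (2 \<alpha>)\<close> is \<open>p\<close> times a power with exponent in [0, 1),
  which is what writes the right-hand side with densities of the same kind. The two factors live in
  opposite half-planes and meet only on the imaginary axis, hence the use of characteristic
  functions. The tail itself equals 1 on the negative half-line and is not a finite density; the
  discount \<eta> restores integrability until the potentials have been removed. Scaling space by
  \<open>t powr (1 / \<alpha>)\<close> leaves one \<Psi> for all \<open>t\<close>, and only the rate
  \<open>q = t * c\<close> changes.\<close>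

definition finite_density :: "(real \<Rightarrow> ennreal) \<Rightarrow> bool" where
  "finite_density f \<longleftrightarrow> f \<in> borel_measurable borel \<and> (\<integral>\<^sup>+x. f x \<partial>lborel) < \<infinity>"

lemma finite_density_measurable[measurable_dest]: "finite_density f \<Longrightarrow> f \<in> borel_measurable borel"
  by (simp add: finite_density_def)

lemma finite_measure_density_lborel: "finite_density f \<Longrightarrow> finite_measure (density lborel f)"
  by (intro finite_measureI) (auto simp: finite_density_def emeasure_density)

lemma finite_density_AE_finite: "finite_density f \<Longrightarrow> AE x in lborel. f x < \<infinity>"
  using nn_integral_PInf_AE[of f lborel] by (auto simp: finite_density_def less_top)

lemma finite_density_add: "finite_density f \<Longrightarrow> finite_density g \<Longrightarrow> finite_density (\<lambda>x. f x + g x)"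
  by (auto simp: finite_density_def nn_integral_add)

lemma finite_density_cmult: "finite_density f \<Longrightarrow> finite_density (\<lambda>x. ennreal c * f x)"
  by (auto simp: finite_density_def nn_integral_cmult ennreal_mult_less_top)

lemma finite_density_reflect: "finite_density f \<Longrightarrow> finite_density (\<lambda>x. f (- x))"
  using nn_integral_real_affine[of f "-1" 0] by (auto simp: finite_density_def)

lemma density_enn2real:
  assumes "finite_density f"
  shows "density lborel f = density lborel (\<lambda>x. ennreal (enn2real (f x)))"
  using assms finite_density_AE_finite[OF assms]
  by (intro density_cong) (auto simp: finite_density_def)

lemma integral_density_bounded:
  fixes h :: "real \<Rightarrow> complex"
  assumes f: "finite_density f" and [measurable]: "h \<in> borel_measurable borel" and b: "\<And>x. norm (h x) \<le> B"
  shows "integrable lborel (\<lambda>x. enn2real (f x) *\<^sub>R h x)"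
    and "integral\<^sup>L (density lborel f) h = integral\<^sup>L lborel (\<lambda>x. enn2real (f x) *\<^sub>R h x)"
proof -
  note [measurable] = finite_density_measurable[OF f]
  interpret finite_measure "density lborel f" by (rule finite_measure_density_lborel[OF f])
  have "integrable (density lborel f) h"
    by (rule integrable_const_bound[where B=B]) (use b in auto)
  then show "integrable lborel (\<lambda>x. enn2real (f x) *\<^sub>R h x)"
    unfolding density_enn2real[OF f] by (subst (asm) integrable_density) auto
  show "integral\<^sup>L (density lborel f) h = integral\<^sup>L lborel (\<lambda>x. enn2real (f x) *\<^sub>R h x)"
    unfolding density_enn2real[OF f] by (subst integral_density) auto
qed

lemma char_density:
  assumes "finite_density f"
  shows "complex_integrable lborel (\<lambda>x. enn2real (f x) *\<^sub>R iexp (z * x))"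
    and "char (density lborel f) z = (CLINT x|lborel. enn2real (f x) *\<^sub>R iexp (z * x))"
  using integral_density_bounded[OF assms, where B=1 and h="\<lambda>x. iexp (z * x)"] by (simp_all add: char_def)

lemma char_density_add:
  assumes "finite_density f" "finite_density g"
  shows "char (density lborel (\<lambda>x. f x + g x)) z = char (density lborel f) z + char (density lborel g) z"
proof -
  note [measurable] = assms[THEN finite_density_measurable]
  have "(CLINT x|lborel. enn2real (f x + g x) *\<^sub>R iexp (z * x)) =
        (CLINT x|lborel. enn2real (f x) *\<^sub>R iexp (z * x) + enn2real (g x) *\<^sub>R iexp (z * x))"
    using assms[THEN finite_density_AE_finite]
    by (intro integral_cong_AE) (auto simp: enn2real_plus scaleR_add_left)
  also have "\<dots> = (CLINT x|lborel. enn2real (f x) *\<^sub>R iexp (z * x)) + (CLINT x|lborel. enn2real (g x) *\<^sub>R iexp (z * x))"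
    using assms by (intro Bochner_Integration.integral_add char_density)
  finally show ?thesis
    using assms by (simp add: char_density finite_density_add)
qed

lemma char_density_cmult:
  assumes "finite_density f" "0 \<le> c"
  shows "char (density lborel (\<lambda>x. ennreal c * f x)) z = c * char (density lborel f) z"
  using assms by (simp add: char_density finite_density_cmult enn2real_mult flip: scaleR_scaleR)
    (simp add: scaleR_conv_of_real)

lemma char_density_reflect:
  assumes "finite_density f"
  shows "char (density lborel (\<lambda>x. f (- x))) z = char (density lborel f) (- z)"
  using assms lborel_integral_real_affine[of "-1" "\<lambda>x. enn2real (f x) *\<^sub>R iexp (- z * x)" 0]
  by (simp add: char_density finite_density_reflect)

lemma char_uminus: "char M (- z) = cnj (char M z)"
  unfolding char_def Bochner_Integration.integral_cnj[symmetric] by (simp add: exp_cnj)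

text \<open>Density of the convolution of \<open>f\<close> with a measure that may have none. With
  values in \<open>ennreal\<close> it is defined at every point and Tonelli applies freely; the
  potential of a reflected function will be such a convolution with the law
  \<open>resolvent\<close>.\<close>

definition mconv :: "(real \<Rightarrow> ennreal) \<Rightarrow> real measure \<Rightarrow> real \<Rightarrow> ennreal" where
  "mconv f \<mu> x = (\<integral>\<^sup>+y. f (x - y) \<partial>\<mu>)"

lemma mconv_measurable[measurable]:
  assumes [measurable]: "f \<in> borel_measurable borel" and "finite_measure \<mu>" "sets \<mu> = sets borel"
  shows "mconv f \<mu> \<in> borel_measurable borel"
proof -
  interpret finite_measure \<mu> by fact
  note [measurable_cong] = assms(3)
  show ?thesis unfolding mconv_def by measurable
qed

lemma nn_integral_mconv:
  assumes [measurable]: "f \<in> borel_measurable borel" "h \<in> borel_measurable borel"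
    and "finite_measure \<mu>" and [measurable_cong]: "sets \<mu> = sets borel"
  shows "(\<integral>\<^sup>+x. mconv f \<mu> x * h x \<partial>lborel) = (\<integral>\<^sup>+x. \<integral>\<^sup>+y. f x * h (x + y) \<partial>\<mu> \<partial>lborel)"
proof -
  interpret finite_measure \<mu> by fact
  interpret pair_sigma_finite \<mu> lborel ..
  have "(\<integral>\<^sup>+x. mconv f \<mu> x * h x \<partial>lborel) = (\<integral>\<^sup>+x. \<integral>\<^sup>+y. f (x - y) * h x \<partial>\<mu> \<partial>lborel)"
    unfolding mconv_def by (subst nn_integral_multc) auto
  also have "\<dots> = (\<integral>\<^sup>+y. \<integral>\<^sup>+x. f (x - y) * h x \<partial>lborel \<partial>\<mu>)"
    by (rule Fubini') measurable
  also have "\<dots> = (\<integral>\<^sup>+y. \<integral>\<^sup>+x. f x * h (x + y) \<partial>lborel \<partial>\<mu>)"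
  proof (rule nn_integral_cong)
    fix y show "(\<integral>\<^sup>+x. f (x - y) * h x \<partial>lborel) = (\<integral>\<^sup>+x. f x * h (x + y) \<partial>lborel)"
      by (subst nn_integral_real_affine[of _ 1 y]) (auto simp: add.commute)
  qed
  also have "\<dots> = (\<integral>\<^sup>+x. \<integral>\<^sup>+y. f x * h (x + y) \<partial>\<mu> \<partial>lborel)"
    by (rule Fubini'[symmetric]) measurable
  finally show ?thesis .
qed

lemma finite_density_mconv:
  assumes "finite_density f" "finite_measure \<mu>" "sets \<mu> = sets borel"
  shows "finite_density (mconv f \<mu>)"
proof -
  interpret finite_measure \<mu> by fact
  note [measurable] = finite_density_measurable[OF assms(1)]
  show ?thesis using nn_integral_mconv[of f "\<lambda>_. 1" \<mu>] assms
    by (auto simp: finite_density_def nn_integral_multc ennreal_mult_less_top emeasure_eq_measure)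
qed

lemma density_mconv:
  assumes f: "finite_density f" and \<mu>: "finite_measure \<mu>" "sets \<mu> = sets borel"
  shows "density lborel (mconv f \<mu>) = convolution (density lborel f) \<mu>"
proof (rule measure_eqI)
  note [measurable] = finite_density_measurable[OF f]
  interpret finite_measure \<mu> by fact
  note [measurable_cong] = \<mu>(2)
  fix A assume "A \<in> sets (density lborel (mconv f \<mu>))"
  then have [measurable]: "A \<in> sets borel" by simp
  have [measurable]: "mconv f \<mu> \<in> borel_measurable borel" using \<mu> by simp
  have "emeasure (density lborel (mconv f \<mu>)) A = (\<integral>\<^sup>+x. \<integral>\<^sup>+y. f x * indicator A (x + y) \<partial>\<mu> \<partial>lborel)"
    using \<mu> by (simp add: emeasure_density nn_integral_mconv)
  also have "\<dots> = (\<integral>\<^sup>+x. f x * (\<integral>\<^sup>+y. indicator A (x + y) \<partial>\<mu>) \<partial>lborel)"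
    by (intro nn_integral_cong nn_integral_cmult) auto
  also have "\<dots> = emeasure (convolution (density lborel f) \<mu>) A"
    using f \<mu> by (subst convolution_emeasure') (auto simp: finite_measure_density_lborel nn_integral_density)
  finally show "emeasure (density lborel (mconv f \<mu>)) A = emeasure (convolution (density lborel f) \<mu>) A" .
qed simp

lemma char_convolution:
  assumes "finite_measure M" "finite_measure N" and [measurable_cong]: "sets M = sets borel" "sets N = sets borel"
  shows "char (convolution M N) z = char M z * char N z"
proof -
  interpret M: finite_measure M by fact
  interpret N: finite_measure N by fact
  interpret P: pair_sigma_finite M N ..
  have fin: "finite_measure (M \<Otimes>\<^sub>M N)" by (intro finite_measure_pair_measure assms)
  have int: "integrable (M \<Otimes>\<^sub>M N) (\<lambda>(x, y). iexp (z * (x + y)))"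
    by (rule finite_measure.integrable_const_bound[OF fin, where B=1]) auto
  have "char (convolution M N) z = (CLINT p|M \<Otimes>\<^sub>M N. iexp (z * (fst p + snd p)))"
    unfolding char_def convolution_def by (subst integral_distr) (auto simp: case_prod_beta)
  also have "\<dots> = (CLINT x|M. CLINT y|N. iexp (z * (x + y)))"
    using P.integral_fst'[OF int] unfolding case_prod_beta by (simp only: fst_conv snd_conv)
  also have "\<dots> = (CLINT x|M. CLINT y|N. iexp (z * x) * iexp (z * y))"
    by (simp add: distrib_left exp_add)
  also have "\<dots> = char M z * char N z" unfolding char_def by simp
  finally show ?thesis .
qed

lemma char_mconv:
  assumes "finite_density f" "finite_measure \<mu>" "sets \<mu> = sets borel"
  shows "char (density lborel (mconv f \<mu>)) z = char (density lborel f) z * char \<mu> z"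
  using assms by (simp add: density_mconv char_convolution finite_measure_density_lborel)

lemma isCont_char_density:
  assumes f: "finite_density f" shows "isCont (char (density lborel f)) z"
proof -
  note [measurable] = finite_density_measurable[OF f]
  interpret finite_measure "density lborel f" by (rule finite_measure_density_lborel[OF f])
  show ?thesis unfolding continuous_at_sequentially char_def comp_def
    by (auto intro!: integral_dominated_convergence[where w="\<lambda>_. 1"] tendsto_intros)
qed

text \<open>Levy's uniqueness theorem speaks of probability measures, so both densities are divided
  by their common mass, and mass zero is treated apart. Positive frequencies suffice: the negative
  ones follow by conjugation and 0 by continuity.\<close>

lemma char_density_unique:
  assumes f: "finite_density f" and g: "finite_density g"
    and eq: "\<And>z. z > 0 \<Longrightarrow> char (density lborel f) z = char (density lborel g) z"
  shows "AE x in lborel. f x = g x"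
proof -
  note [measurable] = f[THEN finite_density_measurable] g[THEN finite_density_measurable]
  have neg: "char (density lborel f) z = char (density lborel g) z" if "z < 0" for z
    using eq[of "-z"] char_uminus[of "density lborel f" "-z"] char_uminus[of "density lborel g" "-z"] that by simp
  have lim: "(\<lambda>n. char (density lborel h) (1 / real (Suc n))) \<longlonglongrightarrow> char (density lborel h) 0" if "finite_density h" for h
    by (rule isCont_tendsto_compose[OF isCont_char_density[OF that]]) (intro LIMSEQ_Suc lim_1_over_n)
  have zero: "char (density lborel f) 0 = char (density lborel g) 0"
    using lim[OF f] lim[OF g] by (simp add: eq LIMSEQ_unique)
  have eq': "char (density lborel f) z = char (density lborel g) z" for z
    using eq[of z] neg[of z] zero by (cases z "0::real" rule: linorder_cases) auto
  define m where "m = measure (density lborel f) UNIV"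
  have mf: "emeasure (density lborel f) UNIV = ennreal m"
    using finite_measure.emeasure_eq_measure[OF finite_measure_density_lborel[OF f]] by (simp add: m_def)
  have mg: "emeasure (density lborel g) UNIV = ennreal m"
    using zero finite_measure.emeasure_eq_measure[OF finite_measure_density_lborel[OF g]] by (simp add: m_def char_def)
  have m0: "m \<ge> 0" by (simp add: m_def)
  show ?thesis
  proof (cases "m = 0")
    case True
    have "AE x in lborel. f x = 0" "AE x in lborel. g x = 0"
      using mf mg True by (simp_all add: emeasure_density nn_integral_0_iff_AE)
    then show ?thesis by eventually_elim simp
  next
    case False
    then have m: "m > 0" using m0 by simp
    have rd: "real_distribution (density lborel (\<lambda>x. ennreal (1/m) * h x))"
      if h: "finite_density h" "emeasure (density lborel h) UNIV = ennreal m" for h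
    proof -
      note [measurable] = h(1)[THEN finite_density_measurable]
      have "prob_space (density lborel (\<lambda>x. ennreal (1/m) * h x))"
        using h m by (intro prob_spaceI)
          (auto simp: emeasure_density nn_integral_cmult ennreal_mult'' simp flip: ennreal_mult)
      then show ?thesis by (simp add: real_distribution_def real_distribution_axioms_def)
    qed
    have "density lborel (\<lambda>x. ennreal (1/m) * f x) = density lborel (\<lambda>x. ennreal (1/m) * g x)"
      using f g m by (intro Levy_uniqueness rd mf mg) (auto simp: char_density_cmult eq')
    then have "AE x in lborel. ennreal (1/m) * f x = ennreal (1/m) * g x"
      by (intro sigma_finite_measure.density_unique[OF sigma_finite_lborel]) auto
    then show ?thesis
      using m by (auto elim!: eventually_mono simp: ennreal_mult_cancel_left)
  qed
qed

section \<open>Laplace transforms on the imaginary axis\<close>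

text \<open>Differentiation under the integral. For \<open>cmod h < Re p / 2\<close> the difference
  quotient of the integrand is at most \<open>x * exp (- Re p / 2 * x)\<close>, hence at most the
  constant \<open>2 / Re p\<close>, which is integrable because the measure is finite.\<close>

lemma holomorphic_laplace:
  assumes fm: "finite_measure M" and [measurable_cong]: "sets M = sets borel" and pos: "AE x in M. 0 \<le> (x::real)"
  shows "(\<lambda>p. CLINT x|M. exp (- p * complex_of_real x)) holomorphic_on {p. 0 < Re p}"
proof -
  interpret finite_measure M by fact
  let ?L = "\<lambda>p. CLINT x|M. exp (- p * complex_of_real x)"
  have int: "integrable M (\<lambda>x. exp (- p * complex_of_real x))" if "0 < Re p" for p
    by (rule integrable_const_bound[where B=1]) (use pos that in \<open>auto elim!: eventually_mono\<close>)
  have "(?L has_field_derivative (CLINT x|M. - of_real x * exp (- p * complex_of_real x))) (at p)" if p: "0 < Re p" for p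
    unfolding DERIV_def
  proof (subst tendsto_at_iff_sequentially, intro allI impI)
    fix h :: "nat \<Rightarrow> complex" assume h: "\<forall>i. h i \<in> UNIV - {0}" "h \<longlonglongrightarrow> 0"
    from tendstoD[OF h(2), of "Re p / 2"] p obtain N where N: "\<And>n. n \<ge> N \<Longrightarrow> cmod (h n) < Re p / 2"
      by (auto simp: eventually_sequentially)
    have hp: "0 < Re (p + h n)" if "n \<ge> N" for n
      using N[OF that] abs_Re_le_cmod[of "h n"] p by simp
    have bound: "norm ((exp (- (p + h (n + N)) * complex_of_real x) - exp (- p * complex_of_real x)) / h (n + N)) \<le> 2 / Re p"
      if x: "0 \<le> x" for x n
    proof -
      let ?h = "h (n + N)"
      have "exp (- (p + ?h) * of_real x) - exp (- p * of_real x) = exp (- p * of_real x) * (exp (- ?h * of_real x) - 1)"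
        by (simp add: algebra_simps exp_add exp_diff exp_minus field_simps)
      then have "norm (exp (- (p + ?h) * of_real x) - exp (- p * of_real x)) = exp (- (Re p * x)) * norm (exp (- ?h * of_real x) - 1)"
        by (simp add: norm_mult)
      also have "norm (exp (- ?h * of_real x) - 1) \<le> exp (cmod ?h * x) * (cmod ?h * x)"
      proof -
        have "norm (exp (- ?h * of_real x) - 1) \<le> exp \<bar>Re (- ?h * of_real x)\<bar> * (cmod (?h * of_real x))"
          using Taylor_exp[of "- ?h * of_real x" 0] by simp
        also have "\<dots> \<le> exp (cmod ?h * x) * (cmod ?h * x)"
          using x abs_Re_le_cmod[of ?h] by (intro mult_mono) (auto simp: norm_mult abs_mult mult_right_mono)
        finally show ?thesis .
      qed
      also have "exp (- (Re p * x)) * (exp (cmod ?h * x) * (cmod ?h * x)) = exp (- ((Re p - cmod ?h) * x)) * x * cmod ?h"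
        by (simp add: algebra_simps flip: exp_add)
      also have "exp (- ((Re p - cmod ?h) * x)) * x \<le> exp (- (Re p / 2 * x)) * x"
      proof -
        have "Re p / 2 * x \<le> (Re p - cmod ?h) * x"
          using N[of "n + N"] x by (intro mult_right_mono) (auto simp: field_simps)
        then show ?thesis using x by (intro mult_right_mono) auto
      qed
      also have "exp (- (Re p / 2 * x)) * x \<le> 2 / Re p"
      proof -
        have "Re p / 2 * x \<le> exp (Re p / 2 * x)" using exp_ge_add_one_self[of "Re p / 2 * x"] by linarith
        then show ?thesis using p by (simp add: exp_minus field_simps)
      qed
      finally show ?thesis
        using h(1) x by (simp add: norm_divide pos_divide_le_eq mult_right_mono)
    qed
    have "(\<lambda>n. (?L (p + h (n + N)) - ?L p) / h (n + N)) \<longlonglongrightarrow> (CLINT x|M. - of_real x * exp (- p * complex_of_real x))"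
    proof -
      have "(?L (p + h (n + N)) - ?L p) / h (n + N) =
         (CLINT x|M. (exp (- (p + h (n + N)) * complex_of_real x) - exp (- p * complex_of_real x)) / h (n + N))" for n
        using int[OF p] int[OF hp[of "n + N"]] by (subst Bochner_Integration.integral_diff[symmetric]) auto
      moreover have "(\<lambda>n. CLINT x|M. (exp (- (p + h (n + N)) * complex_of_real x) - exp (- p * complex_of_real x)) / h (n + N)) \<longlonglongrightarrow>
         (CLINT x|M. - of_real x * exp (- p * complex_of_real x))"
      proof (rule integral_dominated_convergence[where w="\<lambda>_. 2 / Re p"])
        show "AE x in M. (\<lambda>n. (exp (- (p + h (n + N)) * complex_of_real x) - exp (- p * complex_of_real x)) / h (n + N))
            \<longlonglongrightarrow> - of_real x * exp (- p * complex_of_real x)"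
        proof (rule AE_I2)
          fix x
          have "((\<lambda>p. exp (- p * complex_of_real x)) has_field_derivative (- of_real x * exp (- p * complex_of_real x))) (at p)"
            by (auto intro!: derivative_eq_intros)
          then have "((\<lambda>h. (exp (- (p + h) * complex_of_real x) - exp (- p * complex_of_real x)) / h) \<longlongrightarrow> - of_real x * exp (- p * complex_of_real x)) (at 0)"
            unfolding DERIV_def .
          from this[unfolded tendsto_at_iff_sequentially, rule_format, of "\<lambda>n. h (n + N)"] h(1) LIMSEQ_ignore_initial_segment[OF h(2), of N]
          show "(\<lambda>n. (exp (- (p + h (n + N)) * complex_of_real x) - exp (- p * complex_of_real x)) / h (n + N))
            \<longlonglongrightarrow> - of_real x * exp (- p * complex_of_real x)" unfolding comp_def by simp
        qed
      qed (use bound pos in \<open>auto elim!: eventually_mono\<close>)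
      ultimately show ?thesis by (simp only:)
    qed
    then show "((\<lambda>h. (?L (p + h) - ?L p) / h) \<circ> h) \<longlonglongrightarrow> (CLINT x|M. - of_real x * exp (- p * complex_of_real x))"
      unfolding comp_def by (rule LIMSEQ_offset)
  qed
  then show ?thesis
    by (subst holomorphic_on_open) (auto simp: open_halfspace_Re_gt)
qed

text \<open>The identity theorem carries an equation between Laplace transforms from real
  \<open>p\<close> in (0, 1) to the right half-plane, and letting \<open>p\<close> tend to
  \<open>- i z\<close> from the right gives the characteristic function. A product is used instead
  of a quotient since \<open>A\<close> may vanish inside the half-plane, as \<open>1 - p\<close>
  does.\<close>

lemma char_density_laplace:
  assumes f: "finite_density f" and f0: "\<And>x. x < 0 \<Longrightarrow> f x = 0"
    and hol: "A holomorphic_on {p. 0 < Re p}" "B holomorphic_on {p. 0 < Re p}"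
    and eq: "\<And>p. 0 < p \<Longrightarrow> p < 1 \<Longrightarrow> A (complex_of_real p) * of_real (enn2real (\<integral>\<^sup>+x. ennreal (exp (- p * x)) * f x \<partial>lborel)) = B (of_real p)"
    and cont: "isCont A (- \<i> * of_real z)" "isCont B (- \<i> * of_real z)"
  shows "A (- \<i> * of_real z) * char (density lborel f) z = B (- \<i> * of_real z)"
proof -
  note [measurable] = finite_density_measurable[OF f]
  interpret finite_measure "density lborel f" by (rule finite_measure_density_lborel[OF f])
  let ?M = "density lborel f"
  let ?L = "\<lambda>p. CLINT x|?M. exp (- p * complex_of_real x)"
  have pos: "AE x in ?M. 0 \<le> x" using f0 by (auto simp: AE_density not_less[symmetric])
  have hL: "?L holomorphic_on {p. 0 < Re p}"
    by (rule holomorphic_laplace) (auto simp: pos finite_measure_axioms)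
  have real: "?L (of_real p) = of_real (enn2real (\<integral>\<^sup>+x. ennreal (exp (- p * x)) * f x \<partial>lborel))" for p
  proof -
    have "?L (of_real p) = of_real (LINT x|?M. exp (- p * x))"
      unfolding integral_complex_of_real[symmetric] by (simp flip: exp_of_real)
    also have "(LINT x|?M. exp (- p * x)) = enn2real (\<integral>\<^sup>+x. ennreal (exp (- p * x)) \<partial>?M)"
      by (intro integral_eq_nn_integral) auto
    also have "(\<integral>\<^sup>+x. ennreal (exp (- p * x)) \<partial>?M) = (\<integral>\<^sup>+x. ennreal (exp (- p * x)) * f x \<partial>lborel)"
      by (simp add: nn_integral_density mult.commute)
    finally show ?thesis .
  qed
  have AB: "A p * ?L p - B p = 0" if "0 < Re p" for p
  proof (rule analytic_continuation[of "\<lambda>p. A p * ?L p - B p" "{p. 0 < Re p}" "of_real ` {0<..<1}" "1/2"])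
    show "(\<lambda>p. A p * ?L p - B p) holomorphic_on {p. 0 < Re p}" by (intro holomorphic_intros hol hL)
    show "open {p. 0 < Re p}" by (rule open_halfspace_Re_gt)
    show "connected {p. 0 < Re p}" by (simp add: convex_connected convex_halfspace_Re_gt)
    show "(1/2::complex) islimpt of_real ` {0<..<1}"
    proof -
      let ?s = "\<lambda>n. 1/2 - 1 / (4 * real (Suc n))"
      have "(\<lambda>n. complex_of_real (?s n)) \<longlonglongrightarrow> of_real (1/2)"
        by (rule tendsto_of_real) real_asymp
      moreover have "complex_of_real (?s n) \<in> of_real ` {0<..<1} - {1/2}" for n
      proof -
        have s: "?s n \<in> {0<..<1}" "?s n \<noteq> 1/2" by (auto simp: field_simps)
        have "complex_of_real (?s n) \<noteq> of_real (1/2)" using s(2) unfolding of_real_eq_iff .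
        moreover have "complex_of_real (1/2) = 1/2" by simp
        ultimately show ?thesis using s(1) by (metis Diff_iff imageI singletonD)
      qed
      ultimately show ?thesis unfolding islimpt_sequential
        by (intro exI[of _ "\<lambda>n. complex_of_real (?s n)"]) simp
    qed
    fix q :: complex assume "q \<in> of_real ` {0<..<1}"
    then show "A q * ?L q - B q = 0" using eq real by auto
  qed (use that in auto)
  define p where "p n = complex_of_real (1 / real (Suc n)) - \<i> * of_real z" for n
  have p: "p \<longlonglongrightarrow> - \<i> * of_real z"
  proof -
    have "p \<longlonglongrightarrow> of_real 0 - \<i> * of_real z"
      unfolding p_def by (intro tendsto_intros LIMSEQ_Suc lim_1_over_n)
    then show ?thesis by simp
  qed
  have "(\<lambda>n. ?L (p n)) \<longlonglongrightarrow> char ?M z"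
    unfolding char_def
  proof (rule integral_dominated_convergence[where w="\<lambda>_. 1"])
    show "AE x in ?M. (\<lambda>n. exp (- p n * complex_of_real x)) \<longlonglongrightarrow> iexp (z * x)"
    proof (rule AE_I2)
      fix x show "(\<lambda>n. exp (- p n * complex_of_real x)) \<longlonglongrightarrow> iexp (z * x)"
        using tendsto_exp[OF tendsto_mult[OF tendsto_minus[OF p] tendsto_const[of "of_real x"]]] by (simp add: mult.assoc)
    qed
    show "AE x in ?M. norm (exp (- p n * complex_of_real x)) \<le> 1" for n
      using pos by eventually_elim (simp add: p_def)
  qed auto
  then have "(\<lambda>n. A (p n) * ?L (p n) - B (p n)) \<longlonglongrightarrow> A (- \<i> * of_real z) * char ?M z - B (- \<i> * of_real z)"
    by (intro tendsto_intros isCont_tendsto_compose[OF cont(1)] isCont_tendsto_compose[OF cont(2)] p)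
  moreover have "A (p n) * ?L (p n) - B (p n) = 0" for n
    by (rule AB) (simp add: p_def)
  ultimately show ?thesis by (simp add: LIMSEQ_const_iff)
qed

section \<open>Exponential, Gamma and Stieltjes integrals\<close>

lemma nn_integral_exp_tail:
  assumes "0 < (c::real)"
  shows "(\<integral>\<^sup>+x. ennreal (exp (- c * x)) * indicator {a<..} x \<partial>lborel) = ennreal (exp (- c * a) / c)"
proof -
  have "(\<integral>\<^sup>+x. ennreal (exp (- c * x)) * indicator {a<..} x \<partial>lborel) = (\<integral>\<^sup>+x. ennreal (exp (- c * x)) * indicator {a..} x \<partial>lborel)"
  proof (rule nn_integral_cong_AE)
    show "AE x in lborel. ennreal (exp (- c * x)) * indicator {a<..} x = ennreal (exp (- c * x)) * indicator {a..} x"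
      using AE_lborel_singleton[of a] by eventually_elim (simp add: indicator_def less_le)
  qed
  also have "\<dots> = 0 - (- exp (- c * a) / c)"
  proof (rule nn_integral_FTC_atLeast)
    show "((\<lambda>x. - exp (- c * x) / c) \<longlongrightarrow> 0) at_top" using assms by real_asymp
  qed (use assms in \<open>auto intro!: derivative_eq_intros\<close>)
  finally show ?thesis by simp
qed

lemma nn_integral_exp:
  assumes "0 < (c::real)"
  shows "(\<integral>\<^sup>+x. ennreal (exp (- c * x)) * indicator {0<..} x \<partial>lborel) = ennreal (1 / c)"
  using nn_integral_exp_tail[OF assms, of 0] by simp

lemma nn_integral_powr_exp:
  assumes "0 < (a::real)" "0 < c"
  shows "(\<integral>\<^sup>+r. ennreal (r powr (a - 1) * exp (- c * r)) * indicator {0<..} r \<partial>lborel) = ennreal (Gamma a * c powr (- a))"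
proof -
  have "ennreal (Gamma a) = (\<integral>\<^sup>+t. ennreal (indicator {0..} t * t powr (a - 1) / exp t) \<partial>lborel)"
    by (rule Gamma_conv_nn_integral_real[OF assms(1)])
  also have "\<dots> = ennreal c * (\<integral>\<^sup>+r. ennreal (indicator {0..} (c * r) * (c * r) powr (a - 1) / exp (c * r)) \<partial>lborel)"
    using assms by (subst nn_integral_real_affine[where c=c and t=0]) auto
  also have "(\<integral>\<^sup>+r. ennreal (indicator {0..} (c * r) * (c * r) powr (a - 1) / exp (c * r)) \<partial>lborel)
      = (\<integral>\<^sup>+r. ennreal (c powr (a - 1)) * (ennreal (r powr (a - 1) * exp (- c * r)) * indicator {0<..} r) \<partial>lborel)"
  proof (rule nn_integral_cong_AE, rule AE_mp[OF AE_lborel_singleton[of 0]], rule AE_I2, rule impI)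
    fix r :: real assume "r \<noteq> 0"
    then consider "r < 0" | "r > 0" by linarith
    then show "ennreal (indicator {0..} (c * r) * (c * r) powr (a - 1) / exp (c * r))
        = ennreal (c powr (a - 1)) * (ennreal (r powr (a - 1) * exp (- c * r)) * indicator {0<..} r)"
    proof cases
      case 1
      then have "c * r < 0" using assms by (simp add: mult_pos_neg)
      then show ?thesis using 1 by simp
    next
      case 2
      then have "c * r > 0" using assms by simp
      then show ?thesis using 2 assms
        by (simp add: powr_mult exp_minus divide_inverse mult.assoc ennreal_mult)
    qed
  qed
  also have "\<dots> = ennreal (c powr (a - 1)) * (\<integral>\<^sup>+r. ennreal (r powr (a - 1) * exp (- c * r)) * indicator {0<..} r \<partial>lborel)"
    by (rule nn_integral_cmult) auto
  also have "ennreal c * (ennreal (c powr (a - 1)) * (\<integral>\<^sup>+r. ennreal (r powr (a - 1) * exp (- c * r)) * indicator {0<..} r \<partial>lborel))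
     = ennreal (c powr a) * (\<integral>\<^sup>+r. ennreal (r powr (a - 1) * exp (- c * r)) * indicator {0<..} r \<partial>lborel)" (is "_ = _ * ?I")
  proof -
    have "ennreal c * ennreal (c powr (a - 1)) = ennreal (c powr a)"
      using assms powr_mult_base[of c "a - 1"] by (subst ennreal_mult[symmetric]) auto
    then show ?thesis unfolding mult.assoc[symmetric] by (rule arg_cong)
  qed
  finally have *: "ennreal (Gamma a) = ennreal (c powr a) * ?I" .
  have "ennreal (c powr (- a)) * ennreal (c powr a) = 1"
    using assms by (subst ennreal_mult[symmetric]) (auto simp flip: powr_add)
  then have "?I = ennreal (c powr (- a)) * ennreal (Gamma a)"
    unfolding * mult.assoc[symmetric] by simp
  also have "\<dots> = ennreal (Gamma a * c powr (- a))"
    by (subst mult.commute) (rule ennreal_mult''[symmetric], simp)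
  finally show ?thesis .
qed

lemma Gamma_reflection_real: "Gamma a * Gamma (1 - a) = pi / sin (pi * (a::real))"
proof -
  have "complex_of_real (Gamma a * Gamma (1 - a)) = of_real (pi / sin (pi * a))"
    using Gamma_reflection_complex[of "of_real a"] Gamma_complex_of_real[of a] Gamma_complex_of_real[of "1 - a"]
      sin_of_real[of "pi * a", where 'a=complex] by simp
  then show ?thesis by (simp only: of_real_eq_iff)
qed

lemma sin_pi_mult_pos: "0 < a \<Longrightarrow> a < 1 \<Longrightarrow> 0 < sin (pi * (a::real))"
  by (rule sin_gt_zero) auto

lemma inverse_eq_nn_integral_exp:
  assumes "0 < (c::real)"
  shows "ennreal (1 / c) = (\<integral>\<^sup>+v. ennreal (exp (- c * v)) * indicator {0<..} v \<partial>lborel)"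
  by (rule nn_integral_exp[OF assms, symmetric])

text \<open>Writing \<open>1 / (r + p)\<close> as the integral of \<open>exp (- (r + p) * v)\<close>
  and integrating over \<open>r\<close> first leaves a second Gamma integral in \<open>v\<close>;
  the reflection formula evaluates the product \<open>Gamma g * Gamma (1 - g)\<close>.\<close>

lemma nn_integral_stieltjes:
  assumes g: "0 < g" "g < 1" and p: "0 < p"
  shows "(\<integral>\<^sup>+r. ennreal (r powr (g - 1) / (r + p)) * indicator {0<..} r \<partial>lborel) = ennreal (p powr (g - 1) * (pi / sin (pi * g)))"
proof -
  let ?F = "\<lambda>r v. ennreal (r powr (g - 1) * exp (- (r + p) * v)) * indicator {0<..} r * indicator {0<..} v"
  have "(\<integral>\<^sup>+r. ennreal (r powr (g - 1) / (r + p)) * indicator {0<..} r \<partial>lborel) =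
    (\<integral>\<^sup>+r. \<integral>\<^sup>+v. ?F r v \<partial>lborel \<partial>lborel)"
  proof (rule nn_integral_cong)
    fix r :: real
    show "ennreal (r powr (g - 1) / (r + p)) * indicator {0<..} r =
      (\<integral>\<^sup>+v. ?F r v \<partial>lborel)"
    proof (cases "r > 0")
      case True
      have "ennreal (r powr (g - 1) / (r + p)) = ennreal (r powr (g - 1)) * ennreal (1 / (r + p))"
        using True p by (simp flip: ennreal_mult)
      also have "\<dots> = (\<integral>\<^sup>+v. ennreal (r powr (g - 1)) * (ennreal (exp (- (r + p) * v)) * indicator {0<..} v) \<partial>lborel)"
        using True p by (subst inverse_eq_nn_integral_exp) (auto simp: nn_integral_cmult)
      finally show ?thesis using True by (simp add: ennreal_mult mult.assoc)
    qed simp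
  qed
  also have "\<dots> = (\<integral>\<^sup>+v. \<integral>\<^sup>+r. ?F r v \<partial>lborel \<partial>lborel)"
    by (rule lborel_pair.Fubini') measurable
  also have "\<dots> = (\<integral>\<^sup>+v. ennreal (Gamma g) * (ennreal (v powr ((1 - g) - 1) * exp (- p * v)) * indicator {0<..} v) \<partial>lborel)"
  proof (rule nn_integral_cong)
    fix v :: real
    show "(\<integral>\<^sup>+r. ?F r v \<partial>lborel)
      = ennreal (Gamma g) * (ennreal (v powr ((1 - g) - 1) * exp (- p * v)) * indicator {0<..} v)"
    proof (cases "v > 0")
      case True
      have "(\<integral>\<^sup>+r. ?F r v \<partial>lborel)
        = (\<integral>\<^sup>+r. ennreal (exp (- p * v)) * (ennreal (r powr (g - 1) * exp (- v * r)) * indicator {0<..} r) \<partial>lborel)"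
      proof (rule nn_integral_cong)
          fix r :: real
          have "exp (- (r + p) * v) = exp (- p * v) * exp (- v * r)"
            unfolding exp_add[symmetric] by (simp add: algebra_simps)
          then show "?F r v =
            ennreal (exp (- p * v)) * (ennreal (r powr (g - 1) * exp (- v * r)) * indicator {0<..} r)"
            using True by (simp add: ennreal_mult mult_ac)
        qed
      also have "\<dots> = ennreal (exp (- p * v)) * ennreal (Gamma g * v powr (- g))"
        using True g nn_integral_powr_exp[of g v] by (subst nn_integral_cmult) auto
      finally show ?thesis using True g by (simp add: Gamma_real_pos mult_ac flip: ennreal_mult)
    qed simp
  qed
  also have "\<dots> = ennreal (Gamma g) * ennreal (Gamma (1 - g) * p powr (- (1 - g)))"
    using g p nn_integral_powr_exp[of "1 - g" p] by (subst nn_integral_cmult) auto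
  also have "\<dots> = ennreal (p powr (g - 1) * (pi / sin (pi * g)))"
  proof -
    have "Gamma g * (Gamma (1 - g) * P) = P * (pi / sin (pi * g))" for P
      using Gamma_reflection_real[of g] by (metis mult.assoc mult.commute)
    from this[of "p powr (g - 1)"] have "Gamma g * (Gamma (1 - g) * p powr (- (1 - g))) = p powr (g - 1) * (pi / sin (pi * g))"
      by simp
    then show ?thesis
      using g Gamma_real_pos[of g] by (subst ennreal_mult'[symmetric]) (auto intro: less_imp_le)
  qed
  finally show ?thesis .
qed

section \<open>A completely monotone density\<close>

definition exp_density :: "real \<Rightarrow> real \<Rightarrow> ennreal" where
  "exp_density \<eta> x = ennreal (exp (- \<eta> * x)) * indicator {0<..} x"

lemma exp_density_measurable[measurable]: "exp_density \<eta> \<in> borel_measurable borel"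
  unfolding exp_density_def by measurable

lemma finite_density_exp: "0 < \<eta> \<Longrightarrow> finite_density (exp_density \<eta>)"
  using nn_integral_exp[of \<eta>] unfolding finite_density_def by (simp add: exp_density_def[abs_def])

lemma char_exp_density:
  assumes "0 < \<eta>"
  shows "(of_real \<eta> - \<i> * of_real z) * char (density lborel (exp_density \<eta>)) z = 1"
proof -
  have "(\<lambda>p. of_real \<eta> + p) (- \<i> * of_real z) * char (density lborel (exp_density \<eta>)) z = (\<lambda>_. 1) (- \<i> * complex_of_real z)"
  proof (rule char_density_laplace)
    show "finite_density (exp_density \<eta>)" by (rule finite_density_exp[OF assms])
    fix p :: real assume p: "0 < p"
    have "(\<integral>\<^sup>+x. ennreal (exp (- p * x)) * exp_density \<eta> x \<partial>lborel) = ennreal (1 / (p + \<eta>))"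
    proof -
      have "ennreal (exp (- p * x)) * exp_density \<eta> x = ennreal (exp (- (p + \<eta>) * x)) * indicator {0<..} x" for x
      proof -
        have "exp (- (p + \<eta>) * x) = exp (- p * x) * exp (- \<eta> * x)"
          unfolding exp_add[symmetric] by (simp add: algebra_simps)
        then show ?thesis by (simp add: exp_density_def ennreal_mult mult.assoc)
      qed
      then show ?thesis using assms p by (simp only: nn_integral_exp add_pos_pos)
    qed
    then show "(of_real \<eta> + of_real p) * complex_of_real (enn2real (\<integral>\<^sup>+x. ennreal (exp (- p * x)) * exp_density \<eta> x \<partial>lborel)) = 1"
      using assms p by (simp add: field_simps flip: of_real_add)
  qed (auto intro!: holomorphic_intros continuous_intros simp: exp_density_def)
  then show ?thesis by simp
qed

text \<open>The Stieltjes inverse of \<open>(1 - p powr g) / (1 - p)\<close>.\<close>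
definition stieltjes_density :: "real \<Rightarrow> real \<Rightarrow> ennreal" where
  "stieltjes_density g x = (\<integral>\<^sup>+r. ennreal (sin (pi * g) / pi * (r powr g / (1 + r)) * exp (- r * x)) * indicator {0<..} r \<partial>lborel) * indicator {0<..} x"

lemma stieltjes_density_measurable[measurable]: "stieltjes_density g \<in> borel_measurable borel"
  unfolding stieltjes_density_def by measurable

text \<open>The exponent \<open>g = 2 * \<alpha> - 1\<close> is 0 when \<alpha> = 1/2: the factor
  \<open>sin (pi * g)\<close> then makes the density vanish, in agreement with
  \<open>1 - p powr 0 = 0\<close>.\<close>

lemma stieltjes_density_0: "stieltjes_density 0 x = 0"
  by (simp add: stieltjes_density_def)

text \<open>One application of Tonelli with two parameters serves three times:
  \<open>p = a = 0\<close> gives the mass, \<open>a = 0\<close> the Laplace transform and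
  \<open>p = 0\<close> the tail.\<close>

lemma stieltjes_density_exp_tail:
  assumes g: "0 \<le> g" "g < 1" and p: "0 \<le> p" and a: "0 \<le> a"
  shows "(\<integral>\<^sup>+x. ennreal (exp (- p * x)) * stieltjes_density g x * indicator {a<..} x \<partial>lborel) =
    (\<integral>\<^sup>+r. ennreal (sin (pi * g) / pi * (r powr g / ((1 + r) * (r + p))) * exp (- (r + p) * a)) * indicator {0<..} r \<partial>lborel)"
proof -
  let ?F = "\<lambda>x r. ennreal (sin (pi * g) / pi * (r powr g / (1 + r)) * exp (- (r + p) * x)) * indicator {0<..} r * indicator {a<..} x"
  let ?G = "\<lambda>r. ennreal (sin (pi * g) / pi * (r powr g / ((1 + r) * (r + p))) * exp (- (r + p) * a)) * indicator {0<..} r"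
  have s: "0 \<le> sin (pi * g)" using g by (intro sin_ge_zero) auto
  have "(\<integral>\<^sup>+x. ennreal (exp (- p * x)) * stieltjes_density g x * indicator {a<..} x \<partial>lborel) =
    (\<integral>\<^sup>+x. \<integral>\<^sup>+r. ?F x r \<partial>lborel \<partial>lborel)"
  proof (rule nn_integral_cong)
    fix x :: real
    show "ennreal (exp (- p * x)) * stieltjes_density g x * indicator {a<..} x =
      (\<integral>\<^sup>+r. ?F x r \<partial>lborel)"
    proof (cases "x > a")
      case True
      then have x: "x > 0" using a by simp
      have "ennreal (exp (- p * x)) * stieltjes_density g x =
         (\<integral>\<^sup>+r. ennreal (exp (- p * x)) * (ennreal (sin (pi * g) / pi * (r powr g / (1 + r)) * exp (- r * x)) * indicator {0<..} r) \<partial>lborel)"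
        using x by (subst nn_integral_cmult) (auto simp: stieltjes_density_def)
      also have "\<dots> = (\<integral>\<^sup>+r. ennreal (sin (pi * g) / pi * (r powr g / (1 + r)) * exp (- (r + p) * x)) * indicator {0<..} r \<partial>lborel)"
      proof (rule nn_integral_cong)
        fix r :: real
        have "exp (- (r + p) * x) = exp (- p * x) * exp (- r * x)"
          unfolding exp_add[symmetric] by (simp add: algebra_simps)
        then show "ennreal (exp (- p * x)) * (ennreal (sin (pi * g) / pi * (r powr g / (1 + r)) * exp (- r * x)) * indicator {0<..} r)
          = ennreal (sin (pi * g) / pi * (r powr g / (1 + r)) * exp (- (r + p) * x)) * indicator {0<..} r"
          using s by (cases "r > 0") (simp_all add: mult_ac flip: ennreal_mult')
      qed
      finally show ?thesis using True by simp
    qed simp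
  qed
  also have "\<dots> = (\<integral>\<^sup>+r. \<integral>\<^sup>+x. ?F x r \<partial>lborel \<partial>lborel)"
    by (rule lborel_pair.Fubini') measurable
  also have "\<dots> = (\<integral>\<^sup>+r. ?G r \<partial>lborel)"
  proof (rule nn_integral_cong)
    fix r :: real
    show "(\<integral>\<^sup>+x. ?F x r \<partial>lborel)
      = ?G r"
    proof (cases "r > 0")
      case True
      have "(\<integral>\<^sup>+x. ?F x r \<partial>lborel)
        = (\<integral>\<^sup>+x. ennreal (sin (pi * g) / pi * (r powr g / (1 + r))) * (ennreal (exp (- (r + p) * x)) * indicator {a<..} x) \<partial>lborel)"
        using True s by (intro nn_integral_cong) (simp add: mult.assoc[symmetric] flip: ennreal_mult)
      also have "\<dots> = ennreal (sin (pi * g) / pi * (r powr g / (1 + r))) * ennreal (exp (- (r + p) * a) / (r + p))"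
        using True p nn_integral_exp_tail[of "r + p" a] by (subst nn_integral_cmult) auto
      also have "\<dots> = ennreal (sin (pi * g) / pi * (r powr g / ((1 + r) * (r + p))) * exp (- (r + p) * a))"
        using True p s by (subst ennreal_mult[symmetric]) auto
      finally show ?thesis using True by simp
    qed simp
  qed
  finally show ?thesis .
qed

lemma stieltjes_density_indicator: "stieltjes_density g x * indicator {0<..} x = stieltjes_density g x"
  by (simp add: stieltjes_density_def indicator_def)

lemma stieltjes_density_mass:
  assumes g: "0 < g" "g < 1"
  shows "(\<integral>\<^sup>+x. stieltjes_density g x \<partial>lborel) = 1"
proof -
  have s: "0 < sin (pi * g)" using g by (rule sin_pi_mult_pos)
  have "(\<integral>\<^sup>+x. stieltjes_density g x \<partial>lborel) =
    (\<integral>\<^sup>+r. ennreal (sin (pi * g) / pi) * (ennreal (r powr (g - 1) / (r + 1)) * indicator {0<..} r) \<partial>lborel)"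
  proof -
    have eq: "ennreal (sin (pi * g) / pi * (r powr g / ((1 + r) * (r + 0))) * exp (- (r + 0) * 0)) * indicator {0<..} r
      = ennreal (sin (pi * g) / pi) * (ennreal (r powr (g - 1) / (r + 1)) * indicator {0<..} r)" for r :: real
    proof (cases "r > 0")
      case True
      then have "r powr g / ((1 + r) * (r + 0)) = r powr (g - 1) / (r + 1)"
        by (simp add: powr_diff add.commute)
      then show ?thesis using True s by (simp del: add_0_right flip: ennreal_mult)
    qed simp
    have "(\<integral>\<^sup>+x. stieltjes_density g x \<partial>lborel) = (\<integral>\<^sup>+x. ennreal (exp (- 0 * x)) * stieltjes_density g x * indicator {0<..} x \<partial>lborel)"
      by (simp add: stieltjes_density_indicator)
    then show ?thesis
      using g by (simp only: stieltjes_density_exp_tail eq order_refl less_imp_le)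
  qed
  also have "\<dots> = ennreal (sin (pi * g) / pi) * ennreal (pi / sin (pi * g))"
    using nn_integral_stieltjes[of g 1] g by (subst nn_integral_cmult) auto
  also have "\<dots> = 1" using s by (simp flip: ennreal_mult)
  finally show ?thesis .
qed

lemma finite_density_stieltjes:
  assumes "0 \<le> g" "g < 1"
  shows "finite_density (stieltjes_density g)"
  using assms stieltjes_density_mass[of g] by (cases "g = 0") (auto simp: finite_density_def stieltjes_density_0)

text \<open>Partial fractions split \<open>r powr (g - 1) / (r + 1)\<close> into multiples of the
  kernel of the transform and of \<open>r powr (g - 1) / (r + p)\<close>. The two Stieltjes
  integrals are known, which leaves \<open>?c = (1 - p) * k + p powr g * ?c\<close> for the missing
  one; \<open>p < 1\<close> keeps the coefficients positive.\<close>

lemma stieltjes_density_laplace: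
  assumes g: "0 \<le> g" "g < 1" and p: "0 < p" "p < 1"
  shows "(\<integral>\<^sup>+x. ennreal (exp (- p * x)) * stieltjes_density g x \<partial>lborel) = ennreal ((1 - p powr g) / (1 - p))"
proof (cases "g = 0")
  case False
  with g have g: "0 < g" "g < 1" by auto
  let ?c = "pi / sin (pi * g)"
  have s: "0 < sin (pi * g)" using g by (rule sin_pi_mult_pos)
  let ?K = "\<integral>\<^sup>+r. ennreal (r powr g / ((1 + r) * (r + p))) * indicator {0<..} r \<partial>lborel"
  have le1: "p powr g \<le> 1" using p g by (intro powr_le1) auto
  have "ennreal ?c = (\<integral>\<^sup>+r. ennreal (r powr (g - 1) / (r + 1)) * indicator {0<..} r \<partial>lborel)"
    using nn_integral_stieltjes[of g 1] g by simp
  also have "\<dots> = (\<integral>\<^sup>+r. ennreal (1 - p) * (ennreal (r powr g / ((1 + r) * (r + p))) * indicator {0<..} r)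
      + ennreal p * (ennreal (r powr (g - 1) / (r + p)) * indicator {0<..} r) \<partial>lborel)"
  proof (rule nn_integral_cong)
    fix r :: real
    show "ennreal (r powr (g - 1) / (r + 1)) * indicator {0<..} r = ennreal (1 - p) * (ennreal (r powr g / ((1 + r) * (r + p))) * indicator {0<..} r)
      + ennreal p * (ennreal (r powr (g - 1) / (r + p)) * indicator {0<..} r)"
    proof (cases "r > 0")
      case True
      have "r powr g = r * r powr (g - 1)" using True by (simp add: powr_diff)
      moreover have "1 + r \<noteq> 0" "r + 1 \<noteq> 0" "r + p \<noteq> 0" using True p by auto
      ultimately have "r powr (g - 1) / (r + 1) = (1 - p) * (r powr g / ((1 + r) * (r + p))) + p * (r powr (g - 1) / (r + p))"
        by (simp add: divide_simps) (simp add: algebra_simps)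
      then show ?thesis using True p by (simp flip: ennreal_mult ennreal_plus)
    qed simp
  qed
  also have "\<dots> = ennreal (1 - p) * ?K + ennreal p * ennreal (p powr (g - 1) * ?c)"
    using p g by (simp add: nn_integral_add nn_integral_cmult nn_integral_stieltjes)
  also have "ennreal p * ennreal (p powr (g - 1) * ?c) = ennreal (p powr g * ?c)"
    using p s by (simp add: powr_diff flip: ennreal_mult)
  finally have *: "ennreal ?c = ennreal (1 - p) * ?K + ennreal (p powr g * ?c)" .
  \<comment> \<open>Finiteness is read off from the equation, whose other terms are finite and whose
    coefficient \<open>1 - p\<close> is positive.\<close>
  have "?K < \<infinity>"
  proof (rule ccontr)
    assume "\<not> ?K < \<infinity>"
    then have "?K = \<infinity>" unfolding infinity_ennreal_def by (simp only: less_top[symmetric] not_not)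
    with * p show False by (simp add: ennreal_mult_top)
  qed
  then obtain k where k: "?K = ennreal k" "0 \<le> k" by (cases ?K) auto
  have "?c = (1 - p) * k + p powr g * ?c"
  proof -
    have "ennreal ((1 - p) * k + p powr g * ?c) = ennreal (1 - p) * ennreal k + ennreal (p powr g * ?c)"
      using p k(2) s by (simp add: ennreal_plus ennreal_mult)
    then have eq: "ennreal ?c = ennreal ((1 - p) * k + p powr g * ?c)" unfolding * k(1) by (rule sym)
    have nn: "0 \<le> ?c" "0 \<le> (1 - p) * k + p powr g * ?c" using p k(2) s by auto
    show ?thesis using eq unfolding ennreal_inj[OF nn] .
  qed
  then have "(1 - p) * k = (1 - p powr g) * ?c" unfolding left_diff_distrib by linarith
  then have kk: "k = (1 - p powr g) / (1 - p) * ?c" 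
    using p by (metis (no_types) diff_gt_0_iff_gt less_irrefl nonzero_mult_div_cancel_left times_divide_eq_left)
  have "(\<integral>\<^sup>+x. ennreal (exp (- p * x)) * stieltjes_density g x \<partial>lborel)
      = (\<integral>\<^sup>+r. ennreal (sin (pi * g) / pi) * (ennreal (r powr g / ((1 + r) * (r + p))) * indicator {0<..} r) \<partial>lborel)"
  proof -
    have eq: "ennreal (sin (pi * g) / pi * (r powr g / ((1 + r) * (r + p))) * exp (- (r + p) * 0)) * indicator {0<..} r
      = ennreal (sin (pi * g) / pi) * (ennreal (r powr g / ((1 + r) * (r + p))) * indicator {0<..} r)" for r :: real
      using s p by (cases "r > 0") (simp_all add: mult.assoc[symmetric] flip: ennreal_mult)
    have "(\<integral>\<^sup>+x. ennreal (exp (- p * x)) * stieltjes_density g x \<partial>lborel) = (\<integral>\<^sup>+x. ennreal (exp (- p * x)) * stieltjes_density g x * indicator {0<..} x \<partial>lborel)"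
      by (simp add: mult.assoc stieltjes_density_indicator)
    then show ?thesis
      using g p by (simp only: stieltjes_density_exp_tail eq order_refl less_imp_le)
  qed
  also have "\<dots> = ennreal (sin (pi * g) / pi) * ?K" by (rule nn_integral_cmult) measurable
  also have "\<dots> = ennreal ((1 - p powr g) / (1 - p))"
    using s k unfolding k by (simp add: kk flip: ennreal_mult)
  finally show ?thesis .
qed (use p in \<open>simp add: stieltjes_density_0\<close>)

lemma char_stieltjes_density:
  assumes g: "0 \<le> g" "g < 1" and z: "z \<noteq> 0"
  shows "(1 + \<i> * of_real z) * char (density lborel (stieltjes_density g)) z = 1 - (- \<i> * of_real z) powr of_real g"
proof -
  have "(\<lambda>p. 1 - p) (- \<i> * of_real z) * char (density lborel (stieltjes_density g)) z = (\<lambda>p. 1 - p powr of_real g) (- \<i> * complex_of_real z)"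
  proof (rule char_density_laplace)
    show "finite_density (stieltjes_density g)" by (rule finite_density_stieltjes[OF g])
    show "(\<lambda>p. 1 - p powr complex_of_real g) holomorphic_on {p. 0 < Re p}"
      by (intro holomorphic_intros) (auto simp: complex_nonpos_Reals_iff)
    show "isCont (\<lambda>p. 1 - p powr complex_of_real g) (- \<i> * complex_of_real z)"
      using z by (intro continuous_intros) (auto simp: complex_nonpos_Reals_iff)
    fix p :: real assume p: "0 < p" "p < 1"
    have "p powr g \<le> 1" using p g by (intro powr_le1) auto
    then show "(1 - complex_of_real p) * complex_of_real (enn2real (\<integral>\<^sup>+x. ennreal (exp (- p * x)) * stieltjes_density g x \<partial>lborel)) = 1 - of_real p powr of_real g"
      using p g unfolding stieltjes_density_laplace[OF g p] by (simp add: powr_of_real field_simps)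
  qed (auto intro!: holomorphic_intros continuous_intros simp: stieltjes_density_def)
  then show ?thesis by simp
qed

section \<open>The resolvent equation\<close>

abbreviation dconv :: "(real \<Rightarrow> ennreal) \<Rightarrow> (real \<Rightarrow> ennreal) \<Rightarrow> real \<Rightarrow> ennreal" where
  "dconv f g \<equiv> mconv f (density lborel g)"

lemma finite_density_dconv: "finite_density f \<Longrightarrow> finite_density g \<Longrightarrow> finite_density (dconv f g)"
  by (intro finite_density_mconv finite_measure_density_lborel) auto

lemma char_dconv:
  "finite_density f \<Longrightarrow> finite_density g \<Longrightarrow>
    char (density lborel (dconv f g)) z = char (density lborel f) z * char (density lborel g) z"
  by (intro char_mconv finite_measure_density_lborel) auto

lemma dconv_nonpos:
  assumes f: "\<And>x. x \<le> 0 \<Longrightarrow> f x = 0" and g: "\<And>x. x \<le> 0 \<Longrightarrow> g x = 0"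
    and "f \<in> borel_measurable borel" "g \<in> borel_measurable borel" and x: "x \<le> 0"
  shows "dconv f g x = 0"
proof -
  note [measurable] = assms(3,4)
  have "dconv f g x = (\<integral>\<^sup>+y. g y * f (x - y) \<partial>lborel)"
    unfolding mconv_def by (subst nn_integral_density) auto
  moreover have "\<And>y. g y * f (x - y) = 0"
    using f g x by (metis diff_mono diff_zero le_cases mult_zero_left mult_zero_right order_trans)
  ultimately show ?thesis by simp
qed

text \<open>The logarithms of \<open>i z\<close> and \<open>- i z\<close> differ by
  \<open>i * pi\<close>; this produces the factor that links the powers entering the transforms of
  \<open>w\<close> at \<open>- z\<close> and at \<open>z\<close>.\<close>

lemma imag_powr:
  assumes "z > 0"
  shows "(\<i> * complex_of_real z) powr of_real a = (- \<i> * of_real z) powr of_real a * exp (\<i> * of_real (pi * a))"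
    and "(- \<i> * complex_of_real z) powr of_real a = of_real (z powr a) * exp (- \<i> * of_real (pi * a / 2))"
proof -
  have z: "complex_of_real z \<noteq> 0" "\<i> * complex_of_real z \<noteq> 0" "- \<i> * complex_of_real z \<noteq> 0" using assms by auto
  have L1: "Ln (\<i> * complex_of_real z) = of_real (ln z) + \<i> * of_real (pi / 2)"
    using assms Ln_times_of_real[of z \<i>] by (simp add: Ln_of_real mult.commute)
  have L2: "Ln (- \<i> * complex_of_real z) = of_real (ln z) - \<i> * of_real (pi / 2)"
    using assms Ln_times_of_real[of z "-\<i>"] by (simp add: Ln_of_real mult.commute)
  show "(\<i> * complex_of_real z) powr of_real a = (- \<i> * of_real z) powr of_real a * exp (\<i> * of_real (pi * a))"
    using z by (simp only: powr_def L1 L2 if_False) (simp add: algebra_simps flip: exp_add)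
  show "(- \<i> * complex_of_real z) powr of_real a = of_real (z powr a) * exp (- \<i> * of_real (pi * a / 2))"
  proof -
    have "complex_of_real (z powr a) = exp (of_real a * of_real (ln z))"
      using assms by (simp add: powr_def exp_of_real flip: of_real_mult)
    moreover have "(- \<i> * complex_of_real z) powr of_real a = exp (of_real a * (of_real (ln z) - \<i> * of_real (pi / 2)))"
      using z by (simp only: powr_def L2 if_False)
    ultimately show ?thesis by (simp add: algebra_simps flip: exp_add)
  qed
qed

text \<open>Writing \<open>p = - i z\<close>, the assumption on \<open>U\<close> says that its characteristic function is
  \<open>1 / (1 - p powr \<alpha> * exp (- i \<pi> \<alpha>))\<close>. The two densities below have transforms \<open>A\<close> and \<open>B\<close> with
  \<open>A - B = (1 - 2 cos (\<pi> \<alpha>) p powr \<alpha> + p powr (2 \<alpha>)) / ((1 + p) * (\<eta> + p))\<close>; the numerator is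
  \<open>(1 - p powr \<alpha> * exp (- i \<pi> \<alpha>)) * (1 - (i z) powr \<alpha>)\<close>.\<close>
lemma resolvent_equation:
  fixes \<alpha> \<eta> :: real and U :: "real measure"
  assumes \<alpha>: "1 / 2 \<le> \<alpha>" "\<alpha> < 1" and \<eta>: "0 < \<eta>"
    and U: "finite_measure U" "sets U = sets borel"
    and charU: "\<And>z. z > 0 \<Longrightarrow> char U z * (1 - (- \<i> * of_real z) powr of_real \<alpha> * exp (- \<i> * of_real (pi * \<alpha>))) = 1"
  obtains a b where "finite_density a" "finite_density b" "\<And>x. x \<le> 0 \<Longrightarrow> a x = 0" "\<And>x. x \<le> 0 \<Longrightarrow> b x = 0"
    "AE y in lborel. mconv a U y = (\<integral>\<^sup>+i. exp_density \<eta> (y + i) * stieltjes_density \<alpha> i \<partial>lborel) + mconv b U y"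
proof -
  define e d w w' where "e = exp_density 1" and "d = exp_density \<eta>"
    and "w = stieltjes_density \<alpha>" and "w' = stieltjes_density (2 * \<alpha> - 1)"
  have fe: "finite_density e" "finite_density d" using \<eta> by (simp_all add: e_def d_def finite_density_exp)
  have fw: "finite_density w" "finite_density w'" using \<alpha> by (simp_all add: w_def w'_def finite_density_stieltjes)
  have zero: "e x = 0" "d x = 0" "w x = 0" "w' x = 0" if "x \<le> 0" for x
    using that by (simp_all add: e_def d_def w_def w'_def exp_density_def stieltjes_density_def)
  note [measurable] = fe[THEN finite_density_measurable] fw[THEN finite_density_measurable]
  \<comment> \<open>Coefficient of \<open>p powr \<alpha>\<close> in the numerator. It is
    nonnegative because \<open>pi * \<alpha>\<close> lies between \<open>pi / 2\<close> and
    \<open>pi\<close>, where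
    \<open>- cos (pi * \<alpha>) = sin (pi * \<alpha> - pi / 2)\<close>.\<close>
  define c where "c = - 2 * cos (pi * \<alpha>)"
  have c: "0 \<le> c"
  proof -
    have "pi * \<alpha> \<le> pi * 1" "pi * (1 / 2) \<le> pi * \<alpha>" using \<alpha> by (intro mult_left_mono; simp)+
    then have "0 \<le> sin (pi * \<alpha> - pi / 2)" using pi_gt_zero by (intro sin_ge_zero) linarith+
    then show ?thesis by (simp add: c_def sin_diff)
  qed
  \<comment> \<open>Obtained from \<open>(1 + c * P + p * P') * E * D\<close> by replacing
    \<open>P * E\<close> with \<open>E + W - 2 * W * E\<close>, \<open>P' * E\<close> with
    \<open>E + W' - 2 * W' * E\<close> and \<open>p * D\<close> with \<open>1 - \<eta> * D\<close>.
    The positive terms of the expansion form \<open>a\<close>, the negative ones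
    \<open>b\<close>.\<close>
  define a where "a x = dconv e d x + (ennreal c * (dconv e d x + dconv w d x) + (e x + w' x + ennreal (2 * \<eta>) * dconv w' (dconv e d) x))" for x
  define b where "b x = ennreal (2 * c) * dconv w (dconv e d) x + (ennreal 2 * dconv w' e x + ennreal \<eta> * (dconv e d x + dconv w' d x))" for x
  note fin = finite_density_add finite_density_cmult finite_density_dconv fe fw
  have fa: "finite_density a" unfolding a_def by (intro fin)
  have fb: "finite_density b" unfolding b_def by (intro fin)
  note [measurable] = fa[THEN finite_density_measurable] fb[THEN finite_density_measurable]
  have dz: "dconv f g x = 0" if "finite_density f" "finite_density g"
    "\<And>x. x \<le> 0 \<Longrightarrow> f x = 0" "\<And>x. x \<le> 0 \<Longrightarrow> g x = 0" "x \<le> 0" for f g x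
    using that by (intro dconv_nonpos) (auto dest: finite_density_measurable)
  have a0: "a x = 0" and b0: "b x = 0" if "x \<le> 0" for x
    unfolding a_def b_def using that by (simp_all add: dz fin zero)
  \<comment> \<open>The boundary function of the overview at \<open>- y\<close>: reflecting
    \<open>w\<close> puts its transform at \<open>- z\<close>, which is the factor \<open>V\<close>
    from the other half-plane.\<close>
  define l where "l = dconv d (\<lambda>x. w (- x))"
  have fl: "finite_density l" unfolding l_def by (intro fin finite_density_reflect)
  have l: "l y = (\<integral>\<^sup>+i. exp_density \<eta> (y + i) * stieltjes_density \<alpha> i \<partial>lborel)" for y
  proof -
    have "l y = (\<integral>\<^sup>+x. w (- x) * d (y - x) \<partial>lborel)"
      unfolding l_def mconv_def by (subst nn_integral_density) auto
    also have "\<dots> = (\<integral>\<^sup>+i. d (y + i) * w i \<partial>lborel)"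
      by (subst nn_integral_real_affine[of _ "-1" 0]) (auto simp: mult.commute)
    finally show ?thesis by (simp add: d_def w_def)
  qed
  note fU = finite_density_mconv[OF _ U]
  have "AE y in lborel. mconv a U y = l y + mconv b U y"
  proof (rule char_density_unique)
    show "finite_density (mconv a U)" by (rule fU[OF fa])
    show "finite_density (\<lambda>y. l y + mconv b U y)" by (intro fin fl fU fb)
    fix z :: real assume z: "z > 0"
    define p where "p = - \<i> * complex_of_real z"
    define P P' Q where "P = p powr of_real \<alpha>" and "P' = p powr of_real (2 * \<alpha> - 1)" and "Q = exp (\<i> * of_real (pi * \<alpha>))"
    define A B E D W W' V Uz where "A = char (density lborel a) z" and "B = char (density lborel b) z"
      and "E = char (density lborel e) z" and "D = char (density lborel d) z" and "W = char (density lborel w) z"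
      and "W' = char (density lborel w') z" and "V = char (density lborel w) (- z)" and "Uz = char U z"
    have p0: "p \<noteq> 0" using z by (simp add: p_def)
    have p1: "1 - p \<noteq> 0" "1 + p \<noteq> 0" "of_real \<eta> + p \<noteq> 0" using \<eta> by (auto simp: p_def complex_eq_iff)
    have E1: "(1 + p) * E = 1" using char_exp_density[of 1 z] by (simp add: p_def E_def e_def)
    have D1: "(of_real \<eta> + p) * D = 1" using char_exp_density[OF \<eta>, of z] by (simp add: p_def D_def d_def)
    have W1: "(1 - p) * W = 1 - P" using char_stieltjes_density[of \<alpha> z] \<alpha> z by (simp add: p_def W_def w_def P_def)
    have W'1: "(1 - p) * W' = 1 - P'" using char_stieltjes_density[of "2 * \<alpha> - 1" z] \<alpha> z by (simp add: p_def W'_def w'_def P'_def)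
    have V1: "(1 + p) * V = 1 - P * Q"
      using char_stieltjes_density[of \<alpha> "- z"] \<alpha> z imag_powr(1)[OF z, of \<alpha>] by (simp add: p_def V_def w_def P_def Q_def)
    have Q: "Q \<noteq> 0" "exp (- \<i> * of_real (pi * \<alpha>)) = inverse Q" by (auto simp: Q_def exp_minus[symmetric])
    have U1: "Uz * (1 - P * inverse Q) = 1" using charU[OF z] unfolding p_def[symmetric] P_def[symmetric] Q(2) Uz_def .
    have Qc: "Q + inverse Q = - of_real c"
    proof -
      have "Q = cis (pi * \<alpha>)" by (simp add: Q_def cis_conv_exp)
      then show ?thesis by (simp add: complex_eq_iff c_def cis_inverse)
    qed
    have PP: "P * P = p * P'"
    proof -
      have "P * P = p powr (of_real \<alpha> + of_real \<alpha>)" by (simp only: P_def powr_add)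
      also have "complex_of_real \<alpha> + of_real \<alpha> = 1 + of_real (2 * \<alpha> - 1)" by simp
      also have "p powr (1 + of_real (2 * \<alpha> - 1)) = p * P'" using p0 by (simp only: powr_add P'_def powr_to_1)
      finally show ?thesis .
    qed
    \<comment> \<open>Here \<open>P = 1 - (1 - p) * W\<close> and
      \<open>(1 - p) * E = 2 * E - 1\<close>, so that the unbounded factor \<open>P\<close> is
      absorbed by \<open>E\<close>.\<close>
    have X1: "E + W - 2 * W * E = P * E"
    proof -
      have "(1 + p) * (E + W - 2 * W * E) = (1 + p) * E + (1 + p) * W - 2 * W * ((1 + p) * E)" by (simp add: algebra_simps)
      also have "\<dots> = 1 - (1 - p) * W" unfolding E1 by (simp add: algebra_simps)
      also have "\<dots> = (1 + p) * (P * E)" using E1 unfolding W1 by (simp add: mult.left_commute)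
      finally show ?thesis using p1 by simp
    qed
    have X2: "E + W' - 2 * W' * E = P' * E"
    proof -
      have "(1 + p) * (E + W' - 2 * W' * E) = (1 + p) * E + (1 + p) * W' - 2 * W' * ((1 + p) * E)" by (simp add: algebra_simps)
      also have "\<dots> = 1 - (1 - p) * W'" unfolding E1 by (simp add: algebra_simps)
      also have "\<dots> = (1 + p) * (P' * E)" using E1 unfolding W'1 by (simp add: mult.left_commute)
      finally show ?thesis using p1 by simp
    qed
    have D2: "1 - of_real \<eta> * D = p * D" using D1 by (simp add: algebra_simps)
    have A: "A = E * D + (of_real c * (E * D + W * D) + (E + W' + of_real (2 * \<eta>) * (W' * (E * D))))"
      unfolding A_def a_def[abs_def] using c \<eta>
      by (simp only: char_density_add char_density_cmult char_dconv fin E_def D_def W_def W'_def mult_nonneg_nonneg zero_le_numeral less_imp_le)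
    have B: "B = of_real (2 * c) * (W * (E * D)) + (of_real 2 * (W' * E) + of_real \<eta> * (E * D + W' * D))"
      unfolding B_def b_def[abs_def] using c \<eta>
      by (simp only: char_density_add char_density_cmult char_dconv fin E_def D_def W_def W'_def mult_nonneg_nonneg zero_le_numeral less_imp_le)
    have "A - B = E * D + of_real c * D * (E + W - 2 * W * E) + (E + W' - 2 * W' * E) * (1 - of_real \<eta> * D)"
      unfolding A B by (simp add: algebra_simps)
    also have "\<dots> = (1 + of_real c * P + P * P) * (E * D)" unfolding X1 X2 D2 PP by (simp add: algebra_simps)
    also have "1 + of_real c * P + P * P = (1 - P * inverse Q) * (1 - P * Q)"
    proof -
      have "(1 - P * inverse Q) * (1 - P * Q) = 1 - P * (Q + inverse Q) + P * P * (Q * inverse Q)" by (simp add: algebra_simps)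
      then show ?thesis using Q(1) unfolding Qc by simp
    qed
    also have "(1 - P * inverse Q) * (1 - P * Q) * (E * D) = (1 - P * inverse Q) * (((1 + p) * E) * (V * D))"
      unfolding V1[symmetric] by (simp add: mult_ac)
    finally have AB: "A - B = (1 - P * inverse Q) * (V * D)" unfolding E1 by simp
    \<comment> \<open>The transform of \<open>U\<close> is the reciprocal of
      \<open>1 - P * inverse Q\<close>, so it removes that factor from \<open>A - B\<close> and
      leaves only \<open>D * V\<close>, the transform of \<open>l\<close>.\<close>
    have "A * Uz = (A - B) * Uz + B * Uz" by (simp add: algebra_simps)
    also have "(A - B) * Uz = (Uz * (1 - P * inverse Q)) * (V * D)" unfolding AB by (simp add: mult_ac)
    finally have main: "A * Uz = D * V + B * Uz" unfolding U1 by (simp add: mult.commute)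
    have "char (density lborel l) z = D * V"
      unfolding l_def by (simp add: char_dconv fin finite_density_reflect char_density_reflect D_def V_def)
    then show "char (density lborel (mconv a U)) z = char (density lborel (\<lambda>y. l y + mconv b U y)) z"
      using main by (simp add: char_density_add char_mconv U fa fb fl fU A_def B_def Uz_def)
  qed
  then show ?thesis using that[OF fa fb a0 b0] by (simp add: l)
qed

section \<open>Stopping a right-continuous process on dyadic grids\<close>

lemma dyadic_between:
  assumes "0 \<le> s" "s < (t::real)"
  obtains n k :: nat where "s < real k / 2 ^ n" "real k / 2 ^ n < t"
proof -
  obtain n where n: "1 / (t - s) < 2 ^ n" using real_arch_pow[of 2] by auto
  have 1: "1 < (t - s) * 2 ^ n" using n assms by (simp add: field_simps)
  define k where "k = nat (\<lfloor>s * 2 ^ n\<rfloor> + 1)"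
  have k: "real k = of_int \<lfloor>s * 2 ^ n\<rfloor> + 1" using assms by (simp add: k_def)
  have "s * 2 ^ n < real k" "real k \<le> s * 2 ^ n + 1" unfolding k by linarith+
  then show ?thesis using 1 by (intro that[of k n]) (auto simp: field_simps)
qed

text \<open>\<open>markov\<close> is the Markov property at grid times for events of the grid
  history; all stopping below happens on grids, so no filtration and no strong Markov property
  enter. Right-continuity is demanded of every path, which spares exceptional sets;
  \<open>stable_exit_version\<close> supplies such a version.\<close>

locale right_continuous_process = prob_space M for M :: "'a measure" +
  fixes Y :: "real \<Rightarrow> 'a \<Rightarrow> real" and q :: real
  assumes meas: "(\<lambda>(s, \<omega>). Y s \<omega>) \<in> borel_measurable (borel \<Otimes>\<^sub>M M)"
    and rcont: "\<And>\<omega> s. \<omega> \<in> space M \<Longrightarrow> 0 \<le> s \<Longrightarrow> ((\<lambda>t. Y t \<omega>) \<longlongrightarrow> Y s \<omega>) (at_right s)"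
    and markov: "\<And>h s k B g. 0 < h \<Longrightarrow> 0 \<le> s \<Longrightarrow> B \<in> sets (Pi\<^sub>M {..k} (\<lambda>_. borel)) \<Longrightarrow>
      (g :: real \<Rightarrow> ennreal) \<in> borel_measurable borel \<Longrightarrow>
      (\<integral>\<^sup>+\<omega>. indicator B (\<lambda>j\<in>{..k}. Y (real j * h) \<omega>) * g (Y (real k * h + s) \<omega>) \<partial>M) =
      (\<integral>\<^sup>+\<omega>. indicator B (\<lambda>j\<in>{..k}. Y (real j * h) \<omega>) * (\<integral>\<^sup>+\<omega>'. g (Y (real k * h) \<omega> + Y s \<omega>') \<partial>M) \<partial>M)"
    and q: "0 < q"
begin

lemma measurable_Y[measurable (raw)]:
  "f \<in> borel_measurable N \<Longrightarrow> g \<in> measurable N M \<Longrightarrow> (\<lambda>x. Y (f x) (g x)) \<in> borel_measurable N"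
  using measurable_compose[OF measurable_Pair meas, of f N g] by simp

definition hit :: "real \<Rightarrow> nat \<Rightarrow> nat \<Rightarrow> 'a \<Rightarrow> bool" where
  "hit y n k \<omega> \<longleftrightarrow> y + Y (real k / 2 ^ n) \<omega> \<le> 0"

definition first_hit :: "real \<Rightarrow> nat \<Rightarrow> nat \<Rightarrow> 'a \<Rightarrow> bool" where
  "first_hit y n k \<omega> \<longleftrightarrow> hit y n k \<omega> \<and> (\<forall>j<k. \<not> hit y n j \<omega>)"

lemma measurable_hit[measurable]: "Measurable.pred M (hit y n k)" "Measurable.pred M (first_hit y n k)"
  unfolding hit_def[abs_def] first_hit_def[abs_def] by measurable

lemma first_hit_unique: "first_hit y n k \<omega> \<Longrightarrow> first_hit y n j \<omega> \<Longrightarrow> k = j"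
  unfolding first_hit_def by (metis linorder_neqE_nat)

lemma hit_first_hit: "hit y n k \<omega> \<Longrightarrow> \<exists>j\<le>k. first_hit y n j \<omega>"
  unfolding first_hit_def by (induction k rule: less_induct) (metis le_less_trans less_imp_le order_refl)

lemma hit_refine: "n \<le> m \<Longrightarrow> hit y n k \<omega> \<Longrightarrow> hit y m (k * 2 ^ (m - n)) \<omega>"
  and refine_eq: "n \<le> m \<Longrightarrow> real (k * 2 ^ (m - n)) / 2 ^ m = real k / 2 ^ n"
proof -
  assume "n \<le> m"
  then show *: "real (k * 2 ^ (m - n)) / 2 ^ m = real k / 2 ^ n"
    by (auto dest!: le_Suc_ex simp: power_add)
  show "hit y n k \<omega> \<Longrightarrow> hit y m (k * 2 ^ (m - n)) \<omega>" unfolding hit_def * .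
qed

lemma suminf_first_hit:
  fixes c :: "nat \<Rightarrow> ennreal"
  assumes "first_hit y n k \<omega>"
  shows "(\<Sum>j. indicator {\<omega>. first_hit y n j \<omega>} \<omega> * c j) = c k"
proof -
  have "indicator {\<omega>. first_hit y n j \<omega>} \<omega> * c j = (if j = k then c j else 0)" for j
  proof (cases "j = k")
    case False
    then have "\<not> first_hit y n j \<omega>" using assms first_hit_unique by blast
    then show ?thesis using False by simp
  qed (simp add: assms)
  then have "(\<Sum>j. indicator {\<omega>. first_hit y n j \<omega>} \<omega> * c j) = (\<Sum>j. if j = k then c j else 0)"
    by (simp only:)
  then show ?thesis using sums_unique[OF sums_single[of k c]] by (simp only:)
qed

section \<open>Exponentially weighted potentials and their stopping on a grid\<close>

definition weight :: "real \<Rightarrow> ennreal" where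
  "weight s = ennreal (q * exp (- q * s)) * indicator {0..} s"

lemma weight_measurable[measurable]: "weight \<in> borel_measurable borel"
  unfolding weight_def by measurable

lemma weight_shift: "0 \<le> t \<Longrightarrow> weight (t + s) * indicator {t..} (t + s) = ennreal (exp (- q * t)) * weight s"
  using q by (auto simp: weight_def indicator_def algebra_simps exp_add exp_diff exp_minus divide_inverse simp flip: ennreal_mult)

definition potential :: "(real \<Rightarrow> ennreal) \<Rightarrow> real \<Rightarrow> ennreal" where
  "potential a y = (\<integral>\<^sup>+s. weight s * (\<integral>\<^sup>+\<omega>. a (y + Y s \<omega>) \<partial>M) \<partial>lborel)"

lemma potential_measurable[measurable (raw)]:
  assumes [measurable]: "a \<in> borel_measurable borel" "f \<in> borel_measurable N"
  shows "(\<lambda>x. potential a (f x)) \<in> borel_measurable N"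
proof -
  have "potential a \<in> borel_measurable borel" unfolding potential_def by measurable
  then show ?thesis by measurable
qed

definition stopped_potential :: "(real \<Rightarrow> ennreal) \<Rightarrow> real \<Rightarrow> nat \<Rightarrow> ennreal" where
  "stopped_potential a y n =
    (\<integral>\<^sup>+\<omega>. \<integral>\<^sup>+s. weight s * a (y + Y s \<omega>) * indicator {s. \<exists>k. real k / 2 ^ n \<le> s \<and> hit y n k \<omega>} s \<partial>lborel \<partial>M)"

text \<open>Dynkin's formula on the grid. The time after the first hit is split according to the
  index \<open>k\<close> of the hit. That event depends on the history up to \<open>k\<close> only,
  so shifting time by \<open>real k * h\<close> and applying the Markov property turns the remaining
  integral into the potential at the position of the hit; \<open>weight_shift\<close> gives the
  discount.\<close>

lemma stopped_potential_eq:
  assumes [measurable]: "a \<in> borel_measurable borel"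
  shows "stopped_potential a y n = (\<Sum>k. ennreal (exp (- q * (real k / 2 ^ n))) *
    (\<integral>\<^sup>+\<omega>. indicator {\<omega>. first_hit y n k \<omega>} \<omega> * potential a (y + Y (real k / 2 ^ n) \<omega>) \<partial>M))"
proof -
  let ?I = "\<lambda>k \<omega>. indicator {\<omega>. first_hit y n k \<omega>} \<omega> :: ennreal"
  let ?K = "\<lambda>k \<omega>. \<integral>\<^sup>+s. weight s * a (y + Y s \<omega>) * (?I k \<omega> * indicator {real k / 2 ^ n..} s) \<partial>lborel"
  \<comment> \<open>At most one summand is nonzero, and a hit before \<open>s\<close> exists exactly
    when the first hit lies before \<open>s\<close>.\<close>
  have ind: "indicator {s. \<exists>k. real k / 2 ^ n \<le> s \<and> hit y n k \<omega>} s =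
      (\<Sum>k. ?I k \<omega> * (indicator {real k / 2 ^ n..} s :: ennreal))" for s \<omega>
  proof (cases "\<exists>k. first_hit y n k \<omega>")
    case True
    then obtain k where k: "first_hit y n k \<omega>" by auto
    have "(\<exists>j. real j / 2 ^ n \<le> s \<and> hit y n j \<omega>) \<longleftrightarrow> real k / 2 ^ n \<le> s"
    proof
      assume "\<exists>j. real j / 2 ^ n \<le> s \<and> hit y n j \<omega>"
      then obtain j where j: "real j / 2 ^ n \<le> s" "hit y n j \<omega>" by auto
      from hit_first_hit[OF j(2)] k have "k \<le> j" by (auto dest: first_hit_unique)
      then have "real k / 2 ^ n \<le> real j / 2 ^ n" by (simp add: divide_right_mono)
      with j show "real k / 2 ^ n \<le> s" by simp
    qed (use k in \<open>auto simp: first_hit_def\<close>)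
    then show ?thesis unfolding suminf_first_hit[OF k] by (simp add: indicator_def)
  next
    case False
    then have "\<not> hit y n k \<omega>" for k using hit_first_hit by blast
    then show ?thesis using False by simp
  qed
  have "stopped_potential a y n = (\<integral>\<^sup>+\<omega>. \<integral>\<^sup>+s. (\<Sum>k. weight s * a (y + Y s \<omega>) * (?I k \<omega> * indicator {real k / 2 ^ n..} s)) \<partial>lborel \<partial>M)"
    unfolding stopped_potential_def ind by simp
  also have "\<dots> = (\<integral>\<^sup>+\<omega>. (\<Sum>k. ?K k \<omega>) \<partial>M)"
    by (intro nn_integral_cong nn_integral_suminf) measurable
  also have "\<dots> = (\<Sum>k. \<integral>\<^sup>+\<omega>. ?K k \<omega> \<partial>M)"
    by (intro nn_integral_suminf) measurable
  also have "\<dots> = (\<Sum>k. ennreal (exp (- q * (real k / 2 ^ n))) *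
    (\<integral>\<^sup>+\<omega>. ?I k \<omega> * potential a (y + Y (real k / 2 ^ n) \<omega>) \<partial>M))"
  proof (rule suminf_cong)
    fix k
    define h :: real where "h = 1 / 2 ^ n"
    have h: "0 < h" "real k / 2 ^ n = real k * h" by (simp_all add: h_def)
    interpret P: pair_sigma_finite lborel M ..
    let ?R = "\<lambda>s \<omega>. \<integral>\<^sup>+\<omega>'. a (y + Y (real k * h) \<omega> + Y s \<omega>') \<partial>M"
    define B where "B = {f \<in> space (Pi\<^sub>M {..k} (\<lambda>_. borel)). y + f k \<le> 0 \<and> (\<forall>j<k. \<not> y + f j \<le> (0::real))}"
    have B: "B \<in> sets (Pi\<^sub>M {..k} (\<lambda>_. borel))"
      unfolding B_def by measurable
    have IB: "?I k \<omega> = (indicator B (\<lambda>j\<in>{..k}. Y (real j * h) \<omega>) :: ennreal)" for \<omega>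
      by (auto simp: B_def indicator_def first_hit_def hit_def h_def space_PiM)
    have "(\<integral>\<^sup>+\<omega>. ?K k \<omega> \<partial>M)
      = (\<integral>\<^sup>+s. \<integral>\<^sup>+\<omega>. weight s * a (y + Y s \<omega>) * (?I k \<omega> * indicator {real k / 2 ^ n..} s) \<partial>M \<partial>lborel)"
      by (rule P.Fubini') measurable
    also have "\<dots> = (\<integral>\<^sup>+s. weight s * indicator {real k * h..} s * (\<integral>\<^sup>+\<omega>. ?I k \<omega> * a (y + Y s \<omega>) \<partial>M) \<partial>lborel)"
      unfolding h(2) by (subst nn_integral_cmult[symmetric]) (auto simp: mult_ac)
    also have "\<dots> = (\<integral>\<^sup>+s. weight (real k * h + s) * indicator {real k * h..} (real k * h + s) * (\<integral>\<^sup>+\<omega>. ?I k \<omega> * a (y + Y (real k * h + s) \<omega>) \<partial>M) \<partial>lborel)"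
      by (subst nn_integral_real_affine[where c=1 and t="real k * h"]) auto
    also have "\<dots> = (\<integral>\<^sup>+s. ennreal (exp (- q * (real k * h))) * (weight s * (\<integral>\<^sup>+\<omega>. ?I k \<omega> * ?R s \<omega> \<partial>M)) \<partial>lborel)"
    proof (rule nn_integral_cong)
      fix s :: real
      show "weight (real k * h + s) * indicator {real k * h..} (real k * h + s) * (\<integral>\<^sup>+\<omega>. ?I k \<omega> * a (y + Y (real k * h + s) \<omega>) \<partial>M)
        = ennreal (exp (- q * (real k * h))) * (weight s * (\<integral>\<^sup>+\<omega>. ?I k \<omega> * ?R s \<omega> \<partial>M))"
      proof (cases "s \<ge> 0")
        case True
        have "(\<integral>\<^sup>+\<omega>. ?I k \<omega> * a (y + Y (real k * h + s) \<omega>) \<partial>M) =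
          (\<integral>\<^sup>+\<omega>. ?I k \<omega> * ?R s \<omega> \<partial>M)"
          unfolding IB using markov[OF h(1) True B, of "\<lambda>x. a (y + x)"] by (simp add: add.assoc)
        then show ?thesis using h(1) by (subst weight_shift) (auto simp: mult_ac)
      qed (use h(1) in \<open>auto simp: weight_def\<close>)
    qed
    also have "\<dots> = ennreal (exp (- q * (real k * h))) * (\<integral>\<^sup>+s. weight s * (\<integral>\<^sup>+\<omega>. ?I k \<omega> * ?R s \<omega> \<partial>M) \<partial>lborel)"
      by (rule nn_integral_cmult) measurable
    also have "(\<integral>\<^sup>+s. weight s * (\<integral>\<^sup>+\<omega>. ?I k \<omega> * ?R s \<omega> \<partial>M) \<partial>lborel)
      = (\<integral>\<^sup>+s. \<integral>\<^sup>+\<omega>. weight s * (?I k \<omega> * ?R s \<omega>) \<partial>M \<partial>lborel)"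
      by (subst nn_integral_cmult) auto
    also have "\<dots> = (\<integral>\<^sup>+\<omega>. \<integral>\<^sup>+s. weight s * (?I k \<omega> * ?R s \<omega>) \<partial>lborel \<partial>M)"
      by (rule P.Fubini'[symmetric]) measurable
    also have "\<dots> = (\<integral>\<^sup>+\<omega>. ?I k \<omega> * potential a (y + Y (real k * h) \<omega>) \<partial>M)"
      unfolding potential_def by (subst nn_integral_cmult[symmetric]) (auto simp: mult_ac)
    finally show "(\<integral>\<^sup>+\<omega>. ?K k \<omega> \<partial>M)
      = ennreal (exp (- q * (real k / 2 ^ n))) * (\<integral>\<^sup>+\<omega>. ?I k \<omega> * potential a (y + Y (real k / 2 ^ n) \<omega>) \<partial>M)"
      unfolding h(2) .
  qed
  finally show ?thesis .
qed

text \<open>Two distinct times \<open>s < s'\<close> at which the path is negative without having been seen to be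
  so at any earlier dyadic time cannot exist, by right-continuity at \<open>s\<close>.\<close>
lemma AE_hit_before:
  assumes \<omega>: "\<omega> \<in> space M"
  shows "AE s in lborel. 0 \<le> s \<and> y + Y s \<omega> < 0 \<longrightarrow> (\<exists>n k. real k / 2 ^ n \<le> s \<and> hit y n k \<omega>)"
proof -
  define B where "B = {s. 0 \<le> s \<and> y + Y s \<omega> < 0 \<and> \<not> (\<exists>n k. real k / 2 ^ n \<le> s \<and> hit y n k \<omega>)}"
  have no: False if s: "s \<in> B" "t \<in> B" "s < t" for s t
  proof -
    have "eventually (\<lambda>r. Y r \<omega> < - y) (at_right s)"
      using s(1) rcont[OF \<omega>, of s] by (intro order_tendstoD) (auto simp: B_def)
    then obtain b where b: "b > s" "\<And>r. s < r \<Longrightarrow> r < b \<Longrightarrow> Y r \<omega> < - y"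
      unfolding eventually_at_right_field by auto
    obtain n k :: nat where "s < real k / 2 ^ n" "real k / 2 ^ n < min b t"
    proof -
      have "0 \<le> s" "s < min b t" using s b by (auto simp: B_def)
      then show ?thesis using that by (rule dyadic_between)
    qed
    then have "hit y n k \<omega>" "real k / 2 ^ n \<le> t" using b(2)[of "real k / 2 ^ n"] by (auto simp: hit_def)
    then show False using s(2) by (auto simp: B_def)
  qed
  have "AE s in lborel. s \<notin> B"
  proof (cases "B = {}")
    case False
    then obtain s0 where s0: "s0 \<in> B" by auto
    have eq: "s = s0" if "s \<in> B" for s using no[of s s0] no[of s0 s] s0 that by (cases s s0 rule: linorder_cases) auto
    show ?thesis using AE_lborel_singleton[of s0] by eventually_elim (use eq in blast)
  qed simp
  then show ?thesis by eventually_elim (auto simp: B_def)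
qed

lemma hit_before_mono:
  assumes "n \<le> m"
  shows "indicator {s. \<exists>k. real k / 2 ^ n \<le> s \<and> hit y n k \<omega>} s \<le> (indicator {s. \<exists>k. real k / 2 ^ m \<le> s \<and> hit y m k \<omega>} s :: ennreal)"
proof -
  have "{s. \<exists>k. real k / 2 ^ n \<le> s \<and> hit y n k \<omega>} \<subseteq> {s. \<exists>k. real k / 2 ^ m \<le> s \<and> hit y m k \<omega>}"
  proof (intro subsetI CollectI)
    fix s assume "s \<in> {s. \<exists>k. real k / 2 ^ n \<le> s \<and> hit y n k \<omega>}"
    then obtain k where "real k / 2 ^ n \<le> s" "hit y n k \<omega>" by auto
    then show "\<exists>k. real k / 2 ^ m \<le> s \<and> hit y m k \<omega>"
      using hit_refine[OF assms] refine_eq[OF assms, of k] by (intro exI[of _ "k * 2 ^ (m - n)"]) simp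
  qed
  then show ?thesis by (auto simp: indicator_def)
qed

text \<open>As \<open>a\<close> vanishes on [0, \<infinity>), only times \<open>s\<close> with
  \<open>y + Y s < 0\<close> contribute, and by \<open>AE_hit_before\<close> almost every such time
  comes after a hit on some grid. Since the grids are nested, the restricted integrands increase to
  the full one.\<close>

lemma stopped_potential_LIMSEQ:
  assumes [measurable]: "a \<in> borel_measurable borel" and a0: "\<And>x. 0 \<le> x \<Longrightarrow> a x = 0"
  shows "stopped_potential a y \<longlonglongrightarrow> potential a y"
proof -
  interpret P: pair_sigma_finite lborel M ..
  define F where "F n \<omega> s = weight s * a (y + Y s \<omega>) * indicator {s. \<exists>k. real k / 2 ^ n \<le> s \<and> hit y n k \<omega>} s" for n \<omega> s
  have mF: "case_prod (F n) \<in> borel_measurable (M \<Otimes>\<^sub>M lborel)" for n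
  proof -
    have "(\<lambda>x. indicator {s. \<exists>k. real k / 2 ^ n \<le> s \<and> hit y n k (fst x)} (snd x) :: ennreal)
       = indicator {x. \<exists>k. real k / 2 ^ n \<le> snd x \<and> y + Y (real k / 2 ^ n) (fst x) \<le> 0}"
      by (auto simp: indicator_def fun_eq_iff hit_def)
    then show ?thesis unfolding F_def[abs_def] case_prod_beta' by measurable
  qed
  note [measurable] = measurable_compose[OF measurable_Pair mF, simplified]
  have incF: "F n \<omega> s \<le> F m \<omega> s" if "n \<le> m" for n m \<omega> s
    unfolding F_def by (intro mult_left_mono hit_before_mono that) simp
  have sp: "stopped_potential a y n = (\<integral>\<^sup>+\<omega>. \<integral>\<^sup>+s. F n \<omega> s \<partial>lborel \<partial>M)" for n
    by (simp add: stopped_potential_def F_def)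
  have "potential a y = (\<integral>\<^sup>+s. \<integral>\<^sup>+\<omega>. weight s * a (y + Y s \<omega>) \<partial>M \<partial>lborel)"
    unfolding potential_def by (subst nn_integral_cmult[symmetric]) auto
  also have "\<dots> = (\<integral>\<^sup>+\<omega>. \<integral>\<^sup>+s. weight s * a (y + Y s \<omega>) \<partial>lborel \<partial>M)"
    by (rule P.Fubini'[symmetric]) measurable
  also have "\<dots> = (\<integral>\<^sup>+\<omega>. (SUP n. \<integral>\<^sup>+s. F n \<omega> s \<partial>lborel) \<partial>M)"
  proof (rule nn_integral_cong)
    fix \<omega> assume \<omega>[measurable]: "\<omega> \<in> space M"
    have "(\<integral>\<^sup>+s. weight s * a (y + Y s \<omega>) \<partial>lborel) = (\<integral>\<^sup>+s. (SUP n. F n \<omega> s) \<partial>lborel)"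
    proof (rule nn_integral_cong_AE)
      show "AE s in lborel. weight s * a (y + Y s \<omega>) = (SUP n. F n \<omega> s)"
        using AE_hit_before[OF \<omega>, of y]
      proof eventually_elim
        fix s assume hb: "0 \<le> s \<and> y + Y s \<omega> < 0 \<longrightarrow> (\<exists>n k. real k / 2 ^ n \<le> s \<and> hit y n k \<omega>)"
        show "weight s * a (y + Y s \<omega>) = (SUP n. F n \<omega> s)"
        proof (cases "0 \<le> s \<and> y + Y s \<omega> < 0")
          case True
          with hb obtain n k where "real k / 2 ^ n \<le> s" "hit y n k \<omega>" by auto
          then have "s \<in> {s. \<exists>k. real k / 2 ^ n \<le> s \<and> hit y n k \<omega>}" by blast
          then have "F n \<omega> s = weight s * a (y + Y s \<omega>)" unfolding F_def by (simp only: indicator_simps mult_1_right)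
          then have "weight s * a (y + Y s \<omega>) \<le> (SUP n. F n \<omega> s)" by (metis SUP_upper UNIV_I)
          moreover have "(SUP n. F n \<omega> s) \<le> weight s * a (y + Y s \<omega>)"
            by (rule SUP_least) (auto simp: F_def indicator_def)
          ultimately show ?thesis by (rule antisym)
        next
          case False
          then have "weight s * a (y + Y s \<omega>) = 0" using a0[of "y + Y s \<omega>"] by (auto simp: weight_def not_less)
          then have "F n \<omega> s = 0" for n by (simp only: F_def mult_zero_left)
          with \<open>weight s * a (y + Y s \<omega>) = 0\<close> show ?thesis by (simp only:) simp
        qed
      qed
    qed
    also have "\<dots> = (SUP n. \<integral>\<^sup>+s. F n \<omega> s \<partial>lborel)"
      by (rule nn_integral_monotone_convergence_SUP) (auto intro!: incseq_SucI le_funI incF)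
    finally show "(\<integral>\<^sup>+s. weight s * a (y + Y s \<omega>) \<partial>lborel) = (SUP n. \<integral>\<^sup>+s. F n \<omega> s \<partial>lborel)" .
  qed
  also have "\<dots> = (SUP n. \<integral>\<^sup>+\<omega>. \<integral>\<^sup>+s. F n \<omega> s \<partial>lborel \<partial>M)"
    by (rule nn_integral_monotone_convergence_SUP) (auto intro!: incseq_SucI le_funI incF nn_integral_mono)
  finally have "potential a y = (SUP n. stopped_potential a y n)" by (simp add: sp)
  moreover have "incseq (stopped_potential a y)"
    unfolding sp by (intro incseq_SucI nn_integral_mono incF) simp
  ultimately show ?thesis using LIMSEQ_SUP by metis
qed

definition stopped_value :: "(real \<Rightarrow> ennreal) \<Rightarrow> real \<Rightarrow> nat \<Rightarrow> 'a \<Rightarrow> ennreal" where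
  "stopped_value l y n \<omega> =
    (\<Sum>k. indicator {\<omega>. first_hit y n k \<omega>} \<omega> * (ennreal (exp (- q * (real k / 2 ^ n))) * l (y + Y (real k / 2 ^ n) \<omega>)))"

lemma stopped_value_measurable[measurable]:
  assumes [measurable]: "l \<in> borel_measurable borel"
  shows "stopped_value l y n \<in> borel_measurable M"
  unfolding stopped_value_def[abs_def] by measurable

text \<open>Subtracting the grid formulas for \<open>a\<close> and \<open>b\<close> leaves the
  stopped value of \<open>l\<close>, and both stopped potentials converge to the full ones.
  Finiteness of the potential of \<open>b\<close> is what permits the subtraction in
  \<open>ennreal\<close>.\<close>

lemma stopped_value_LIMSEQ:
  assumes [measurable]: "a \<in> borel_measurable borel" "b \<in> borel_measurable borel" "l \<in> borel_measurable borel"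
    and a0: "\<And>x. 0 \<le> x \<Longrightarrow> a x = 0" and b0: "\<And>x. 0 \<le> x \<Longrightarrow> b x = 0"
    and eq: "AE y in lborel. potential a y = l y + potential b y"
    and fin: "AE y in lborel. potential a y < \<infinity>"
  shows "AE y in lborel. (\<lambda>n. \<integral>\<^sup>+\<omega>. stopped_value l y n \<omega> \<partial>M) \<longlonglongrightarrow> l y"
proof -
  interpret P: pair_sigma_finite lborel M ..
  \<comment> \<open>The equation is only known almost everywhere but is used at the random points
    \<open>y + Y t\<close>. Translations preserve null sets, so by Tonelli almost every
    \<open>y\<close> is good for almost every path, and then for all dyadic \<open>t\<close>
    together.\<close>
  have "AE y in lborel. AE \<omega> in M. potential a (y + Y t \<omega>) = l (y + Y t \<omega>) + potential b (y + Y t \<omega>)" for t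
  proof (subst P.AE_commute)
    show "AE \<omega> in M. AE y in lborel. potential a (y + Y t \<omega>) = l (y + Y t \<omega>) + potential b (y + Y t \<omega>)"
    proof (rule AE_I2)
      fix \<omega>
      have "Measurable.pred borel (\<lambda>y. potential a y = l y + potential b y)" by measurable
      from AE_borel_affine[OF _ this eq, of 1 "Y t \<omega>"]
      show "AE y in lborel. potential a (y + Y t \<omega>) = l (y + Y t \<omega>) + potential b (y + Y t \<omega>)"
        by (simp add: add.commute)
    qed
  qed measurable
  then have "AE y in lborel. \<forall>n k. AE \<omega> in M. potential a (y + Y (real k / 2 ^ n) \<omega>) =
      l (y + Y (real k / 2 ^ n) \<omega>) + potential b (y + Y (real k / 2 ^ n) \<omega>)"
    for n by (simp add: AE_all_countable)
  with eq fin show ?thesis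
  proof eventually_elim
    fix y assume y: "potential a y = l y + potential b y" "potential a y < \<infinity>"
      and all: "\<forall>n k. AE \<omega> in M. potential a (y + Y (real k / 2 ^ n) \<omega>) =
        l (y + Y (real k / 2 ^ n) \<omega>) + potential b (y + Y (real k / 2 ^ n) \<omega>)"
    have pb: "potential b y < \<infinity>" using y by (metis add.commute add_increasing2 order_le_less_trans order_refl zero_le)
    have sv: "(\<integral>\<^sup>+\<omega>. stopped_value l y n \<omega> \<partial>M) = (\<Sum>k. ennreal (exp (- q * (real k / 2 ^ n))) *
        (\<integral>\<^sup>+\<omega>. indicator {\<omega>. first_hit y n k \<omega>} \<omega> * l (y + Y (real k / 2 ^ n) \<omega>) \<partial>M))" for n
      unfolding stopped_value_def
      by (subst nn_integral_suminf) (auto simp: mult.left_commute[of "indicator _ _"] nn_integral_cmult)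
    have dec: "stopped_potential a y n = (\<integral>\<^sup>+\<omega>. stopped_value l y n \<omega> \<partial>M) + stopped_potential b y n" for n
    proof -
      have "(\<integral>\<^sup>+\<omega>. indicator {\<omega>. first_hit y n k \<omega>} \<omega> * potential a (y + Y (real k / 2 ^ n) \<omega>) \<partial>M) =
         (\<integral>\<^sup>+\<omega>. indicator {\<omega>. first_hit y n k \<omega>} \<omega> * l (y + Y (real k / 2 ^ n) \<omega>) \<partial>M) +
         (\<integral>\<^sup>+\<omega>. indicator {\<omega>. first_hit y n k \<omega>} \<omega> * potential b (y + Y (real k / 2 ^ n) \<omega>) \<partial>M)" for k
      proof -
        have "(\<integral>\<^sup>+\<omega>. indicator {\<omega>. first_hit y n k \<omega>} \<omega> * potential a (y + Y (real k / 2 ^ n) \<omega>) \<partial>M) =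
          (\<integral>\<^sup>+\<omega>. indicator {\<omega>. first_hit y n k \<omega>} \<omega> * l (y + Y (real k / 2 ^ n) \<omega>)
            + indicator {\<omega>. first_hit y n k \<omega>} \<omega> * potential b (y + Y (real k / 2 ^ n) \<omega>) \<partial>M)"
          using all[rule_format, of k n] by (intro nn_integral_cong_AE) (auto simp: distrib_left elim!: eventually_mono)
        then show ?thesis by (simp add: nn_integral_add)
      qed
      then show ?thesis
        unfolding sv stopped_potential_eq[OF assms(1)] stopped_potential_eq[OF assms(2)]
        by (simp add: distrib_left suminf_add)
    qed
    have bound: "stopped_potential b y n < \<infinity>" for n
    proof -
      have "incseq (stopped_potential b y)"
        unfolding stopped_potential_def
        by (intro incseq_SucI nn_integral_mono mult_left_mono hit_before_mono) auto
      then have "stopped_potential b y n \<le> potential b y"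
        by (rule incseq_le) (rule stopped_potential_LIMSEQ[OF assms(2) b0])
      with pb show ?thesis by simp
    qed
    have "(\<lambda>n. stopped_potential a y n - stopped_potential b y n) \<longlonglongrightarrow> potential a y - potential b y"
      using y pb by (intro tendsto_diff_ennreal_general stopped_potential_LIMSEQ a0 b0 assms) auto
    also have "(\<lambda>n. stopped_potential a y n - stopped_potential b y n) = (\<lambda>n. \<integral>\<^sup>+\<omega>. stopped_value l y n \<omega> \<partial>M)"
      unfolding dec using bound by (simp add: less_top ennreal_add_diff_cancel_right)
    also have "potential a y - potential b y = l y" unfolding y(1) using pb by (simp add: ennreal_add_diff_cancel_right)
    finally show "(\<lambda>n. \<integral>\<^sup>+\<omega>. stopped_value l y n \<omega> \<partial>M) \<longlonglongrightarrow> l y" .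
  qed
qed

text \<open>The infimum runs over countably many times, so it is measurable for \<open>M\<close>
  itself, whereas the exit time is an infimum over all times.\<close>

definition hitting_time :: "real \<Rightarrow> 'a \<Rightarrow> ereal" where
  "hitting_time y \<omega> = (INF (n, k). if hit y n k \<omega> then ereal (real k / 2 ^ n) else \<infinity>)"

lemma hitting_time_measurable[measurable]: "hitting_time y \<in> borel_measurable M"
  unfolding hitting_time_def[abs_def] case_prod_beta by measurable

lemma hitting_time_le: "hit y n k \<omega> \<Longrightarrow> hitting_time y \<omega> \<le> ereal (real k / 2 ^ n)"
  unfolding hitting_time_def by (rule INF_lower2[of "(n, k)"]) auto

lemma hitting_time_nonneg: "0 \<le> hitting_time y \<omega>"
  unfolding hitting_time_def by (rule INF_greatest) auto

lemma hitting_time_less: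
  assumes "hitting_time y \<omega> < ereal b"
  obtains n k where "hit y n k \<omega>" "real k / 2 ^ n < b"
proof -
  obtain p where "(case p of (n, k) \<Rightarrow> if hit y n k \<omega> then ereal (real k / 2 ^ n) else \<infinity>) < ereal b"
    using assms unfolding hitting_time_def INF_less_iff by auto
  then show ?thesis using that by (cases p) (auto split: if_splits)
qed

lemma hitting_time_cases:
  obtains "hitting_time y \<omega> = \<infinity>" "\<And>n k. \<not> hit y n k \<omega>"
  | \<tau> where "hitting_time y \<omega> = ereal \<tau>" "0 \<le> \<tau>" "\<And>n k. hit y n k \<omega> \<Longrightarrow> \<tau> \<le> real k / 2 ^ n"
proof (cases "hitting_time y \<omega>")
  case PInf
  then show ?thesis using that(1) hitting_time_le[of y _ _ \<omega>] by force
next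
  case MInf
  then show ?thesis using hitting_time_nonneg[of y \<omega>] by simp
next
  case (real \<tau>)
  then show ?thesis using that(2)[of \<tau>] hitting_time_nonneg[of y \<omega>] hitting_time_le[of y _ _ \<omega>] by force
qed

definition limit_value :: "real \<Rightarrow> real \<Rightarrow> real \<Rightarrow> 'a \<Rightarrow> ennreal" where
  "limit_value W \<eta> y \<omega> = (if hitting_time y \<omega> = \<infinity> then 0 else
     ennreal (exp (- q * real_of_ereal (hitting_time y \<omega>)) * (W * exp (\<eta> * (y + Y (real_of_ereal (hitting_time y \<omega>)) \<omega>)))))"

lemma limit_value_measurable[measurable]: "limit_value W \<eta> y \<in> borel_measurable M"
  unfolding limit_value_def[abs_def] by measurable

text \<open>A finer grid contains the coarser one, so its first hit is no later than any given hit
  of the coarser grid, and no hit precedes \<tau>. Hence the first hits approach \<tau> from the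
  right, possibly reaching it, and right-continuity carries the positions along.\<close>

lemma first_hit_times:
  assumes \<omega>: "\<omega> \<in> space M" and \<tau>: "hitting_time y \<omega> = ereal \<tau>"
  obtains N k where "\<forall>n\<ge>N. first_hit y n (k n) \<omega>" "(\<lambda>n. real (k n) / 2 ^ n) \<longlonglongrightarrow> \<tau>"
    "(\<lambda>n. Y (real (k n) / 2 ^ n) \<omega>) \<longlonglongrightarrow> Y \<tau> \<omega>"
proof -
  have \<tau>0: "0 \<le> \<tau>" using hitting_time_nonneg[of y \<omega>] \<tau> by simp
  have ge: "\<tau> \<le> real k / 2 ^ n" if "hit y n k \<omega>" for n k using hitting_time_le[OF that] \<tau> by simp
  have ex: "\<exists>N. \<forall>n\<ge>N. \<exists>k. first_hit y n k \<omega> \<and> real k / 2 ^ n < \<tau> + e" if "e > 0" for e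
  proof -
    have "hitting_time y \<omega> < ereal (\<tau> + e)" using \<tau> that by simp
    then obtain N k where k: "hit y N k \<omega>" "real k / 2 ^ N < \<tau> + e" by (rule hitting_time_less)
    show ?thesis
    proof (rule exI[of _ N], intro allI impI)
      fix n assume n: "N \<le> n"
      obtain j where j: "j \<le> k * 2 ^ (n - N)" "first_hit y n j \<omega>"
        using hit_first_hit[OF hit_refine[OF n k(1)]] by auto
      have "real j / 2 ^ n \<le> real (k * 2 ^ (n - N)) / 2 ^ n"
        using j(1) by (intro divide_right_mono) (simp_all only: of_nat_le_iff zero_le_power zero_le_numeral)
      then have "real j / 2 ^ n < \<tau> + e" using k(2) unfolding refine_eq[OF n] by simp
      with j(2) show "\<exists>k. first_hit y n k \<omega> \<and> real k / 2 ^ n < \<tau> + e" by blast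
    qed
  qed
  define k where "k n = (SOME k. first_hit y n k \<omega>)" for n
  obtain N where N: "\<And>n. n \<ge> N \<Longrightarrow> \<exists>k. first_hit y n k \<omega>" using ex[of 1] by (meson zero_less_one)
  have k: "first_hit y n (k n) \<omega>" if "n \<ge> N" for n unfolding k_def by (rule someI_ex[OF N[OF that]])
  have ge_k: "\<tau> \<le> real (k n) / 2 ^ n" if "n \<ge> N" for n using ge k[OF that] by (auto simp: first_hit_def)
  have less: "eventually (\<lambda>n. real (k n) / 2 ^ n < \<tau> + e) sequentially" if e: "e > 0" for e
  proof -
    from ex[OF e] obtain N' where N': "\<And>n. n \<ge> N' \<Longrightarrow> \<exists>k. first_hit y n k \<omega> \<and> real k / 2 ^ n < \<tau> + e" by auto
    have "real (k n) / 2 ^ n < \<tau> + e" if "n \<ge> max N N'" for n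
    proof -
      from that have n: "N \<le> n" "N' \<le> n" by auto
      from N'[OF n(2)] obtain j where j: "first_hit y n j \<omega>" "real j / 2 ^ n < \<tau> + e" by blast
      then show ?thesis using first_hit_unique[OF k[OF n(1)] j(1)] by simp
    qed
    then show ?thesis unfolding eventually_sequentially by blast
  qed
  have t: "(\<lambda>n. real (k n) / 2 ^ n) \<longlonglongrightarrow> \<tau>"
  proof (rule order_tendstoI)
    fix a assume "\<tau> < a" then show "eventually (\<lambda>n. real (k n) / 2 ^ n < a) sequentially" using less[of "a - \<tau>"] by simp
  next
    fix a assume a: "a < \<tau>"
    show "eventually (\<lambda>n. a < real (k n) / 2 ^ n) sequentially"
      using eventually_ge_at_top[of N] by eventually_elim (use a ge_k in \<open>rule less_le_trans\<close>)
  qed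
  have "(\<lambda>n. Y (real (k n) / 2 ^ n) \<omega>) \<longlonglongrightarrow> Y \<tau> \<omega>"
  proof (rule tendstoI)
    fix e :: real assume e: "e > 0"
    from tendstoD[OF rcont[OF \<omega> \<tau>0] e] obtain b where b: "b > \<tau>" "\<And>t. \<tau> < t \<Longrightarrow> t < b \<Longrightarrow> dist (Y t \<omega>) (Y \<tau> \<omega>) < e"
      unfolding eventually_at_right_field by auto
    show "eventually (\<lambda>n. dist (Y (real (k n) / 2 ^ n) \<omega>) (Y \<tau> \<omega>) < e) sequentially"
      using less[OF diff_gt_0_iff_gt[THEN iffD2, OF b(1)]] eventually_ge_at_top[of N]
    proof eventually_elim
      fix n assume n: "real (k n) / 2 ^ n < \<tau> + (b - \<tau>)" "N \<le> n"
      show "dist (Y (real (k n) / 2 ^ n) \<omega>) (Y \<tau> \<omega>) < e"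
        using b(2)[of "real (k n) / 2 ^ n"] ge_k[OF n(2)] n(1) e by (cases "real (k n) / 2 ^ n = \<tau>") auto
    qed
  qed
  moreover have "\<forall>n\<ge>N. first_hit y n (k n) \<omega>" using k by blast
  ultimately show ?thesis using t that by blast
qed

text \<open>A limit of the nonpositive positions at first hits. It bounds the exponential factor of
  \<open>limit_value\<close> by 1 when \<eta> tends to 0.\<close>

lemma nonpos_at_hitting_time:
  assumes "\<omega> \<in> space M" "hitting_time y \<omega> = ereal \<tau>"
  shows "y + Y \<tau> \<omega> \<le> 0"
proof -
  obtain N k where *: "\<forall>n\<ge>N. first_hit y n (k n) \<omega>" "(\<lambda>n. Y (real (k n) / 2 ^ n) \<omega>) \<longlonglongrightarrow> Y \<tau> \<omega>"
    using first_hit_times[OF assms] by metis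
  have "(\<lambda>n. y + Y (real (k n) / 2 ^ n) \<omega>) \<longlonglongrightarrow> y + Y \<tau> \<omega>" by (intro tendsto_intros *)
  then show ?thesis
    by (rule LIMSEQ_le_const2) (use *(1) in \<open>auto simp: first_hit_def hit_def\<close>)
qed

lemma stopped_value_tendsto:
  assumes \<omega>: "\<omega> \<in> space M" and l: "\<And>x. x \<le> 0 \<Longrightarrow> l x = ennreal (W * exp (\<eta> * x))" and W: "0 \<le> W"
  shows "(\<lambda>n. stopped_value l y n \<omega>) \<longlonglongrightarrow> limit_value W \<eta> y \<omega>"
proof (cases rule: hitting_time_cases[of y \<omega>])
  case 1
  then show ?thesis by (simp add: stopped_value_def limit_value_def first_hit_def)
next
  case (2 \<tau>)
  obtain N k where k: "\<forall>n\<ge>N. first_hit y n (k n) \<omega>" "(\<lambda>n. real (k n) / 2 ^ n) \<longlonglongrightarrow> \<tau>"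
    "(\<lambda>n. Y (real (k n) / 2 ^ n) \<omega>) \<longlonglongrightarrow> Y \<tau> \<omega>" by (rule first_hit_times[OF \<omega> 2(1)])
  have "eventually (\<lambda>n. stopped_value l y n \<omega> =
      ennreal (exp (- q * (real (k n) / 2 ^ n)) * (W * exp (\<eta> * (y + Y (real (k n) / 2 ^ n) \<omega>))))) sequentially"
    using eventually_ge_at_top[of N]
  proof eventually_elim
    fix n assume "N \<le> n"
    then have fh: "first_hit y n (k n) \<omega>" using k(1) by blast
    then have "y + Y (real (k n) / 2 ^ n) \<omega> \<le> 0" by (simp add: first_hit_def hit_def)
    from l[OF this] show "stopped_value l y n \<omega> =
      ennreal (exp (- q * (real (k n) / 2 ^ n)) * (W * exp (\<eta> * (y + Y (real (k n) / 2 ^ n) \<omega>))))"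
      using W unfolding stopped_value_def suminf_first_hit[OF fh] by (simp only: ennreal_mult' exp_ge_zero)
  qed
  moreover have "(\<lambda>n. ennreal (exp (- q * (real (k n) / 2 ^ n)) * (W * exp (\<eta> * (y + Y (real (k n) / 2 ^ n) \<omega>))))) \<longlonglongrightarrow>
      ennreal (exp (- q * \<tau>) * (W * exp (\<eta> * (y + Y \<tau> \<omega>))))"
    by (intro tendsto_intros k)
  ultimately show ?thesis unfolding limit_value_def 2(1) by (simp add: tendsto_cong)
qed

lemma stopped_value_le:
  assumes l: "\<And>x. x \<le> 0 \<Longrightarrow> l x = ennreal (W * exp (\<eta> * x))" and W: "0 \<le> W" and \<eta>: "0 \<le> \<eta>"
  shows "stopped_value l y n \<omega> \<le> ennreal W"
proof (cases "\<exists>k. first_hit y n k \<omega>")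
  case True
  then obtain k where k: "first_hit y n k \<omega>" by auto
  then have neg: "y + Y (real k / 2 ^ n) \<omega> \<le> 0" by (simp add: first_hit_def hit_def)
  have "stopped_value l y n \<omega> = ennreal (exp (- q * (real k / 2 ^ n)) * (W * exp (\<eta> * (y + Y (real k / 2 ^ n) \<omega>))))"
    using W unfolding stopped_value_def suminf_first_hit[OF k] l[OF neg] by (simp only: ennreal_mult' exp_ge_zero)
  also have "\<dots> \<le> ennreal (1 * (W * 1))"
    using W \<eta> q neg by (intro ennreal_leI mult_mono) (auto simp: mult_nonneg_nonpos)
  finally show ?thesis by simp
qed (simp add: stopped_value_def)

lemma hitting_time_exp_moment:
  assumes lim: "(\<lambda>n. \<integral>\<^sup>+\<omega>. stopped_value l y n \<omega> \<partial>M) \<longlonglongrightarrow> l y"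
    and [measurable]: "l \<in> borel_measurable borel"
    and l: "\<And>x. x \<le> 0 \<Longrightarrow> l x = ennreal (W * exp (\<eta> * x))" and W: "0 \<le> W" and \<eta>: "0 \<le> \<eta>"
  shows "l y = (\<integral>\<^sup>+\<omega>. limit_value W \<eta> y \<omega> \<partial>M)"
proof -
  have "(\<lambda>n. \<integral>\<^sup>+\<omega>. stopped_value l y n \<omega> \<partial>M) \<longlonglongrightarrow> (\<integral>\<^sup>+\<omega>. limit_value W \<eta> y \<omega> \<partial>M)"
    by (rule nn_integral_dominated_convergence[where w="\<lambda>_. ennreal W"])
      (use stopped_value_le[OF l W \<eta>] stopped_value_tendsto[OF _ l W] in \<open>auto simp: emeasure_space_1\<close>)
  with lim show ?thesis by (rule LIMSEQ_unique)
qed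

lemma limit_value_LIMSEQ:
  assumes W: "W \<longlonglongrightarrow> 1" "\<And>m. 0 \<le> W m" "\<And>m. W m \<le> 1" and \<eta>: "\<eta> \<longlonglongrightarrow> 0" "\<And>m. 0 \<le> \<eta> m"
  shows "(\<lambda>m. \<integral>\<^sup>+\<omega>. limit_value (W m) (\<eta> m) y \<omega> \<partial>M) \<longlonglongrightarrow>
    (\<integral>\<^sup>+\<omega>. ennreal (exp_minus (ereal q * hitting_time y \<omega>)) \<partial>M)"
proof (rule nn_integral_dominated_convergence[where w="\<lambda>_. 1"])
  show "AE \<omega> in M. (\<lambda>m. limit_value (W m) (\<eta> m) y \<omega>) \<longlonglongrightarrow> ennreal (exp_minus (ereal q * hitting_time y \<omega>))"
  proof (rule AE_I2)
    fix \<omega> assume \<omega>: "\<omega> \<in> space M"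
    show "(\<lambda>m. limit_value (W m) (\<eta> m) y \<omega>) \<longlonglongrightarrow> ennreal (exp_minus (ereal q * hitting_time y \<omega>))"
    proof (cases rule: hitting_time_cases[of y \<omega>])
      case 1
      then show ?thesis using q by (simp add: limit_value_def exp_minus_def)
    next
      case (2 \<tau>)
      have "(\<lambda>m. ennreal (exp (- q * \<tau>) * (W m * exp (\<eta> m * (y + Y \<tau> \<omega>))))) \<longlonglongrightarrow> ennreal (exp (- q * \<tau>) * (1 * exp (0 * (y + Y \<tau> \<omega>))))"
        by (intro tendsto_intros W \<eta>)
      then show ?thesis using 2(1) by (simp add: limit_value_def exp_minus_def)
    qed
  qed
  show "AE \<omega> in M. limit_value (W m) (\<eta> m) y \<omega> \<le> 1" for m
  proof (rule AE_I2)
    fix \<omega> assume \<omega>: "\<omega> \<in> space M"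
    show "limit_value (W m) (\<eta> m) y \<omega> \<le> 1"
    proof (cases rule: hitting_time_cases[of y \<omega>])
      case (2 \<tau>)
      have "exp (- q * \<tau>) * (W m * exp (\<eta> m * (y + Y \<tau> \<omega>))) \<le> 1 * (1 * 1)"
        using nonpos_at_hitting_time[OF \<omega> 2(1)] W \<eta> q 2(2) by (intro mult_mono) (auto simp: mult_nonneg_nonpos)
      then show ?thesis using 2(1) by (simp add: limit_value_def flip: ennreal_1)
    qed (simp add: limit_value_def)
  qed
  show "(\<lambda>\<omega>. ennreal (exp_minus (ereal q * hitting_time y \<omega>))) \<in> borel_measurable M"
    unfolding exp_minus_def by measurable
qed (auto simp: emeasure_space_1)

end

section \<open>The incomplete Gamma function\<close>

text \<open>The right-hand side of the first formula as a function of
  \<open>y = t powr (1 / \<alpha>)\<close>; \<open>stieltjes_density_tail\<close> recognises it as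
  the tail of \<open>stieltjes_density \<alpha>\<close>.\<close>

definition exit_laplace :: "real \<Rightarrow> real \<Rightarrow> real" where
  "exit_laplace \<alpha> y = sin (\<alpha> * pi) / pi * Gamma \<alpha> * upper_incomplete_Gamma (1 - \<alpha>) y * exp y"

text \<open>\<open>upper_incomplete_Gamma\<close> is a Bochner integral, which takes the value 0 for
  a non-integrable function; this guards its conversion to a nonnegative integral.\<close>

lemma integrable_upper_Gamma:
  fixes y a :: real
  assumes "0 < y" "a \<le> 1"
  shows "integrable lborel (\<lambda>t. indicator {y<..} t *\<^sub>R (t powr (a - 1) * exp (- t)))"
proof (rule integrableI_bounded)
  have "(\<integral>\<^sup>+t. ennreal (norm (indicator {y<..} t *\<^sub>R (t powr (a - 1) * exp (- t)))) \<partial>lborel)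
    \<le> (\<integral>\<^sup>+t. ennreal (y powr (a - 1)) * (ennreal (exp (- 1 * t)) * indicator {0<..} t) \<partial>lborel)"
  proof (rule nn_integral_mono)
    fix t :: real
    show "ennreal (norm (indicator {y<..} t *\<^sub>R (t powr (a - 1) * exp (- t)))) \<le> ennreal (y powr (a - 1)) * (ennreal (exp (- 1 * t)) * indicator {0<..} t)"
    proof (cases "y < t")
      case True
      then have "t powr (a - 1) \<le> y powr (a - 1)" using assms by (intro powr_mono2') auto
      then show ?thesis using True assms by (simp add: mult_right_mono ennreal_leI flip: ennreal_mult)
    qed simp
  qed
  also have "\<dots> = ennreal (y powr (a - 1)) * ennreal (1 / 1)"
    by (subst nn_integral_cmult) (auto simp: nn_integral_exp[of 1, simplified])
  also have "\<dots> < \<infinity>" by simp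
  finally show "(\<integral>\<^sup>+t. ennreal (norm (indicator {y<..} t *\<^sub>R (t powr (a - 1) * exp (- t)))) \<partial>lborel) < \<infinity>" .
qed measurable

lemma upper_incomplete_Gamma_nonneg: "0 \<le> upper_incomplete_Gamma a y"
  unfolding upper_incomplete_Gamma_def set_lebesgue_integral_def by (intro integral_nonneg_AE) auto

lemma upper_incomplete_Gamma_eq_nn:
  assumes "0 < y" "a \<le> 1"
  shows "ennreal (upper_incomplete_Gamma a y) = (\<integral>\<^sup>+t. ennreal (t powr (a - 1) * exp (- t)) * indicator {y<..} t \<partial>lborel)"
proof -
  have "ennreal (upper_incomplete_Gamma a y) = (\<integral>\<^sup>+t. ennreal (indicator {y<..} t *\<^sub>R (t powr (a - 1) * exp (- t))) \<partial>lborel)"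
    unfolding upper_incomplete_Gamma_def set_lebesgue_integral_def
    by (rule nn_integral_eq_integral[symmetric, OF integrable_upper_Gamma[OF assms]]) auto
  also have "\<dots> = (\<integral>\<^sup>+t. ennreal (t powr (a - 1) * exp (- t)) * indicator {y<..} t \<partial>lborel)"
    by (intro nn_integral_cong) (simp add: indicator_def)
  finally show ?thesis .
qed

text \<open>The tail is a multiple of the integral of
  \<open>r powr (\<alpha> - 1) * exp (- r * y) / (1 + r)\<close>. Writing \<open>1 / (1 + r)\<close>
  as the integral of \<open>exp (- (1 + r) * v)\<close> and integrating over \<open>r\<close> first
  gives \<open>Gamma \<alpha> * (y + v) powr (- \<alpha>)\<close>, and \<open>t = y + v\<close>
  produces the incomplete Gamma function with the factor \<open>exp y\<close>.\<close>

lemma stieltjes_density_tail: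
  assumes \<alpha>: "0 < \<alpha>" "\<alpha> < 1" and y: "0 < y"
  shows "(\<integral>\<^sup>+i. stieltjes_density \<alpha> i * indicator {y<..} i \<partial>lborel) = ennreal (exit_laplace \<alpha> y)"
proof -
  define c where "c = sin (pi * \<alpha>) / pi"
  have c: "0 \<le> c" using sin_pi_mult_pos[OF \<alpha>] by (simp add: c_def)
  have "(\<integral>\<^sup>+i. stieltjes_density \<alpha> i * indicator {y<..} i \<partial>lborel) =
    (\<integral>\<^sup>+r. ennreal (c * (r powr \<alpha> / ((1 + r) * (r + 0))) * exp (- (r + 0) * y)) * indicator {0<..} r \<partial>lborel)"
    using stieltjes_density_exp_tail[of \<alpha> 0 y] \<alpha> y by (simp add: c_def)
  also have "\<dots> = (\<integral>\<^sup>+r. \<integral>\<^sup>+v. ennreal (c * r powr (\<alpha> - 1) * exp (- (y + v) * r) * exp (- v)) * indicator {0<..} r * indicator {0<..} v \<partial>lborel \<partial>lborel)"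
  proof (rule nn_integral_cong)
    fix r :: real
    show "ennreal (c * (r powr \<alpha> / ((1 + r) * (r + 0))) * exp (- (r + 0) * y)) * indicator {0<..} r =
      (\<integral>\<^sup>+v. ennreal (c * r powr (\<alpha> - 1) * exp (- (y + v) * r) * exp (- v)) * indicator {0<..} r * indicator {0<..} v \<partial>lborel)"
    proof (cases "r > 0")
      case True
      have eq: "c * r powr (\<alpha> - 1) * exp (- (y + v) * r) * exp (- v) = c * r powr (\<alpha> - 1) * exp (- y * r) * exp (- (1 + r) * v)" for v
      proof -
        have "exp (- (y + v) * r) * exp (- v) = exp (- y * r) * exp (- (1 + r) * v)"
          unfolding exp_add[symmetric] by (simp add: algebra_simps)
        then show ?thesis by (simp only: mult.assoc)
      qed
      have "(\<integral>\<^sup>+v. ennreal (c * r powr (\<alpha> - 1) * exp (- (y + v) * r) * exp (- v)) * indicator {0<..} r * indicator {0<..} v \<partial>lborel) =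
        (\<integral>\<^sup>+v. ennreal (c * r powr (\<alpha> - 1) * exp (- y * r)) * (ennreal (exp (- (1 + r) * v)) * indicator {0<..} v) \<partial>lborel)"
        unfolding eq using True c by (intro nn_integral_cong) (simp add: mult.assoc[symmetric] flip: ennreal_mult)
      also have "\<dots> = ennreal (c * r powr (\<alpha> - 1) * exp (- y * r)) * ennreal (1 / (1 + r))"
        using True by (subst nn_integral_cmult) (auto simp: nn_integral_exp[of "1 + r", simplified])
      also have "\<dots> = ennreal (c * r powr (\<alpha> - 1) * exp (- y * r) * (1 / (1 + r)))"
        using True c by (intro ennreal_mult[symmetric]) auto
      also have "c * r powr (\<alpha> - 1) * exp (- y * r) * (1 / (1 + r)) = c * (r powr \<alpha> / ((1 + r) * (r + 0))) * exp (- (r + 0) * y)"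
        using True by (simp add: powr_diff mult_ac)
      finally show ?thesis using True by simp
    qed simp
  qed
  also have "\<dots> = (\<integral>\<^sup>+v. \<integral>\<^sup>+r. ennreal (c * r powr (\<alpha> - 1) * exp (- (y + v) * r) * exp (- v)) * indicator {0<..} r * indicator {0<..} v \<partial>lborel \<partial>lborel)"
    by (rule lborel_pair.Fubini') measurable
  also have "\<dots> = (\<integral>\<^sup>+v. ennreal (c * Gamma \<alpha>) * (ennreal ((y + v) powr (- \<alpha>) * exp (- v)) * indicator {0<..} v) \<partial>lborel)"
  proof (rule nn_integral_cong)
    fix v :: real
    show "(\<integral>\<^sup>+r. ennreal (c * r powr (\<alpha> - 1) * exp (- (y + v) * r) * exp (- v)) * indicator {0<..} r * indicator {0<..} v \<partial>lborel)
      = ennreal (c * Gamma \<alpha>) * (ennreal ((y + v) powr (- \<alpha>) * exp (- v)) * indicator {0<..} v)"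
    proof (cases "v > 0")
      case True
      have "(\<integral>\<^sup>+r. ennreal (c * r powr (\<alpha> - 1) * exp (- (y + v) * r) * exp (- v)) * indicator {0<..} r * indicator {0<..} v \<partial>lborel)
        = (\<integral>\<^sup>+r. ennreal (c * exp (- v)) * (ennreal (r powr (\<alpha> - 1) * exp (- (y + v) * r)) * indicator {0<..} r) \<partial>lborel)"
      proof (rule nn_integral_cong)
        fix r :: real
        have "c * r powr (\<alpha> - 1) * exp (- (y + v) * r) * exp (- v) = (c * exp (- v)) * (r powr (\<alpha> - 1) * exp (- (y + v) * r))"
          by simp
        then have "ennreal (c * r powr (\<alpha> - 1) * exp (- (y + v) * r) * exp (- v)) = ennreal (c * exp (- v)) * ennreal (r powr (\<alpha> - 1) * exp (- (y + v) * r))"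
          using c by (simp only: ennreal_mult mult_nonneg_nonneg exp_ge_zero powr_ge_zero)
        then show "ennreal (c * r powr (\<alpha> - 1) * exp (- (y + v) * r) * exp (- v)) * indicator {0<..} r * indicator {0<..} v
          = ennreal (c * exp (- v)) * (ennreal (r powr (\<alpha> - 1) * exp (- (y + v) * r)) * indicator {0<..} r)"
          using True by (simp only: mult.assoc) simp
      qed
      also have "\<dots> = ennreal (c * exp (- v)) * ennreal (Gamma \<alpha> * (y + v) powr (- \<alpha>))"
        using True \<alpha> y nn_integral_powr_exp[of \<alpha> "y + v"] by (subst nn_integral_cmult) auto
      also have "\<dots> = ennreal ((c * exp (- v)) * (Gamma \<alpha> * (y + v) powr (- \<alpha>)))"
        using c Gamma_real_pos[OF \<alpha>(1)] by (intro ennreal_mult[symmetric]) auto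
      also have "(c * exp (- v)) * (Gamma \<alpha> * (y + v) powr (- \<alpha>)) = (c * Gamma \<alpha>) * ((y + v) powr (- \<alpha>) * exp (- v))" by simp
      also have "ennreal \<dots> = ennreal (c * Gamma \<alpha>) * ennreal ((y + v) powr (- \<alpha>) * exp (- v))"
        using c Gamma_real_pos[OF \<alpha>(1)] by (intro ennreal_mult) auto
      finally show ?thesis using True by simp
    qed simp
  qed
  also have "\<dots> = ennreal (c * Gamma \<alpha>) * (\<integral>\<^sup>+v. ennreal ((y + v) powr (- \<alpha>) * exp (- v)) * indicator {0<..} v \<partial>lborel)"
    by (rule nn_integral_cmult) measurable
  also have "(\<integral>\<^sup>+v. ennreal ((y + v) powr (- \<alpha>) * exp (- v)) * indicator {0<..} v \<partial>lborel)
    = (\<integral>\<^sup>+t. ennreal (exp y) * (ennreal (t powr ((1 - \<alpha>) - 1) * exp (- t)) * indicator {y<..} t) \<partial>lborel)"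
  proof -
    have "(\<integral>\<^sup>+t. ennreal (exp y) * (ennreal (t powr ((1 - \<alpha>) - 1) * exp (- t)) * indicator {y<..} t) \<partial>lborel) =
       (\<integral>\<^sup>+v. ennreal (exp y) * (ennreal ((y + v) powr ((1 - \<alpha>) - 1) * exp (- (y + v))) * indicator {y<..} (y + v)) \<partial>lborel)"
      by (subst nn_integral_real_affine[of _ 1 y]) auto
    also have "\<dots> = (\<integral>\<^sup>+v. ennreal ((y + v) powr (- \<alpha>) * exp (- v)) * indicator {0<..} v \<partial>lborel)"
    proof (rule nn_integral_cong)
      fix v :: real
      have "exp y * ((y + v) powr (- \<alpha>) * exp (- (y + v))) = (y + v) powr (- \<alpha>) * exp (- v)"
        unfolding mult.left_commute[of "exp y"] exp_add[symmetric] by simp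
      then show "ennreal (exp y) * (ennreal ((y + v) powr ((1 - \<alpha>) - 1) * exp (- (y + v))) * indicator {y<..} (y + v)) =
        ennreal ((y + v) powr (- \<alpha>) * exp (- v)) * indicator {0<..} v"
        by (cases "v > 0") (simp_all flip: ennreal_mult)
    qed
    finally show ?thesis by simp
  qed
  also have "\<dots> = ennreal (exp y) * ennreal (upper_incomplete_Gamma (1 - \<alpha>) y)"
    using y \<alpha> by (subst nn_integral_cmult) (auto simp: upper_incomplete_Gamma_eq_nn)
  also have "ennreal (c * Gamma \<alpha>) * \<dots> = ennreal (exit_laplace \<alpha> y)"
  proof -
    have "exit_laplace \<alpha> y = c * Gamma \<alpha> * (exp y * upper_incomplete_Gamma (1 - \<alpha>) y)"
      by (simp add: exit_laplace_def c_def mult_ac)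
    then show ?thesis using c Gamma_real_pos[OF \<alpha>(1)] upper_incomplete_Gamma_nonneg[of "1 - \<alpha>" y]
      by (simp only: ennreal_mult mult_nonneg_nonneg exp_ge_zero less_imp_le)
  qed
  finally show ?thesis .
qed

lemma exit_laplace_nonneg:
  assumes "0 < \<alpha>" "\<alpha> < 1" shows "0 \<le> exit_laplace \<alpha> y"
  using sin_pi_mult_pos[OF assms] Gamma_real_pos[OF assms(1)] upper_incomplete_Gamma_nonneg[of "1 - \<alpha>" y]
  unfolding exit_laplace_def by (intro mult_nonneg_nonneg divide_nonneg_nonneg) (auto simp: mult.commute)

text \<open>Continuity is that of the tail of a density, by dominated convergence; the boundary
  point \<open>y\<close> alone is excluded.\<close>

lemma exit_laplace_LIMSEQ:
  assumes \<alpha>: "0 < \<alpha>" "\<alpha> < 1" and y: "0 < y" and u: "u \<longlonglongrightarrow> y" "\<And>j. 0 < u j"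
  shows "(\<lambda>j. exit_laplace \<alpha> (u j)) \<longlonglongrightarrow> exit_laplace \<alpha> y"
proof -
  have "(\<lambda>j. \<integral>\<^sup>+i. stieltjes_density \<alpha> i * indicator {u j<..} i \<partial>lborel) \<longlonglongrightarrow> (\<integral>\<^sup>+i. stieltjes_density \<alpha> i * indicator {y<..} i \<partial>lborel)"
  proof (rule nn_integral_dominated_convergence[where w="stieltjes_density \<alpha>"])
    show "AE i in lborel. (\<lambda>j. stieltjes_density \<alpha> i * indicator {u j<..} i) \<longlonglongrightarrow> stieltjes_density \<alpha> i * indicator {y<..} i"
      using AE_lborel_singleton[of y]
    proof eventually_elim
      fix i assume "i \<noteq> y"
      have "eventually (\<lambda>j. indicator {u j<..} i = (indicator {y<..} i :: ennreal)) sequentially"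
      proof (cases "y < i")
        case True
        from order_tendstoD(2)[OF u(1) this] show ?thesis by eventually_elim (use True in simp)
      next
        case False
        with \<open>i \<noteq> y\<close> have "i < y" by simp
        from order_tendstoD(1)[OF u(1) this] show ?thesis by eventually_elim (use False in simp)
      qed
      then show "(\<lambda>j. stieltjes_density \<alpha> i * indicator {u j<..} i) \<longlonglongrightarrow> stieltjes_density \<alpha> i * indicator {y<..} i"
        by (intro tendsto_eventually) (auto elim: eventually_mono)
    qed
  qed (use stieltjes_density_mass[OF \<alpha>] in \<open>auto simp: indicator_def\<close>)
  then show ?thesis using u(2) y \<alpha> by (simp add: stieltjes_density_tail exit_laplace_nonneg)
qed

section \<open>Exit times of stable processes\<close>

text \<open>For \<open>z > 0\<close> this is \<open>z powr \<alpha> * exp (- i \<theta>)\<close>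
  with \<theta> = 3 \<pi> \<alpha> / 2 - \<pi>, the phase forced by the positivity coefficient. At
  negative frequencies the exponent of the process is the conjugate of its value at
  \<open>- z\<close> and not this expression.\<close>

definition stable_exponent :: "real \<Rightarrow> real \<Rightarrow> complex" where
  "stable_exponent \<alpha> z = - ((- \<i> * of_real z) powr of_real \<alpha> * exp (- \<i> * of_real (pi * \<alpha>)))"

locale stable_exit = right_continuous_process M Y q
  for M :: "'a measure" and Y q +
  fixes \<alpha> :: real
  assumes \<alpha>: "1 / 2 \<le> \<alpha>" "\<alpha> < 1"
    and char_Y: "\<And>s z. 0 \<le> s \<Longrightarrow> 0 < z \<Longrightarrow> char (distr M borel (Y s)) z = exp (- (of_real (q * s) * stable_exponent \<alpha> z))"
begin

text \<open>The law of \<open>Y\<close> at an independent exponential time of rate \<open>q\<close>;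
  integrals against it are the potentials.\<close>

definition resolvent :: "real measure" where
  "resolvent = distr (density lborel weight \<Otimes>\<^sub>M M) borel (\<lambda>(s, \<omega>). Y s \<omega>)"

lemma finite_density_weight: "finite_density weight"
proof -
  have "(\<integral>\<^sup>+s. weight s \<partial>lborel) = (\<integral>\<^sup>+s. ennreal q * (ennreal (exp (- q * s)) * indicator {0<..} s) \<partial>lborel)"
  proof (rule nn_integral_cong_AE)
    show "AE s in lborel. weight s = ennreal q * (ennreal (exp (- q * s)) * indicator {0<..} s)"
      using AE_lborel_singleton[of 0]
    proof eventually_elim
      fix s :: real assume "s \<noteq> 0"
      then show "weight s = ennreal q * (ennreal (exp (- q * s)) * indicator {0<..} s)"
        using q by (simp add: weight_def ennreal_mult mult.assoc indicator_def less_le)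
    qed
  qed
  also have "\<dots> = ennreal q * ennreal (1 / q)"
    using q by (subst nn_integral_cmult) (auto simp: nn_integral_exp[of q, simplified])
  finally show ?thesis by (simp add: finite_density_def ennreal_mult_less_top)
qed

lemma finite_measure_resolvent: "finite_measure resolvent" and sets_resolvent: "sets resolvent = sets borel"
  unfolding resolvent_def
  by (intro finite_measure.finite_measure_distr finite_measure_pair_measure finite_measure_density_lborel
      finite_density_weight finite_measure_axioms) measurable

lemma nn_integral_resolvent:
  assumes [measurable]: "g \<in> borel_measurable borel"
  shows "(\<integral>\<^sup>+x. g x \<partial>resolvent) = (\<integral>\<^sup>+s. weight s * (\<integral>\<^sup>+\<omega>. g (Y s \<omega>) \<partial>M) \<partial>lborel)"
  unfolding resolvent_def
  by (simp add: nn_integral_distr nn_integral_fst[symmetric] nn_integral_density case_prod_beta')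

text \<open>Read off from the bound 1 on the modulus of a characteristic function, without computing
  the argument of the exponent.\<close>

lemma Re_stable_exponent: "0 < z \<Longrightarrow> 0 \<le> Re (stable_exponent \<alpha> z)"
proof -
  assume z: "0 < z"
  interpret D: real_distribution "distr M borel (Y 1)" by (intro real_distribution_distr) measurable
  have "exp (- (q * Re (stable_exponent \<alpha> z))) \<le> 1"
    using D.cmod_char_le_1[of z] char_Y[of 1 z] z by (simp add: norm_exp_eq_Re)
  then show ?thesis using q by (simp add: zero_le_mult_iff)
qed

text \<open>The integral of \<open>q * exp (- q * s) * exp (- q * s * \<Psi>)\<close> over
  \<open>s > 0\<close> is \<open>1 / (1 + \<Psi>)\<close>. The real part of \<Psi> goes into the
  rate \<eta> and the imaginary part into the frequency, so that it becomes a characteristic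
  function of an exponential density.\<close>

lemma char_resolvent:
  assumes z: "0 < z"
  shows "char resolvent z * (1 + stable_exponent \<alpha> z) = 1"
proof -
  define \<Psi> where "\<Psi> = stable_exponent \<alpha> z"
  define \<eta> where "\<eta> = q * (1 + Re \<Psi>)"
  have \<eta>: "0 < \<eta>" using q Re_stable_exponent[OF z] by (simp add: \<eta>_def \<Psi>_def)
  interpret W: finite_measure "density lborel weight" by (rule finite_measure_density_lborel[OF finite_density_weight])
  interpret P: pair_sigma_finite "density lborel weight" M ..
  have int: "integrable (density lborel weight \<Otimes>\<^sub>M M) (\<lambda>(s, \<omega>). iexp (z * Y s \<omega>))"
    by (rule finite_measure.integrable_const_bound[where B=1])
      (auto intro!: finite_measure_pair_measure W.finite_measure_axioms finite_measure_axioms)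
  have "char resolvent z = (CLINT p|density lborel weight \<Otimes>\<^sub>M M. (case p of (s, \<omega>) \<Rightarrow> iexp (z * Y s \<omega>)))"
    unfolding resolvent_def char_def by (subst integral_distr) (auto simp: case_prod_beta')
  also have "\<dots> = (CLINT s|density lborel weight. CLINT \<omega>|M. iexp (z * Y s \<omega>))"
    using P.integral_fst'[OF int] unfolding case_prod_beta by (simp only: fst_conv snd_conv)
  also have "\<dots> = (CLINT s|lborel. enn2real (weight s) *\<^sub>R (CLINT \<omega>|M. iexp (z * Y s \<omega>)))"
  proof (rule integral_density_bounded[OF finite_density_weight, where B=1])
    show "norm (CLINT \<omega>|M. iexp (z * Y s \<omega>)) \<le> 1" for s
      by (rule order_trans[OF integral_norm_bound]) (simp add: prob_space)
  qed measurable
  also have "\<dots> = (CLINT s|lborel. of_real q * (enn2real (exp_density \<eta> s) *\<^sub>R iexp ((- q * Im \<Psi>) * s)))"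
  proof (rule integral_cong_AE)
    show "AE s in lborel. enn2real (weight s) *\<^sub>R (CLINT \<omega>|M. iexp (z * Y s \<omega>)) =
        of_real q * (enn2real (exp_density \<eta> s) *\<^sub>R iexp ((- q * Im \<Psi>) * s))"
      using AE_lborel_singleton[of 0]
    proof eventually_elim
      fix s :: real assume "s \<noteq> 0"
      show "enn2real (weight s) *\<^sub>R (CLINT \<omega>|M. iexp (z * Y s \<omega>)) =
        of_real q * (enn2real (exp_density \<eta> s) *\<^sub>R iexp ((- q * Im \<Psi>) * s))"
      proof (cases "s > 0")
        case True
        have "(CLINT \<omega>|M. iexp (z * Y s \<omega>)) = char (distr M borel (Y s)) z"
          unfolding char_def by (subst integral_distr) auto
        also have "\<dots> = exp (- (of_real (q * s) * \<Psi>))" using char_Y[of s z] True z by (simp add: \<Psi>_def)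
        finally have *: "(CLINT \<omega>|M. iexp (z * Y s \<omega>)) = exp (- (of_real (q * s) * \<Psi>))" .
        have "exp (- q * s) *\<^sub>R exp (- (of_real (q * s) * \<Psi>)) = exp (- \<eta> * s) *\<^sub>R iexp ((- q * Im \<Psi>) * s)"
          unfolding scaleR_conv_of_real exp_of_real[symmetric] exp_add[symmetric]
          by (rule arg_cong[where f=exp]) (simp add: complex_eq_iff \<eta>_def algebra_simps)
        then show ?thesis
          using True q unfolding * weight_def exp_density_def
          by (simp add: scaleR_conv_of_real mult.assoc)
      next
        case False
        then show ?thesis using \<open>s \<noteq> 0\<close> by (simp add: weight_def exp_density_def)
      qed
    qed
  qed measurable
  also have "\<dots> = of_real q * char (density lborel (exp_density \<eta>)) (- q * Im \<Psi>)"
    by (simp only: char_density[OF finite_density_exp[OF \<eta>]] integral_mult_right_zero)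
  finally have "char resolvent z = of_real q * char (density lborel (exp_density \<eta>)) (- q * Im \<Psi>)" .
  moreover have "of_real \<eta> - \<i> * of_real (- q * Im \<Psi>) = of_real q * (1 + \<Psi>)"
    by (simp add: complex_eq_iff \<eta>_def)
  ultimately show ?thesis
    using char_exp_density[OF \<eta>, of "- q * Im \<Psi>"] by (simp add: \<Psi>_def mult_ac)
qed

text \<open>The function \<open>l\<close> of the overview: the indicator inside
  \<open>exp_density\<close> restricts the integral to \<open>i > y\<close>. For
  \<open>y \<le> 0\<close> that is no restriction because the second density lives on (0,
  \<infinity>), which makes the value a pure exponential in \<open>y\<close>.\<close>

definition boundary_value :: "real \<Rightarrow> real \<Rightarrow> ennreal" where
  "boundary_value \<eta> y = (\<integral>\<^sup>+i. exp_density \<eta> (i - y) * stieltjes_density \<alpha> i \<partial>lborel)"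

lemma boundary_value_measurable[measurable]: "boundary_value \<eta> \<in> borel_measurable borel"
  unfolding boundary_value_def[abs_def] by measurable

lemma boundary_value_nonpos:
  assumes \<eta>: "0 < \<eta>" "\<eta> < 1" and x: "x \<le> 0"
  shows "boundary_value \<eta> x = ennreal ((1 - \<eta> powr \<alpha>) / (1 - \<eta>) * exp (\<eta> * x))"
proof -
  have "boundary_value \<eta> x = (\<integral>\<^sup>+i. ennreal (exp (\<eta> * x)) * (ennreal (exp (- \<eta> * i)) * stieltjes_density \<alpha> i) \<partial>lborel)"
    unfolding boundary_value_def
  proof (rule nn_integral_cong)
    fix i
    show "exp_density \<eta> (i - x) * stieltjes_density \<alpha> i = ennreal (exp (\<eta> * x)) * (ennreal (exp (- \<eta> * i)) * stieltjes_density \<alpha> i)"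
    proof (cases "i > 0")
      case True
      have "ennreal (exp (- \<eta> * (i - x))) = ennreal (exp (\<eta> * x)) * ennreal (exp (- \<eta> * i))"
        by (simp add: mult_exp_exp algebra_simps flip: ennreal_mult)
      then show ?thesis using True x by (simp add: exp_density_def mult.assoc)
    qed (simp add: stieltjes_density_def)
  qed
  also have "\<dots> = ennreal (exp (\<eta> * x)) * ennreal ((1 - \<eta> powr \<alpha>) / (1 - \<eta>))"
    using \<eta> \<alpha> stieltjes_density_laplace[of \<alpha> \<eta>] by (subst nn_integral_cmult) auto
  finally show ?thesis by (simp add: mult.commute flip: ennreal_mult')
qed

text \<open>Potentials average over \<open>y + Y\<close> and convolutions over \<open>x - Y\<close>,
  so the resolvent equation is read at \<open>- y\<close> and the densities \<open>a\<close> and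
  \<open>b\<close> are reflected. They then vanish on [0, \<infinity>), as the stopping argument
  requires.\<close>

lemma AE_stopped_value_LIMSEQ:
  assumes \<eta>: "0 < \<eta>"
  shows "AE y in lborel. (\<lambda>n. \<integral>\<^sup>+\<omega>. stopped_value (boundary_value \<eta>) y n \<omega> \<partial>M) \<longlonglongrightarrow> boundary_value \<eta> y"
proof -
  have "char resolvent z * (1 - (- \<i> * of_real z) powr of_real \<alpha> * exp (- \<i> * of_real (pi * \<alpha>))) = 1" if "z > 0" for z
    using char_resolvent[OF that] by (simp add: stable_exponent_def)
  from resolvent_equation[OF \<alpha> \<eta> finite_measure_resolvent sets_resolvent this]
  obtain a b where ab: "finite_density a" "finite_density b" and a0: "\<And>x. x \<le> 0 \<Longrightarrow> a x = 0" and b0: "\<And>x. x \<le> 0 \<Longrightarrow> b x = 0"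
    and eq: "AE y in lborel. mconv a resolvent y = (\<integral>\<^sup>+i. exp_density \<eta> (y + i) * stieltjes_density \<alpha> i \<partial>lborel) + mconv b resolvent y"
    by blast
  note [measurable] = ab[THEN finite_density_measurable]
  have [measurable]: "mconv a resolvent \<in> borel_measurable borel" "mconv b resolvent \<in> borel_measurable borel"
    using finite_measure_resolvent sets_resolvent by measurable
  have pot: "potential (\<lambda>x. f (- x)) y = mconv f resolvent (- y)" if [measurable]: "f \<in> borel_measurable borel" for f y
    unfolding mconv_def potential_def by (subst nn_integral_resolvent) (auto simp: algebra_simps)
  show ?thesis
  proof (rule stopped_value_LIMSEQ[of "\<lambda>x. a (- x)" "\<lambda>x. b (- x)"])
    have "Measurable.pred borel (\<lambda>y. mconv a resolvent y = (\<integral>\<^sup>+i. exp_density \<eta> (y + i) * stieltjes_density \<alpha> i \<partial>lborel) + mconv b resolvent y)"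
      by measurable
    from AE_borel_affine[OF _ this eq, of "- 1" 0]
    show "AE y in lborel. potential (\<lambda>x. a (- x)) y = boundary_value \<eta> y + potential (\<lambda>x. b (- x)) y"
      by (simp add: pot boundary_value_def)
    have "finite_density (mconv a resolvent)"
      by (rule finite_density_mconv[OF ab(1) finite_measure_resolvent sets_resolvent])
    from AE_borel_affine[OF _ _ finite_density_AE_finite[OF this], of "- 1" 0]
    show "AE y in lborel. potential (\<lambda>x. a (- x)) y < \<infinity>" by (simp add: pot)
  qed (use a0 b0 in auto)
qed

lemma boundary_value_LIMSEQ:
  assumes \<eta>: "\<eta> \<longlonglongrightarrow> 0" "\<And>m. 0 < \<eta> m" and y: "0 < y"
  shows "(\<lambda>m. boundary_value (\<eta> m) y) \<longlonglongrightarrow> ennreal (exit_laplace \<alpha> y)"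
proof -
  have a: "0 < \<alpha>" using \<alpha> by simp
  have "(\<lambda>m. boundary_value (\<eta> m) y) \<longlonglongrightarrow> (\<integral>\<^sup>+i. stieltjes_density \<alpha> i * indicator {y<..} i \<partial>lborel)"
    unfolding boundary_value_def
  proof (rule nn_integral_dominated_convergence[where w="stieltjes_density \<alpha>"])
    have fin: "AE i in lborel. stieltjes_density \<alpha> i < \<infinity>"
      using \<alpha> by (intro finite_density_AE_finite finite_density_stieltjes) auto
    show "AE i in lborel. exp_density (\<eta> m) (i - y) * stieltjes_density \<alpha> i \<le> stieltjes_density \<alpha> i" for m
    proof (rule AE_I2)
      fix i
      have "exp_density (\<eta> m) (i - y) \<le> 1"
        using \<eta>(2)[of m] by (auto simp: exp_density_def indicator_def)
      then show "exp_density (\<eta> m) (i - y) * stieltjes_density \<alpha> i \<le> stieltjes_density \<alpha> i"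
        using mult_right_mono[of "exp_density (\<eta> m) (i - y)" 1 "stieltjes_density \<alpha> i"] by simp
    qed
    show "AE i in lborel. (\<lambda>m. exp_density (\<eta> m) (i - y) * stieltjes_density \<alpha> i) \<longlonglongrightarrow> stieltjes_density \<alpha> i * indicator {y<..} i"
      using fin
    proof eventually_elim
      fix i assume "stieltjes_density \<alpha> i < \<infinity>"
      then have f: "stieltjes_density \<alpha> i < top" by simp
      have "(\<lambda>m. ennreal (exp (- \<eta> m * (i - y)))) \<longlonglongrightarrow> ennreal (exp (- 0 * (i - y)))"
        by (intro tendsto_intros \<eta>)
      then have "(\<lambda>m. exp_density (\<eta> m) (i - y)) \<longlonglongrightarrow> indicator {y<..} i"
        by (cases "y < i") (simp_all add: exp_density_def)
      from ennreal_tendsto_cmult[OF f this]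
      show "(\<lambda>m. exp_density (\<eta> m) (i - y) * stieltjes_density \<alpha> i) \<longlonglongrightarrow> stieltjes_density \<alpha> i * indicator {y<..} i"
        by (simp add: mult.commute)
    qed
  qed (use stieltjes_density_mass[OF a \<alpha>(2)] in auto)
  then show ?thesis using stieltjes_density_tail[OF a \<alpha>(2) y] by simp
qed

lemma AE_hitting_time_laplace:
  "AE y in lborel. 0 < y \<longrightarrow> (\<integral>\<^sup>+\<omega>. ennreal (exp_minus (ereal q * hitting_time y \<omega>)) \<partial>M) = ennreal (exit_laplace \<alpha> y)"
proof -
  \<comment> \<open>The offset 2 keeps \<open>\<eta> m\<close> below 1 already for
    \<open>m = 0\<close>, the range in which the Laplace transform of
    \<open>stieltjes_density\<close> is known.\<close>
  define \<eta> where "\<eta> m = 1 / real (m + 2)" for m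
  have \<eta>: "0 < \<eta> m" "\<eta> m < 1" for m by (simp_all add: \<eta>_def)
  have \<eta>0: "\<eta> \<longlonglongrightarrow> 0" unfolding \<eta>_def by real_asymp
  define W where "W m = (1 - \<eta> m powr \<alpha>) / (1 - \<eta> m)" for m
  have le: "\<eta> m powr \<alpha> \<le> 1" "\<eta> m \<le> \<eta> m powr \<alpha>" for m
    using \<eta>[of m] \<alpha> powr_mono'[of \<alpha> 1 "\<eta> m"] by (auto intro: powr_le1)
  have W: "0 \<le> W m" "W m \<le> 1" for m
    using \<eta>[of m] le[of m] by (auto simp: W_def divide_le_eq_1)
  have W1: "W \<longlonglongrightarrow> 1"
  proof -
    have "(\<lambda>m. \<eta> m powr \<alpha>) \<longlonglongrightarrow> 0 powr \<alpha>"
      using \<alpha> \<eta> \<eta>0 by (intro tendsto_powr') (auto simp: less_imp_le)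
    from tendsto_divide[OF tendsto_diff[OF tendsto_const this] tendsto_diff[OF tendsto_const \<eta>0], of 1 1]
    show ?thesis by (simp add: W_def[abs_def])
  qed
  have "AE y in lborel. \<forall>m. (\<lambda>n. \<integral>\<^sup>+\<omega>. stopped_value (boundary_value (\<eta> m)) y n \<omega> \<partial>M) \<longlonglongrightarrow> boundary_value (\<eta> m) y"
    unfolding AE_all_countable using AE_stopped_value_LIMSEQ[OF \<eta>(1)] by simp
  then show ?thesis
  proof eventually_elim
    fix y assume all: "\<forall>m. (\<lambda>n. \<integral>\<^sup>+\<omega>. stopped_value (boundary_value (\<eta> m)) y n \<omega> \<partial>M) \<longlonglongrightarrow> boundary_value (\<eta> m) y"
    have "boundary_value (\<eta> m) y = (\<integral>\<^sup>+\<omega>. limit_value (W m) (\<eta> m) y \<omega> \<partial>M)" for m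
      using boundary_value_nonpos[OF \<eta>, of _ m] W \<eta>(1)[of m]
      by (intro hitting_time_exp_moment[OF all[rule_format]]) (auto simp: W_def)
    then have "(\<lambda>m. boundary_value (\<eta> m) y) \<longlonglongrightarrow> (\<integral>\<^sup>+\<omega>. ennreal (exp_minus (ereal q * hitting_time y \<omega>)) \<partial>M)"
      using limit_value_LIMSEQ[OF W1 W \<eta>0, of y] \<eta>(1) by (simp add: less_imp_le)
    then show "0 < y \<longrightarrow> (\<integral>\<^sup>+\<omega>. ennreal (exp_minus (ereal q * hitting_time y \<omega>)) \<partial>M) = ennreal (exit_laplace \<alpha> y)"
      using boundary_value_LIMSEQ[OF \<eta>0 \<eta>(1), of y] by (auto intro: LIMSEQ_unique)
  qed
qed

section \<open>From almost every starting point to every starting point\<close>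

lemma exp_minus_antimono: "0 \<le> s \<Longrightarrow> s \<le> t \<Longrightarrow> exp_minus (ereal q * t) \<le> exp_minus (ereal q * s)"
  using q by (cases s; cases t) (auto simp: exp_minus_def)

lemma exp_minus_inj:
  assumes "0 \<le> s" "0 \<le> t" "exp_minus (ereal q * s) = exp_minus (ereal q * t)"
  shows "s = t"
  using assms q by (cases s; cases t) (auto simp: exp_minus_def)

lemma exp_minus_bounds: "0 \<le> exp_minus (ereal q * s)" "0 \<le> s \<Longrightarrow> exp_minus (ereal q * s) \<le> 1"
  using q by (cases s; auto simp: exp_minus_def)+

lemma exp_minus_hitting_measurable[measurable]: "(\<lambda>\<omega>. exp_minus (ereal q * hitting_time y \<omega>)) \<in> borel_measurable M"
  unfolding exp_minus_def by measurable

lemma hitting_time_mono: "y \<le> y' \<Longrightarrow> hitting_time y \<omega> \<le> hitting_time y' \<omega>"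
  unfolding hitting_time_def by (intro INF_superset_mono subset_refl) (auto simp: hit_def)

lemma AE_lborel_between:
  assumes "AE y in lborel. P y" "a < (b :: real)"
  obtains y where "a < y" "y < b" "P y"
proof (rule ccontr)
  assume "\<not> thesis"
  then have "\<not> (a < y \<and> y < b \<and> P y)" for y using that by blast
  with assms(1) have "AE y in lborel. y \<notin> {a<..<b}" by (auto elim!: eventually_mono)
  then have "{a<..<b} \<in> null_sets lborel" by (subst AE_iff_null_sets) auto
  then show False using assms(2) by (simp add: null_sets_def)
qed

lemma hitting_time_laplace:
  assumes y: "0 < y"
  shows "(\<integral>\<^sup>+\<omega>. ennreal (exp_minus (ereal q * hitting_time y \<omega>)) \<partial>M) = ennreal (exit_laplace \<alpha> y)"
proof -
  define I where "I y = (\<integral>\<^sup>+\<omega>. ennreal (exp_minus (ereal q * hitting_time y \<omega>)) \<partial>M)" for y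
  have a: "0 < \<alpha>" using \<alpha> by simp
  note G = exit_laplace_LIMSEQ[OF a \<alpha>(2) y, THEN tendsto_ennrealI]
  have mono: "I y' \<le> I y" if "y \<le> y'" for y y'
    unfolding I_def by (intro nn_integral_mono ennreal_leI exp_minus_antimono hitting_time_nonneg hitting_time_mono that)
  \<comment> \<open>The lower end is at least \<open>y / 2\<close>, which keeps the approximating
    points positive, where the almost everywhere statement says something.\<close>
  have "\<exists>u. \<forall>j. y - y / real (j + 2) < u j \<and> u j < y \<and> I (u j) = ennreal (exit_laplace \<alpha> (u j))"
  proof (intro choice allI)
    fix j :: nat
    have "y - y / real (j + 2) < y" using y by simp
    from AE_hitting_time_laplace this obtain v where "y - y / real (j + 2) < v" "v < y"
      "0 < v \<longrightarrow> (\<integral>\<^sup>+\<omega>. ennreal (exp_minus (ereal q * hitting_time v \<omega>)) \<partial>M) = ennreal (exit_laplace \<alpha> v)"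
      by (rule AE_lborel_between)
    moreover have "0 \<le> y - y / real (j + 2)" using y by (simp add: field_simps)
    ultimately show "\<exists>v. y - y / real (j + 2) < v \<and> v < y \<and> I v = ennreal (exit_laplace \<alpha> v)"
      unfolding I_def by (intro exI[of _ v]) auto
  qed
  then obtain u where u: "\<And>j. y - y / real (j + 2) < u j" "\<And>j. u j < y" "\<And>j. I (u j) = ennreal (exit_laplace \<alpha> (u j))"
    by blast
  have u0: "0 < u j" for j
  proof -
    have "0 \<le> y - y / real (j + 2)" using y by (simp add: field_simps)
    then show ?thesis using u(1)[of j] by simp
  qed
  have ulim: "u \<longlonglongrightarrow> y"
  proof (rule tendsto_sandwich[of "\<lambda>j. y - y / real (j + 2)" _ _ "\<lambda>_. y"])
    show "(\<lambda>j. y - y / real (j + 2)) \<longlonglongrightarrow> y" by real_asymp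
  qed (intro always_eventually allI less_imp_le u tendsto_const)+
  have "\<exists>v. \<forall>j. y < v j \<and> v j < y + 1 / real (j + 1) \<and> I (v j) = ennreal (exit_laplace \<alpha> (v j))"
  proof (intro choice allI)
    fix j :: nat
    have "y < y + 1 / real (j + 1)" by simp
    from AE_hitting_time_laplace this obtain v where "y < v" "v < y + 1 / real (j + 1)"
      "0 < v \<longrightarrow> (\<integral>\<^sup>+\<omega>. ennreal (exp_minus (ereal q * hitting_time v \<omega>)) \<partial>M) = ennreal (exit_laplace \<alpha> v)"
      by (rule AE_lborel_between)
    then show "\<exists>v. y < v \<and> v < y + 1 / real (j + 1) \<and> I v = ennreal (exit_laplace \<alpha> v)"
      unfolding I_def using y by (intro exI[of _ v]) auto
  qed
  then obtain v where v: "\<And>j. y < v j" "\<And>j. v j < y + 1 / real (j + 1)" "\<And>j. I (v j) = ennreal (exit_laplace \<alpha> (v j))"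
    by blast
  have v0: "0 < v j" for j using v(1)[of j] y by simp
  have vlim: "v \<longlonglongrightarrow> y"
  proof (rule tendsto_sandwich[of "\<lambda>_. y" _ _ "\<lambda>j. y + 1 / real (j + 1)"])
    show "(\<lambda>j. y + 1 / real (j + 1)) \<longlonglongrightarrow> y" by real_asymp
  qed (intro always_eventually allI less_imp_le v tendsto_const)+
  have "I y \<le> ennreal (exit_laplace \<alpha> y)"
    by (rule LIMSEQ_le_const[OF G[OF ulim u0]]) (auto simp: less_imp_le u mono simp flip: u(3))
  moreover have "ennreal (exit_laplace \<alpha> y) \<le> I y"
    by (rule LIMSEQ_le_const2[OF G[OF vlim v0]]) (auto simp: less_imp_le v mono simp flip: v(3))
  ultimately show ?thesis unfolding I_def by (rule antisym)
qed

section \<open>Comparison of the exit time with the dyadic hitting time\<close>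

lemma exit_time_le_hitting_time: "exit_time (\<lambda>t \<omega>. y + Y t \<omega>) \<omega> \<le> hitting_time y \<omega>"
  unfolding hitting_time_def
proof (rule INF_greatest)
  fix p :: "nat \<times> nat"
  show "exit_time (\<lambda>t \<omega>. y + Y t \<omega>) \<omega> \<le> (case p of (n, k) \<Rightarrow> if hit y n k \<omega> then ereal (real k / 2 ^ n) else \<infinity>)"
    unfolding exit_time_def by (cases p) (auto simp: hit_def not_less intro!: Inf_lower)
qed

text \<open>If \<open>y + Y t \<le> 0\<close> then \<open>y' + Y t\<close> is strictly negative and
  stays so just after \<open>t\<close>, hence at dyadic times arbitrarily close to \<open>t\<close>.
  Starting strictly lower is essential: a path may touch 0 without being nonpositive at any nearby
  dyadic time.\<close>

lemma hitting_time_le_exit_time: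
  assumes \<omega>: "\<omega> \<in> space M" and y: "y' < y"
  shows "hitting_time y' \<omega> \<le> exit_time (\<lambda>t \<omega>. y + Y t \<omega>) \<omega>"
  unfolding exit_time_def
proof (rule Inf_greatest)
  fix r assume "r \<in> {ereal t |t. 0 \<le> t \<and> y + Y t \<omega> \<notin> {0<..}}"
  then obtain t where r: "r = ereal t" and t: "0 \<le> t" "y + Y t \<omega> \<le> 0" by auto
  show "hitting_time y' \<omega> \<le> r"
    unfolding r
  proof (rule ereal_le_epsilon2)
    fix e :: real assume e: "0 < e"
    have "eventually (\<lambda>r. Y r \<omega> < - y') (at_right t)"
      using t y rcont[OF \<omega> t(1)] by (intro order_tendstoD) auto
    then obtain b where b: "b > t" "\<And>r. t < r \<Longrightarrow> r < b \<Longrightarrow> Y r \<omega> < - y'"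
      unfolding eventually_at_right_field by auto
    have "t < min b (t + e)" using b e by simp
    with t(1) obtain n k where nk: "t < real k / 2 ^ n" "real k / 2 ^ n < min b (t + e)" by (rule dyadic_between)
    then have "hit y' n k \<omega>" using b(2)[of "real k / 2 ^ n"] by (simp add: hit_def)
    from hitting_time_le[OF this] have "hitting_time y' \<omega> \<le> ereal (real k / 2 ^ n)" .
    also have "\<dots> \<le> ereal t + ereal e" using nk by simp
    finally show "hitting_time y' \<omega> \<le> ereal t + ereal e" .
  qed
qed

text \<open>The exit time lies between the hitting times from the lower points \<open>u j\<close>
  and the one from \<open>y\<close>. Correspondingly its discount factor lies between
  \<open>H y\<close> and \<open>V\<close>, and continuity of \<open>exit_laplace\<close> gives these
  two the same expectation, so they agree almost surely.\<close>

lemma AE_exit_time_eq: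
  assumes y: "0 < y"
  shows "AE \<omega> in M. exit_time (\<lambda>t \<omega>. y + Y t \<omega>) \<omega> = hitting_time y \<omega>"
proof -
  have a: "0 < \<alpha>" using \<alpha> by simp
  define H where "H y \<omega> = exp_minus (ereal q * hitting_time y \<omega>)" for y \<omega>
  have [measurable]: "H y \<in> borel_measurable M" for y unfolding H_def by measurable
  have H: "0 \<le> H y \<omega>" "H y \<omega> \<le> 1" for y \<omega>
    unfolding H_def by (intro exp_minus_bounds hitting_time_nonneg)+
  have int: "integrable M (H y)" for y
    by (rule integrable_const_bound[where B=1]) (use H in auto)
  have EH: "expectation (H y) = exit_laplace \<alpha> y" if "0 < y" for y
    using hitting_time_laplace[OF that] H exit_laplace_nonneg[OF a \<alpha>(2), of y]
    unfolding H_def[symmetric] by (simp add: nn_integral_eq_integral[OF int] integral_nonneg_AE)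
  have Hmono: "H y' \<omega> \<le> H y \<omega>" if "y \<le> y'" for y y' \<omega>
    unfolding H_def by (intro exp_minus_antimono hitting_time_nonneg hitting_time_mono that)
  define u where "u j = y - y / real (j + 2)" for j
  have u: "0 < u j" "u j < y" for j
    using y by (simp_all add: u_def field_simps add_pos_nonneg)
  have ulim: "u \<longlonglongrightarrow> y" unfolding u_def by real_asymp
  define V where "V \<omega> = (INF j. H (u j) \<omega>)" for \<omega>
  have bdd: "bdd_below (range (\<lambda>j. H (u j) \<omega>))" for \<omega> using H(1) by (intro bdd_belowI2)
  have [measurable]: "V \<in> borel_measurable M" unfolding V_def[abs_def] by (rule borel_measurable_cINF) (auto simp: bdd)
  have VH: "H y \<omega> \<le> V \<omega>" for \<omega>
    unfolding V_def using u by (intro cINF_greatest Hmono) (auto simp: less_imp_le)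
  have V: "0 \<le> V \<omega>" "V \<omega> \<le> H (u j) \<omega>" for \<omega> j
    using H(1)[of y \<omega>] VH[of \<omega>] cINF_lower[OF bdd, of j \<omega>] by (auto simp: V_def)
  have intV: "integrable M V"
    by (rule Bochner_Integration.integrable_bound[OF int[of "u 0"]]) (use V H in \<open>auto intro!: AE_I2\<close>)
  have "expectation V \<le> exit_laplace \<alpha> y"
  proof (rule LIMSEQ_le_const[OF exit_laplace_LIMSEQ[OF a \<alpha>(2) y ulim u(1)]])
    have "expectation V \<le> exit_laplace \<alpha> (u j)" for j
      unfolding EH[OF u(1), symmetric] by (intro integral_mono intV int V)
    then show "\<exists>N. \<forall>n\<ge>N. expectation V \<le> exit_laplace \<alpha> (u n)" by blast
  qed
  then have "expectation (\<lambda>\<omega>. V \<omega> - H y \<omega>) \<le> 0" using EH[OF y] intV int by simp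
  moreover have "0 \<le> expectation (\<lambda>\<omega>. V \<omega> - H y \<omega>)" using VH by (intro integral_nonneg_AE) simp
  ultimately have "expectation (\<lambda>\<omega>. V \<omega> - H y \<omega>) = 0" by simp
  then have "AE \<omega> in M. V \<omega> - H y \<omega> = 0"
    using integral_nonneg_eq_0_iff_AE[of M "\<lambda>\<omega>. V \<omega> - H y \<omega>"] VH intV int by simp
  then show ?thesis
  proof (rule AE_mp, intro AE_I2 impI)
    fix \<omega> assume \<omega>: "\<omega> \<in> space M" and eq: "V \<omega> - H y \<omega> = 0"
    let ?\<tau> = "exit_time (\<lambda>t \<omega>. y + Y t \<omega>) \<omega>"
    have \<tau>0: "0 \<le> ?\<tau>" unfolding exit_time_def by (rule Inf_greatest) auto
    have "exp_minus (ereal q * ?\<tau>) \<le> V \<omega>"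
      unfolding V_def
    proof (rule cINF_greatest)
      fix j show "exp_minus (ereal q * ?\<tau>) \<le> H (u j) \<omega>"
        unfolding H_def by (intro exp_minus_antimono hitting_time_nonneg hitting_time_le_exit_time[OF \<omega> u(2)])
    qed simp
    moreover have "H y \<omega> \<le> exp_minus (ereal q * ?\<tau>)"
      unfolding H_def by (intro exp_minus_antimono \<tau>0 exit_time_le_hitting_time)
    ultimately have "exp_minus (ereal q * ?\<tau>) = exp_minus (ereal q * hitting_time y \<omega>)" using eq by (simp add: H_def)
    then show "?\<tau> = hitting_time y \<omega>" by (intro exp_minus_inj \<tau>0 hitting_time_nonneg)
  qed
qed

end

section \<open>The positivity coefficient\<close>

lemma prob_space_exp_density: "prob_space (density lborel (exp_density 1))"
  using nn_integral_exp[of 1] by (intro prob_spaceI) (simp add: emeasure_density exp_density_def[abs_def])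

lemma AE_exp_density: "0 < \<eta> \<Longrightarrow> AE t in density lborel (exp_density \<eta>). 0 < t"
  by (subst AE_density) (auto intro!: AE_I2 simp: exp_density_def indicator_def)

lemma char_exp_density_parts:
  assumes "0 < a"
  shows "Re (char (density lborel (exp_density a)) y) = a / (a\<^sup>2 + y\<^sup>2)"
    and "Im (char (density lborel (exp_density a)) y) = y / (a\<^sup>2 + y\<^sup>2)"
proof -
  have "of_real a - \<i> * of_real y \<noteq> 0" using assms by (auto simp: complex_eq_iff)
  then have "char (density lborel (exp_density a)) y = 1 / (of_real a - \<i> * of_real y)"
    using char_exp_density[OF assms, of y] by (simp add: field_simps)
  then show "Re (char (density lborel (exp_density a)) y) = a / (a\<^sup>2 + y\<^sup>2)"
    "Im (char (density lborel (exp_density a)) y) = y / (a\<^sup>2 + y\<^sup>2)"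
    by (simp_all add: Re_divide Im_divide)
qed

lemma Fubini_bounded:
  fixes f :: "'x \<Rightarrow> 'y \<Rightarrow> 'b :: {banach, second_countable_topology}"
  assumes "finite_measure M" "finite_measure N" and [measurable]: "case_prod f \<in> borel_measurable (M \<Otimes>\<^sub>M N)"
    and "\<And>x y. norm (f x y) \<le> B"
  shows "(\<integral>x. \<integral>y. f x y \<partial>N \<partial>M) = (\<integral>y. \<integral>x. f x y \<partial>M \<partial>N)"
proof -
  interpret M: finite_measure M by fact
  interpret N: finite_measure N by fact
  interpret pair_sigma_finite M N ..
  have "integrable (M \<Otimes>\<^sub>M N) (case_prod f)"
    by (rule finite_measure.integrable_const_bound[where B=B])
      (use assms in \<open>auto intro!: finite_measure_pair_measure\<close>)
  from Fubini_integral[OF this] show ?thesis by simp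
qed

text \<open>Both sides are the double integral of \<open>iexp (s * x * z)\<close>. With an
  exponential law as one of the measures, expectations of rational functions under the other become
  integrals of its characteristic function.\<close>

lemma char_swap:
  assumes "finite_measure M" "finite_measure N" and [measurable_cong]: "sets M = sets borel" "sets N = sets borel"
  shows "(CLINT x|N. char M (s * x)) = (CLINT z|M. char N (s * z))"
proof -
  have "(CLINT x|N. CLINT z|M. iexp ((s * x) * z)) = (CLINT z|M. CLINT x|N. iexp ((s * x) * z))"
    by (rule Fubini_bounded[OF assms(2,1), where B=1]) auto
  then show ?thesis by (simp add: char_def mult_ac)
qed

text \<open>\<open>sin (B * t) / t\<close> is the integral of \<open>cos (w * t)\<close> over
  \<open>w\<close> in [0, B]. After Fubini the inner integral is the Laplace transform
  \<open>A / (A\<^sup>2 + w\<^sup>2)\<close> of the cosine, with primitive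
  \<open>arctan (w / A)\<close>.\<close>

lemma integral_sin_div_exp_density_nonneg:
  assumes A: "0 < A" and B: "0 \<le> B"
  shows "(LINT t|density lborel (exp_density A). sin (B * t) / t) = arctan (B / A)"
proof -
  let ?D = "density lborel (exp_density A)" and ?R = "density lborel (\<lambda>w. ennreal (indicator {0..B} w))"
  have D: "finite_measure ?D" by (rule finite_measure_density_lborel[OF finite_density_exp[OF A]])
  have R: "finite_measure ?R"
    by (rule finite_measure_density_lborel) (simp add: finite_density_def ennreal_indicator B)
  have RI: "(LINT w|?R. h w) = F B - F 0"
    if "\<And>w. (F has_real_derivative h w) (at w)" "\<And>w. isCont h w" for h F :: "real \<Rightarrow> real"
  proof -
    have [measurable]: "h \<in> borel_measurable borel"
      by (intro borel_measurable_continuous_onI continuous_at_imp_continuous_on ballI that)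
    have "(LINT w|?R. h w) = (\<integral>w. h w * indicator {0..B} w \<partial>lborel)"
      by (subst integral_density) (auto simp: mult.commute)
    also have "\<dots> = F B - F 0" by (rule integral_FTC_Icc_real[OF B]) (use that in auto)
    finally show ?thesis .
  qed
  have "(LINT t|?D. sin (B * t) / t) = (LINT t|?D. LINT w|?R. cos (w * t))"
  proof (rule integral_cong_AE)
    show "AE t in ?D. sin (B * t) / t = (LINT w|?R. cos (w * t))"
      using AE_exp_density[OF A]
    proof eventually_elim
      fix t :: real assume t: "0 < t"
      have "(LINT w|?R. cos (w * t)) = sin (B * t) / t - sin (0 * t) / t"
        by (rule RI) (use t in \<open>auto intro!: derivative_eq_intros continuous_intros\<close>)
      then show "sin (B * t) / t = (LINT w|?R. cos (w * t))" by simp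
    qed
    interpret R: finite_measure ?R by (rule R)
    show "(\<lambda>t. LINT w|?R. cos (w * t)) \<in> borel_measurable ?D" by measurable
  qed measurable
  also have "\<dots> = (LINT w|?R. LINT t|?D. cos (w * t))"
    by (rule Fubini_bounded[OF D R, where B=1]) auto
  also have "\<dots> = (LINT w|?R. A / (A\<^sup>2 + w\<^sup>2))"
  proof (rule Bochner_Integration.integral_cong)
    fix w
    have "complex_integrable ?D (\<lambda>t. iexp (w * t))"
      by (rule finite_measure.integrable_const_bound[OF D, where B=1]) auto
    then have "Re (char ?D w) = (LINT t|?D. Re (iexp (w * t)))"
      unfolding char_def by (rule integral_Re[symmetric])
    then show "(LINT t|?D. cos (w * t)) = A / (A\<^sup>2 + w\<^sup>2)"
      using char_exp_density_parts(1)[OF A, of w] by (simp add: Re_exp)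
  qed simp
  also have "\<dots> = arctan (B / A) - arctan (0 / A)"
  proof (rule RI)
    fix w
    have "A\<^sup>2 + w\<^sup>2 \<noteq> 0" "1 + (w / A)\<^sup>2 \<noteq> 0" using A by (auto simp: add_pos_nonneg less_imp_neq[symmetric])
    moreover from this(2) have "A\<^sup>2 * (1 + (w / A)\<^sup>2) = A\<^sup>2 + w\<^sup>2" using A by (simp add: field_simps)
    ultimately have "A / (A\<^sup>2 + w\<^sup>2) = inverse (1 + (w / A)\<^sup>2) * (1 / A)"
      using A by (simp add: divide_simps power2_eq_square)
    then show "((\<lambda>w. arctan (w / A)) has_real_derivative A / (A\<^sup>2 + w\<^sup>2)) (at w)"
      using A by (auto intro!: derivative_eq_intros)
    show "isCont (\<lambda>w. A / (A\<^sup>2 + w\<^sup>2)) w" using \<open>A\<^sup>2 + w\<^sup>2 \<noteq> 0\<close> by (intro continuous_intros) auto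
  qed
  finally show ?thesis by simp
qed

lemma integral_sin_div_exp_density:
  assumes A: "0 < A"
  shows "(LINT t|density lborel (exp_density A). sin (B * t) / t) = arctan (B / A)"
proof (cases "0 \<le> B")
  case False
  then show ?thesis using integral_sin_div_exp_density_nonneg[OF A, of "- B"] by (simp add: arctan_minus)
qed (simp add: integral_sin_div_exp_density_nonneg A)

text \<open>In the variable \<open>s = t powr (1 / \<alpha>) * x\<close> one has
  \<open>dt / t = \<alpha> * ds / s\<close>, so the integral is \<alpha> times that of
  \<open>1 / (1 + s\<^sup>2)\<close> over the half-line. The primitive
  \<open>\<alpha> * arctan s\<close> is used directly.\<close>

lemma integral_cauchy_kernel_pos:
  fixes \<alpha> x :: real
  assumes \<alpha>: "0 < \<alpha>" and x: "0 < x"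
  defines "k \<equiv> (\<lambda>t. t powr (1 / \<alpha>) * x / (1 + (t powr (1 / \<alpha>) * x)\<^sup>2) / t)"
  shows "set_integrable lborel {0<..} k" "(LBINT t:{0<..}. k t) = \<alpha> * (pi / 2)"
proof -
  let ?F = "\<lambda>t. \<alpha> * arctan (t powr (1 / \<alpha>) * x)"
  have pos: "1 + (t powr (1 / \<alpha>) * x)\<^sup>2 > 0" for t by (simp add: add_pos_nonneg)
  have D: "DERIV ?F t :> k t" if "0 < t" for t
  proof -
    have "((\<lambda>t. t powr (1 / \<alpha>)) has_real_derivative 1 / \<alpha> * t powr (1 / \<alpha> - 1)) (at t)"
      using that by (rule has_real_derivative_powr)
    then have "DERIV ?F t :> \<alpha> * (inverse (1 + (t powr (1 / \<alpha>) * x)\<^sup>2) * (1 / \<alpha> * t powr (1 / \<alpha> - 1) * x))"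
      by (intro DERIV_cmult DERIV_chain2[OF DERIV_arctan] DERIV_cmult_right)
    also have "\<alpha> * (inverse (1 + (t powr (1 / \<alpha>) * x)\<^sup>2) * (1 / \<alpha> * t powr (1 / \<alpha> - 1) * x)) = k t"
      using that \<alpha> by (simp add: k_def powr_diff divide_inverse mult_ac)
    finally show ?thesis .
  qed
  have C: "isCont k t" if "0 < t" for t
    using that pos[of t] unfolding k_def by (intro continuous_intros) auto
  have L0: "(?F \<longlongrightarrow> 0) (at_right 0)"
  proof -
    have "((\<lambda>t. t powr (1 / \<alpha>)) \<longlongrightarrow> 0) (at_right 0)"
      using \<alpha> by real_asymp
    then have "(?F \<longlongrightarrow> \<alpha> * arctan (0 * x)) (at_right 0)" by (intro tendsto_intros)
    then show ?thesis by simp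
  qed
  have L1: "(?F \<longlongrightarrow> \<alpha> * (pi / 2)) at_top"
  proof -
    have "filterlim (\<lambda>t. t powr (1 / \<alpha>) * x) at_top at_top"
      using \<alpha> x by real_asymp
    then have "((\<lambda>t. arctan (t powr (1 / \<alpha>) * x)) \<longlongrightarrow> pi / 2) at_top"
      by (rule filterlim_compose[OF tendsto_arctan_at_top])
    then show ?thesis by (intro tendsto_intros)
  qed
  have e: "einterval 0 \<infinity> = {0<..}" by (auto simp: einterval_def zero_ereal_def)
  note FTC = interval_integral_FTC_nonneg[of 0 \<infinity> ?F k 0 "\<alpha> * (pi / 2)"]
  have "set_integrable lborel (einterval 0 \<infinity>) k" "(LBINT t=0..\<infinity>. k t) = \<alpha> * (pi / 2) - 0"
    by (rule FTC; (use D C L0 L1 x pos in \<open>auto simp: k_def ereal_tendsto_simps zero_ereal_def less_imp_le\<close>))+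
  then show "set_integrable lborel {0<..} k" "(LBINT t:{0<..}. k t) = \<alpha> * (pi / 2)"
    unfolding e interval_lebesgue_integral_def by (auto simp: e)
qed

text \<open>Zolotarev's formula, obtained by computing the expectation of \<open>sgn\<close> in two
  ways. By scaling, \<open>k t x\<close> integrates over \<open>t\<close> to \<alpha> \<pi> / 2
  times \<open>sgn x\<close>. Its expectation under \<open>N\<close> is, by \<open>char_swap\<close>
  with an exponential law, the average of \<open>g t z\<close>, whose integral over \<open>t\<close>
  is the phase \<theta> for every \<open>z > 0\<close>.\<close>

lemma positivity_of_char:
  fixes N :: "real measure" and \<alpha> \<theta> c :: real
  assumes N: "real_distribution N" and \<alpha>: "0 < \<alpha>" and c: "0 < c" and \<theta>: "- pi / 2 < \<theta>" "\<theta> < pi / 2"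
    and charN: "\<And>z. 0 < z \<Longrightarrow> char N z = exp (- (of_real (c * z powr \<alpha>) * exp (- \<i> * of_real \<theta>)))"
  shows "measure N {0..} = 1 / 2 + \<theta> / (pi * \<alpha>)"
proof -
  interpret N: real_distribution N by fact
  let ?D = "density lborel (exp_density 1)"
  interpret D: prob_space ?D by (rule prob_space_exp_density)
  define A B where "A z = c * z powr \<alpha> * cos \<theta>" and "B z = c * z powr \<alpha> * sin \<theta>" for z
  have cos: "0 < cos \<theta>" using \<theta> by (intro cos_gt_zero_pi) auto
  have Apos: "0 < A z" if "0 < z" for z using that c cos by (simp add: A_def)
  have char_scaled: "char N (s * z) = exp (of_real (- (s powr \<alpha> * A z)) + \<i> * of_real (s powr \<alpha> * B z))" if "0 < s" "0 < z" for s z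
  proof -
    have "char N (s * z) = exp (- (of_real (c * (s * z) powr \<alpha>) * exp (- \<i> * of_real \<theta>)))"
      using that by (intro charN) simp
    also have "exp (- \<i> * of_real \<theta>) = cis (- \<theta>)" by (simp add: cis_conv_exp)
    also have "- (of_real (c * (s * z) powr \<alpha>) * cis (- \<theta>)) = of_real (- (s powr \<alpha> * A z)) + \<i> * of_real (s powr \<alpha> * B z)"
      using that by (simp add: complex_eq_iff A_def B_def powr_mult)
    finally show ?thesis .
  qed
  have int_char: "complex_integrable ?D (\<lambda>z. char N (s * z))" for s
    by (rule D.integrable_const_bound[where B=1]) (use N.cmod_char_le_1 in auto)
  have int_charD: "complex_integrable N (\<lambda>x. char ?D (s * x))" for s
  proof (rule N.integrable_const_bound[where B=1])
    interpret D': real_distribution ?D by standard auto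
    show "AE x in N. norm (char ?D (s * x)) \<le> 1" using D'.cmod_char_le_1 by simp
    show "(\<lambda>x. char ?D (s * x)) \<in> borel_measurable N" by measurable
  qed
  have swap: "(CLINT x|N. char ?D (s * x)) = (CLINT z|?D. char N (s * z))" for s
    by (rule char_swap) (auto intro: N.finite_measure_axioms D.finite_measure_axioms)
  \<comment> \<open>The mass at 0 is the limit of the expectation of
    \<open>1 / (1 + (n x)\<^sup>2)\<close>, and \<open>char_swap\<close> turns this expectation into
    an average of \<open>char N (n z)\<close>, which tends to 0.\<close>
  have zero: "measure N {0} = 0"
  proof -
    have lhs: "(\<lambda>n. LINT x|N. 1 / (1 + (real n * x)\<^sup>2)) \<longlonglongrightarrow> (LINT x|N. indicator {0} x)"
    proof (rule integral_dominated_convergence[where w="\<lambda>_. 1"])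
      show "AE x in N. (\<lambda>n. 1 / (1 + (real n * x)\<^sup>2)) \<longlonglongrightarrow> indicator {0} x"
      proof (rule AE_I2)
        fix x :: real
        show "(\<lambda>n. 1 / (1 + (real n * x)\<^sup>2)) \<longlonglongrightarrow> indicator {0} x"
        proof (cases "x = 0")
          case False
          then have "x < 0 \<or> 0 < x" by auto
          then have "(\<lambda>n. 1 / (1 + (real n * x)\<^sup>2)) \<longlonglongrightarrow> 0" by (elim disjE) real_asymp+
          then show ?thesis using False by simp
        qed simp
      qed
      show "AE x in N. norm (1 / (1 + (real n * x)\<^sup>2)) \<le> 1" for n
        by (rule AE_I2) (simp add: divide_le_eq_1 add_pos_nonneg)
    qed auto
    have rhs: "(\<lambda>n. CLINT z|?D. char N (real n * z)) \<longlonglongrightarrow> (CLINT z|?D. 0)"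
    proof (rule integral_dominated_convergence[where w="\<lambda>_. 1"])
      show "AE z in ?D. (\<lambda>n. char N (real n * z)) \<longlonglongrightarrow> 0"
        using AE_exp_density[OF zero_less_one]
      proof eventually_elim
        fix z :: real assume z: "0 < z"
        have "(\<lambda>n. exp (- (real n powr \<alpha> * A z))) \<longlonglongrightarrow> 0"
          using \<alpha> Apos[OF z] by real_asymp
        then have "(\<lambda>n. norm (char N (real n * z))) \<longlonglongrightarrow> 0"
        proof (rule Lim_transform_eventually)
          show "eventually (\<lambda>n. exp (- (real n powr \<alpha> * A z)) = norm (char N (real n * z))) sequentially"
            using eventually_gt_at_top[of 0] by eventually_elim (simp add: char_scaled z norm_exp_eq_Re)
        qed
        then show "(\<lambda>n. char N (real n * z)) \<longlonglongrightarrow> 0" by (rule tendsto_norm_zero_cancel)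
      qed
    qed (use N.cmod_char_le_1 in auto)
    have "(LINT x|N. 1 / (1 + (real n * x)\<^sup>2)) = Re (CLINT z|?D. char N (real n * z))" for n
      unfolding swap[symmetric] integral_Re[OF int_charD, symmetric]
      by (simp add: char_exp_density_parts(1)[OF zero_less_one])
    then have "(\<lambda>n. LINT x|N. 1 / (1 + (real n * x)\<^sup>2)) \<longlonglongrightarrow> 0"
      using tendsto_Re[OF rhs] by simp
    with lhs have "(LINT x|N. indicator {0} x) = (0::real)" by (rule LIMSEQ_unique)
    then show ?thesis by simp
  qed
  \<comment> \<open>\<open>k\<close> is the imaginary part of the transform of the exponential law
    at \<open>t powr (1 / \<alpha>) * x\<close>, divided by \<open>t\<close>. The power of
    \<open>t\<close> makes the exponent of \<open>char N\<close> linear in \<open>t\<close>, and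
    \<open>g\<close> is the resulting integrand in \<open>z\<close>.\<close>
  define k where "k t x = t powr (1 / \<alpha>) * x / (1 + (t powr (1 / \<alpha>) * x)\<^sup>2) / t" for t x :: real
  define g where "g t z = exp (- t * A z) * sin (B z * t) / t" for t z :: real
  have [measurable]: "(\<lambda>z. A z) \<in> borel_measurable borel" "(\<lambda>z. B z) \<in> borel_measurable borel"
    unfolding A_def B_def by measurable
  have kg: "(LINT x|N. k t x) = (LINT z|?D. g t z)" if t: "0 < t" for t
  proof -
    let ?s = "t powr (1 / \<alpha>)"
    have s: "0 < ?s" "?s powr \<alpha> = t" using t \<alpha> by (simp_all add: powr_powr)
    have "(LINT x|N. k t x) = (LINT x|N. Im (char ?D (?s * x))) / t"
    proof -
      have "k t x = Im (char ?D (?s * x)) / t" for x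
        by (simp add: k_def char_exp_density_parts(2)[OF zero_less_one])
      then show ?thesis by (simp only: integral_divide_zero)
    qed
    also have "(LINT x|N. Im (char ?D (?s * x))) = (LINT z|?D. Im (char N (?s * z)))"
      unfolding integral_Im[OF int_charD] integral_Im[OF int_char] swap ..
    also have "\<dots> = (LINT z|?D. exp (- t * A z) * sin (B z * t))"
    proof (rule integral_cong_AE)
      show "AE z in ?D. Im (char N (?s * z)) = exp (- t * A z) * sin (B z * t)"
        using AE_exp_density[OF zero_less_one]
      proof eventually_elim
        fix z :: real assume z: "0 < z"
        show "Im (char N (?s * z)) = exp (- t * A z) * sin (B z * t)"
          unfolding char_scaled[OF s(1) z] s(2) by (simp add: Im_exp mult.commute)
      qed
    qed measurable
    finally show ?thesis unfolding g_def by simp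
  qed
  have k_neg: "k t (- x) = - k t x" for t x by (simp add: k_def)
  have k_int: "integrable lborel (\<lambda>t. indicator {0<..} t * k t x)" and k_eq: "(LINT t|lborel. indicator {0<..} t * k t x) = \<alpha> * (pi / 2) * sgn x"
    and k_abs: "(LINT t|lborel. norm (indicator {0<..} t * k t x)) \<le> \<alpha> * (pi / 2)" for x
  proof -
    have *: "integrable lborel (\<lambda>t. indicator {0<..} t * k t x) \<and> (LINT t|lborel. indicator {0<..} t * k t x) = \<alpha> * (pi / 2)
        \<and> (LINT t|lborel. norm (indicator {0<..} t * k t x)) = \<alpha> * (pi / 2)" if x: "0 < x" for x
    proof -
      have "norm (indicator {0<..} t * k t x) = indicator {0<..} t * k t x" for t
        using x by (auto simp: k_def indicator_def)
      then show ?thesis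
        using integral_cauchy_kernel_pos[OF \<alpha> x]
        by (simp add: set_integrable_def set_lebesgue_integral_def k_def)
    qed
    consider "x = 0" | "0 < x" | "0 < - x" by linarith
    then have "integrable lborel (\<lambda>t. indicator {0<..} t * k t x) \<and> (LINT t|lborel. indicator {0<..} t * k t x) = \<alpha> * (pi / 2) * sgn x
        \<and> (LINT t|lborel. norm (indicator {0<..} t * k t x)) \<le> \<alpha> * (pi / 2)"
    proof cases
      case 1
      then show ?thesis using \<alpha> by (simp add: k_def)
    next
      case 2
      then show ?thesis using *[of x] by simp
    next
      case 3
      then show ?thesis using *[of "- x"] by (simp add: k_neg)
    qed
    then show "integrable lborel (\<lambda>t. indicator {0<..} t * k t x)" "(LINT t|lborel. indicator {0<..} t * k t x) = \<alpha> * (pi / 2) * sgn x"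
      "(LINT t|lborel. norm (indicator {0<..} t * k t x)) \<le> \<alpha> * (pi / 2)" by auto
  qed
  interpret LN: pair_sigma_finite N lborel ..
  interpret LD: pair_sigma_finite ?D lborel ..
  have "(LINT x|N. LINT t|lborel. indicator {0<..} t * k t x) = (LINT t|lborel. LINT x|N. indicator {0<..} t * k t x)"
  proof (rule LN.Fubini_integral[symmetric])
    show "integrable (N \<Otimes>\<^sub>M lborel) (\<lambda>(x, t). indicator {0<..} t * k t x)"
    proof (rule LN.Fubini_integrable)
      show m: "(\<lambda>(x, t). indicator {0<..} t * k t x) \<in> borel_measurable (N \<Otimes>\<^sub>M lborel)"
        unfolding k_def by measurable
      have [measurable]: "(\<lambda>x. LINT t|lborel. norm (indicator {0<..} t * k t x)) \<in> borel_measurable N"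
        unfolding k_def by measurable
      show "integrable N (\<lambda>x. LINT t|lborel. norm (case (x, t) of (x, t) \<Rightarrow> indicator {0<..} t * k t x))"
        unfolding prod.case
      proof (rule N.integrable_const_bound[where B="\<alpha> * (pi / 2)"])
        show "AE x in N. norm (LINT t|lborel. norm (indicator {0<..} t * k t x)) \<le> \<alpha> * (pi / 2)"
          using k_abs by (intro AE_I2) (simp add: integral_nonneg_AE)
      qed measurable
    qed (use k_int in simp)
  qed
  also have "(LINT x|N. LINT t|lborel. indicator {0<..} t * k t x) = \<alpha> * (pi / 2) * (LINT x|N. sgn x)"
    unfolding k_eq by simp
  also have "(LINT t|lborel. LINT x|N. indicator {0<..} t * k t x) = (LINT t|lborel. LINT z|?D. indicator {0<..} t * g t z)"
    by (rule Bochner_Integration.integral_cong) (auto simp: kg indicator_def)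
  also have "\<dots> = (LINT z|?D. LINT t|lborel. indicator {0<..} t * g t z)"
  proof (rule LD.Fubini_integral)
    \<comment> \<open>\<open>\<bar>sin x\<bar> \<le> \<bar>x\<bar>\<close> removes the singularity
      at \<open>t = 0\<close>; the bound integrates over \<open>t\<close> to
      \<open>\<bar>B z\<bar> / A z = \<bar>tan \<theta>\<bar>\<close>, which does not depend on
      \<open>z\<close>.\<close>
    have gb: "norm (indicator {0<..} t * g t z) \<le> \<bar>B z\<bar> * enn2real (exp_density (A z) t)" for t z
    proof (cases "0 < t")
      case True
      have "\<bar>sin (B z * t)\<bar> \<le> \<bar>B z * t\<bar>" by (rule abs_sin_x_le_abs_x)
      then have "\<bar>sin (B z * t) / t\<bar> \<le> \<bar>B z\<bar>" using True by (simp add: abs_mult divide_le_eq)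
      then have "\<bar>sin (B z * t) / t\<bar> * exp (- t * A z) \<le> \<bar>B z\<bar> * exp (- t * A z)" by (rule mult_right_mono) simp
      then show ?thesis using True by (simp add: g_def exp_density_def abs_mult mult.commute)
    qed (simp add: exp_density_def)
    have ei: "has_bochner_integral lborel (\<lambda>t. enn2real (exp_density a t)) (1 / a)" if "0 < a" for a
    proof (rule has_bochner_integral_nn_integral)
      have "ennreal (enn2real (exp_density a t)) = exp_density a t" for t by (simp add: exp_density_def indicator_def)
      then show "(\<integral>\<^sup>+t. ennreal (enn2real (exp_density a t)) \<partial>lborel) = ennreal (1 / a)"
        using nn_integral_exp[OF that] by (simp add: exp_density_def)
    qed (use that in auto)
    have gi: "integrable lborel (\<lambda>t. indicator {0<..} t * g t z)"
      and gn: "(LINT t|lborel. norm (indicator {0<..} t * g t z)) \<le> \<bar>tan \<theta>\<bar>" if z: "0 < z" for z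
    proof -
      note e = ei[OF Apos[OF z]]
      have ib: "integrable lborel (\<lambda>t. \<bar>B z\<bar> * enn2real (exp_density (A z) t))"
        using e by (intro integrable_mult_right) (auto simp: has_bochner_integral_iff)
      show gi: "integrable lborel (\<lambda>t. indicator {0<..} t * g t z)"
        by (rule Bochner_Integration.integrable_bound[OF ib]) (use gb in \<open>auto simp: g_def intro: order_trans\<close>)
      have "(LINT t|lborel. norm (indicator {0<..} t * g t z)) \<le> (LINT t|lborel. \<bar>B z\<bar> * enn2real (exp_density (A z) t))"
        by (intro integral_mono integrable_norm gi ib gb)
      also have "\<dots> = \<bar>B z\<bar> / A z" using e by (simp add: has_bochner_integral_iff)
      also have "\<dots> = \<bar>tan \<theta>\<bar>" using z c cos by (simp add: A_def B_def tan_def abs_mult abs_divide)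
      finally show "(LINT t|lborel. norm (indicator {0<..} t * g t z)) \<le> \<bar>tan \<theta>\<bar>" .
    qed
    show "integrable (?D \<Otimes>\<^sub>M lborel) (\<lambda>(z, t). indicator {0<..} t * g t z)"
    proof (rule LD.Fubini_integrable)
      show "(\<lambda>(z, t). indicator {0<..} t * g t z) \<in> borel_measurable (?D \<Otimes>\<^sub>M lborel)"
        unfolding g_def by measurable
      show "AE z in ?D. integrable lborel (\<lambda>t. case (z, t) of (z, t) \<Rightarrow> indicator {0<..} t * g t z)"
        using AE_exp_density[OF zero_less_one] by eventually_elim (simp add: gi)
      have [measurable]: "(\<lambda>z. LINT t|lborel. norm (indicator {0<..} t * g t z)) \<in> borel_measurable ?D"
        unfolding g_def by measurable
      show "integrable ?D (\<lambda>z. LINT t|lborel. norm (case (z, t) of (z, t) \<Rightarrow> indicator {0<..} t * g t z))"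
        unfolding prod.case
      proof (rule D.integrable_const_bound[where B="\<bar>tan \<theta>\<bar>"])
        show "AE z in ?D. norm (LINT t|lborel. norm (indicator {0<..} t * g t z)) \<le> \<bar>tan \<theta>\<bar>"
          using AE_exp_density[OF zero_less_one] by eventually_elim (use gn in \<open>auto simp: integral_nonneg_AE\<close>)
      qed measurable
    qed
  qed
  also have "\<dots> = (LINT z|?D. \<theta>)"
  proof (rule integral_cong_AE)
    show "(\<lambda>z. LINT t|lborel. indicator {0<..} t * g t z) \<in> borel_measurable ?D" unfolding g_def by measurable
    show "AE z in ?D. (LINT t|lborel. indicator {0<..} t * g t z) = \<theta>"
      using AE_exp_density[OF zero_less_one]
    proof eventually_elim
      fix z :: real assume z: "0 < z"
      have eq: "exp_density (A z) = (\<lambda>t. ennreal (indicator {0<..} t * exp (- A z * t)))"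
        by (auto simp: exp_density_def indicator_def fun_eq_iff)
      have "(LINT t|lborel. indicator {0<..} t * g t z) = (LINT t|density lborel (exp_density (A z)). sin (B z * t) / t)"
        unfolding eq by (subst integral_density) (auto simp: g_def mult_ac intro!: Bochner_Integration.integral_cong)
      also have "\<dots> = arctan (B z / A z)" by (rule integral_sin_div_exp_density[OF Apos[OF z]])
      also have "B z / A z = tan \<theta>" using z c by (simp add: A_def B_def tan_def)
      also have "arctan (tan \<theta>) = \<theta>" using \<theta> by (intro arctan_tan) auto
      finally show "(LINT t|lborel. indicator {0<..} t * g t z) = \<theta>" .
    qed
  qed simp
  finally have sgn: "\<alpha> * (pi / 2) * (LINT x|N. sgn x) = \<theta>" using D.prob_space by simp
  have "(LINT x|N. sgn x) = (LINT x|N. 2 * indicator {0..} x - 1 - indicator {0} x)"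
    by (rule Bochner_Integration.integral_cong) (auto simp: sgn_if indicator_def)
  also have "\<dots> = 2 * measure N {0..} - 1 - measure N {0}"
    using N.prob_space by (simp add: less_top[symmetric])
  finally have "\<alpha> * (pi / 2) * (2 * measure N {0..} - 1) = \<theta>" using sgn zero by simp
  then show ?thesis using \<alpha> by (simp add: field_simps)
qed

section \<open>Levy processes\<close>

text \<open>The grid history is a function \<open>S\<close> of the first \<open>k\<close>
  increments, while the increment from \<open>real k * h\<close> to \<open>real k * h + s\<close> is
  independent of them and distributed as \<open>X s\<close>. The joint law is then a product, and
  Tonelli integrates the last increment first.\<close>

lemma levy_markov:
  fixes M :: "'a measure" and g :: "real \<Rightarrow> ennreal"
  assumes X: "levy_process M X" and h: "0 < h" and s: "0 \<le> s"
    and B[measurable]: "B \<in> sets (Pi\<^sub>M {..k} (\<lambda>_. borel))" and [measurable]: "g \<in> borel_measurable borel"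
  shows "(\<integral>\<^sup>+\<omega>. indicator B (\<lambda>j\<in>{..k}. X (real j * h) \<omega>) * g (X (real k * h + s) \<omega>) \<partial>M) =
    (\<integral>\<^sup>+\<omega>. indicator B (\<lambda>j\<in>{..k}. X (real j * h) \<omega>) * (\<integral>\<^sup>+\<omega>'. g (X (real k * h) \<omega> + X s \<omega>') \<partial>M) \<partial>M)"
proof -
  interpret prob_space M using X by (simp add: levy_process_def)
  have X_meas: "X t \<in> borel_measurable M" if "0 \<le> t" for t using X that by (simp add: levy_process_def)
  \<comment> \<open>\<open>levy_process\<close> quantifies over infinite monotone sequences of
    times, so the grid up to \<open>real k * h\<close> is followed by the constant
    \<open>real k * h + s\<close>. The increment with index \<open>k\<close> is the final
    step.\<close>
  define ts where "ts j = (if j \<le> k then real j * h else real k * h + s)" for j :: nat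
  define \<Delta> where "\<Delta> j \<omega> = X (ts (Suc j)) \<omega> - X (ts j) \<omega>" for j \<omega>
  have ts0: "0 \<le> ts j" for j using h s by (simp add: ts_def)
  have ts_mono: "mono ts"
  proof (rule monoI)
    fix i j :: nat assume "i \<le> j"
    moreover have "real i * h \<le> real k * h + s" if "i \<le> k"
    proof -
      have "real i * h \<le> real k * h" using that h by (intro mult_right_mono) auto
      then show ?thesis using s by linarith
    qed
    ultimately show "ts i \<le> ts j" using h s by (auto simp: ts_def mult_right_mono)
  qed
  have [measurable]: "\<Delta> j \<in> borel_measurable M" for j unfolding \<Delta>_def[abs_def] using X_meas ts0 by measurable
  have ind: "indep_vars (\<lambda>_. borel) \<Delta> {..<Suc k}"
    using X ts0 ts_mono unfolding levy_process_def \<Delta>_def[abs_def] by blast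
  define V where "V \<omega> = (\<lambda>i\<in>{..<k}. \<Delta> i \<omega>)" for \<omega>
  have V[measurable]: "V \<in> measurable M (Pi\<^sub>M {..<k} (\<lambda>_. borel))"
    unfolding V_def[abs_def] by measurable
  \<comment> \<open>A function on the one-point set \<open>{k}\<close> and not a number, because
    independence of blocks of a family is stated for restricted families.\<close>
  define W where "W \<omega> = (\<lambda>i\<in>{k}. \<Delta> i \<omega>)" for \<omega>
  have W[measurable]: "W \<in> measurable M (Pi\<^sub>M {k} (\<lambda>_. borel))"
    unfolding W_def[abs_def] by measurable
  have "indep_var (Pi\<^sub>M {..<k} (\<lambda>_. borel)) V (Pi\<^sub>M {k} (\<lambda>_. borel)) W"
    unfolding V_def[abs_def] W_def[abs_def] by (rule indep_var_restrict[OF ind]) auto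
  then have joint: "distr M (Pi\<^sub>M {..<k} (\<lambda>_. borel)) V \<Otimes>\<^sub>M distr M (Pi\<^sub>M {k} (\<lambda>_. borel)) W =
      distr M (Pi\<^sub>M {..<k} (\<lambda>_. borel) \<Otimes>\<^sub>M Pi\<^sub>M {k} (\<lambda>_. borel)) (\<lambda>\<omega>. (V \<omega>, W \<omega>))"
    unfolding indep_var_distribution_eq by blast
  have \<Delta>_distr: "distr M borel (\<Delta> k) = distr M borel (X s)"
  proof -
    have "\<Delta> k = (\<lambda>\<omega>. X (real k * h + s) \<omega> - X (real k * h) \<omega>)" by (simp add: \<Delta>_def[abs_def] ts_def)
    then show ?thesis using X s h by (simp add: levy_process_def)
  qed
  define S where "S v = (\<lambda>j\<in>{..k}. \<Sum>i<j. v i)" for v :: "nat \<Rightarrow> real"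
  have S[measurable]: "S \<in> measurable (Pi\<^sub>M {..<k} (\<lambda>_. borel)) (Pi\<^sub>M {..k} (\<lambda>_. borel))"
    unfolding S_def[abs_def] by measurable
  have [measurable]: "(\<lambda>v. S v k) \<in> borel_measurable (Pi\<^sub>M {..<k} (\<lambda>_. borel))" by measurable
  have path: "AE \<omega> in M. (\<lambda>j\<in>{..k}. X (real j * h) \<omega>) = S (V \<omega>) \<and> X (real k * h) \<omega> = S (V \<omega>) k \<and> X (real k * h + s) \<omega> = S (V \<omega>) k + \<Delta> k \<omega>"
  proof -
    have "AE \<omega> in M. X 0 \<omega> = 0" using X by (simp add: levy_process_def)
    then show ?thesis
    proof eventually_elim
      fix \<omega> assume X0: "X 0 \<omega> = 0"
      have Sj: "S (V \<omega>) j = X (real j * h) \<omega>" if "j \<le> k" for j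
      proof -
        have "S (V \<omega>) j = (\<Sum>i<j. X (ts (Suc i)) \<omega> - X (ts i) \<omega>)"
          using that by (simp add: S_def V_def \<Delta>_def)
        also have "\<dots> = X (ts j) \<omega> - X (ts 0) \<omega>" by (rule sum_lessThan_telescope)
        finally show ?thesis using that X0 by (simp add: ts_def)
      qed
      have "(\<lambda>j\<in>{..k}. X (real j * h) \<omega>) = S (V \<omega>)"
        by (rule ext) (auto simp: Sj S_def[of "V \<omega>"] restrict_def simp flip: Sj)
      then show "(\<lambda>j\<in>{..k}. X (real j * h) \<omega>) = S (V \<omega>) \<and> X (real k * h) \<omega> = S (V \<omega>) k \<and> X (real k * h + s) \<omega> = S (V \<omega>) k + \<Delta> k \<omega>"
        by (simp add: Sj \<Delta>_def ts_def)
    qed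
  qed
  let ?F = "\<lambda>v d. indicator B (S v) * g (S v k + d)"
  interpret DD: prob_space "distr M (Pi\<^sub>M {k} (\<lambda>_. borel)) W" by (rule prob_space_distr) (rule W)
  have [measurable]: "(\<lambda>v. v k) \<in> borel_measurable (Pi\<^sub>M {k} (\<lambda>_. borel :: real measure))"
    by (rule measurable_component_singleton) simp
  have Wk: "W \<omega> k = \<Delta> k \<omega>" for \<omega> by (simp add: W_def)
  have "(\<integral>\<^sup>+\<omega>. indicator B (\<lambda>j\<in>{..k}. X (real j * h) \<omega>) * g (X (real k * h + s) \<omega>) \<partial>M) = (\<integral>\<^sup>+\<omega>. ?F (V \<omega>) (W \<omega> k) \<partial>M)"
  proof (rule nn_integral_cong_AE)
    show "AE \<omega> in M. indicator B (\<lambda>j\<in>{..k}. X (real j * h) \<omega>) * g (X (real k * h + s) \<omega>) = ?F (V \<omega>) (W \<omega> k)"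
      using path by eventually_elim (simp add: Wk)
  qed
  also have "\<dots> = (\<integral>\<^sup>+p. ?F (fst p) (snd p k) \<partial>distr M (Pi\<^sub>M {..<k} (\<lambda>_. borel) \<Otimes>\<^sub>M Pi\<^sub>M {k} (\<lambda>_. borel)) (\<lambda>\<omega>. (V \<omega>, W \<omega>)))"
    by (subst nn_integral_distr) auto
  also have "\<dots> = (\<integral>\<^sup>+v. \<integral>\<^sup>+w. ?F v (w k) \<partial>distr M (Pi\<^sub>M {k} (\<lambda>_. borel)) W \<partial>distr M (Pi\<^sub>M {..<k} (\<lambda>_. borel)) V)"
    unfolding joint[symmetric] by (subst DD.nn_integral_fst[symmetric]) (auto simp: case_prod_beta')
  also have "\<dots> = (\<integral>\<^sup>+\<omega>. \<integral>\<^sup>+\<omega>'. ?F (V \<omega>) (\<Delta> k \<omega>') \<partial>M \<partial>M)"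
  proof -
    have "(\<integral>\<^sup>+w. ?F v (w k) \<partial>distr M (Pi\<^sub>M {k} (\<lambda>_. borel)) W) = (\<integral>\<^sup>+\<omega>'. ?F v (\<Delta> k \<omega>') \<partial>M)" for v
      by (subst nn_integral_distr) (auto simp: Wk)
    then show ?thesis by (simp add: nn_integral_distr)
  qed
  also have "\<dots> = (\<integral>\<^sup>+\<omega>. \<integral>\<^sup>+d. ?F (V \<omega>) d \<partial>distr M borel (\<Delta> k) \<partial>M)"
    by (subst nn_integral_distr) auto
  also have "\<dots> = (\<integral>\<^sup>+\<omega>. \<integral>\<^sup>+\<omega>'. ?F (V \<omega>) (X s \<omega>') \<partial>M \<partial>M)"
    unfolding \<Delta>_distr using X_meas[OF s] by (subst nn_integral_distr) auto
  also have "\<dots> = (\<integral>\<^sup>+\<omega>. indicator B (S (V \<omega>)) * (\<integral>\<^sup>+\<omega>'. g (S (V \<omega>) k + X s \<omega>') \<partial>M) \<partial>M)"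
    using X_meas[OF s] by (simp add: nn_integral_cmult)
  also have "\<dots> = (\<integral>\<^sup>+\<omega>. indicator B (\<lambda>j\<in>{..k}. X (real j * h) \<omega>) * (\<integral>\<^sup>+\<omega>'. g (X (real k * h) \<omega> + X s \<omega>') \<partial>M) \<partial>M)"
  proof (rule nn_integral_cong_AE)
    show "AE \<omega> in M. indicator B (S (V \<omega>)) * (\<integral>\<^sup>+\<omega>'. g (S (V \<omega>) k + X s \<omega>') \<partial>M) =
      indicator B (\<lambda>j\<in>{..k}. X (real j * h) \<omega>) * (\<integral>\<^sup>+\<omega>'. g (X (real k * h) \<omega> + X s \<omega>') \<partial>M)"
      using path by eventually_elim simp
  qed
  finally show ?thesis .
qed

text \<open>With \<theta> the arctangent of \<open>\<beta> * tan (pi * \<alpha> / 2)\<close>, the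
  factor \<open>1 - i tan \<theta>\<close> is \<open>exp (- i \<theta>) / cos \<theta>\<close>, so
  \<open>c = \<sigma> / cos \<theta>\<close>. Zolotarev's formula gives
  \<open>1 / 2 + \<theta> / (pi * \<alpha>) = 2 - 1 / \<alpha>\<close>, that is \<theta> = 3 \<pi>
  \<alpha> / 2 - \<pi>, and this turns the exponent into \<open>c\<close> times
  \<open>stable_exponent\<close>.\<close>

lemma stable_exponent_parameters:
  assumes \<alpha>: "1 / 2 \<le> \<alpha>" "\<alpha> < 1" and X: "strictly_stable_process M X \<alpha> \<beta> \<sigma>"
    and pos: "1 - positivity_coefficient M X = 1 / \<alpha> - 1" and c: "c = exponent_modulus \<alpha> \<beta> \<sigma>"
  shows "0 < c"
    and "\<And>s z. 0 \<le> s \<Longrightarrow> 0 < z \<Longrightarrow> char (distr M borel (X s)) z = exp (- (of_real (s * c) * stable_exponent \<alpha> z))"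
proof -
  define \<theta> where "\<theta> = arctan (\<beta> * tan (pi * \<alpha> / 2))"
  have \<theta>: "- pi / 2 < \<theta>" "\<theta> < pi / 2" using arctan_bounded[of "\<beta> * tan (pi * \<alpha> / 2)"] by (auto simp: \<theta>_def)
  have cos: "0 < cos \<theta>" using \<theta> by (intro cos_gt_zero_pi) auto
  have tan: "\<beta> * tan (pi * \<alpha> / 2) = sin \<theta> / cos \<theta>"
  proof -
    have "sin \<theta> / cos \<theta> = tan \<theta>" by (simp add: tan_def)
    also have "\<dots> = \<beta> * tan (pi * \<alpha> / 2)" unfolding \<theta>_def by (rule tan_arctan)
    finally show ?thesis by (rule sym)
  qed
  have \<sigma>: "0 < \<sigma>" using X by (simp add: strictly_stable_process_def)
  have rot: "1 - \<i> * complex_of_real (sin \<theta> / cos \<theta>) = of_real (1 / cos \<theta>) * exp (- \<i> * of_real \<theta>)"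
  proof -
    have "exp (- \<i> * of_real \<theta>) = cis (- \<theta>)" by (simp add: cis_conv_exp)
    then show ?thesis using cos by (simp add: complex_eq_iff)
  qed
  have c': "c = \<sigma> / cos \<theta>"
    unfolding c exponent_modulus_def tan rot using cos by (simp add: norm_mult norm_divide norm_exp_eq_Re)
  show c0: "0 < c" using c' \<sigma> cos by simp
  have ch: "char (distr M borel (X s)) z = exp (- (of_real (s * c * z powr \<alpha>) * exp (- \<i> * of_real \<theta>)))"
    if "0 \<le> s" "0 < z" for s z
  proof -
    have "char (distr M borel (X s)) z = exp (- (of_real (s * \<sigma> * z powr \<alpha>) * (1 - \<i> * of_real (sin \<theta> / cos \<theta>))))"
      using X that by (simp add: strictly_stable_process_def tan)
    also have "of_real (s * \<sigma> * z powr \<alpha>) * (1 - \<i> * complex_of_real (sin \<theta> / cos \<theta>)) = of_real (s * c * z powr \<alpha>) * exp (- \<i> * of_real \<theta>)"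
      unfolding rot c' by simp
    finally show ?thesis .
  qed
  have X1: "X 1 \<in> borel_measurable M" and ps: "prob_space M"
    using X by (simp_all add: strictly_stable_process_def levy_process_def)
  interpret prob_space M by (rule ps)
  have "measure (distr M borel (X 1)) {0..} = 1 / 2 + \<theta> / (pi * \<alpha>)"
    by (rule positivity_of_char[OF real_distribution_distr[OF X1] _ c0 \<theta>]) (use \<alpha> ch[of 1] in auto)
  moreover have "measure (distr M borel (X 1)) {0..} = positivity_coefficient M X"
    unfolding positivity_coefficient_def using X1 by (subst measure_distr) (auto intro!: arg_cong[where f="measure M"])
  ultimately have "1 / 2 + \<theta> / (pi * \<alpha>) = 2 - 1 / \<alpha>" using pos by simp
  then have "\<theta> / (pi * \<alpha>) = 3 / 2 - 1 / \<alpha>" by simp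
  then have "\<theta> = (3 / 2 - 1 / \<alpha>) * (pi * \<alpha>)" using \<alpha> by (simp add: divide_eq_eq)
  then have \<theta>_eq: "\<theta> = pi * \<alpha> / 2 + pi * \<alpha> - pi" using \<alpha> by (simp add: left_diff_distrib)
  show "char (distr M borel (X s)) z = exp (- (of_real (s * c) * stable_exponent \<alpha> z))" if s: "0 \<le> s" and z: "0 < z" for s z
  proof -
    have "exp (- \<i> * of_real \<theta>) = cis (- \<theta>)" by (simp add: cis_conv_exp)
    also have "- \<theta> = - (pi * \<alpha> / 2) + - (pi * \<alpha>) + pi" by (simp add: \<theta>_eq)
    also have "cis \<dots> = - (cis (- (pi * \<alpha> / 2)) * cis (- (pi * \<alpha>)))" 
      by (simp only: cis_mult[symmetric] cis_pi mult_minus_right mult_1_right)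
    finally have "of_real (z powr \<alpha>) * exp (- \<i> * of_real \<theta>) = stable_exponent \<alpha> z"
      unfolding stable_exponent_def imag_powr(2)[OF z] by (simp add: cis_conv_exp)
    then show ?thesis unfolding ch[OF s z] by (simp add: mult.assoc)
  qed
qed

text \<open>Multiplying space by \<open>t powr (1 / \<alpha>)\<close> multiplies the exponent by
  \<open>t\<close>, so the exponent gets the same factor \<open>t * c\<close> as the discount rate,
  which is the normal form of \<open>stable_exit\<close>. Changing the paths to 0 on a null set
  makes every one of them right-continuous.\<close>

lemma stable_exit_version:
  fixes M :: "'a measure"
  assumes \<alpha>: "1 / 2 \<le> \<alpha>" "\<alpha> < 1" and X: "strictly_stable_process M X \<alpha> \<beta> \<sigma>"
    and pos: "1 - positivity_coefficient M X = 1 / \<alpha> - 1" and c: "c = exponent_modulus \<alpha> \<beta> \<sigma>"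
    and t: "0 < t"
  obtains Y where "stable_exit M Y (t * c) \<alpha>" "AE \<omega> in M. \<forall>s\<ge>0. Y s \<omega> = t powr (1 / \<alpha>) * X s \<omega>"
proof -
  have levy: "levy_process M X" using X by (simp add: strictly_stable_process_def)
  interpret prob_space M using levy by (simp add: levy_process_def)
  note par = stable_exponent_parameters[OF \<alpha> X pos c]
  have X_meas: "X s \<in> borel_measurable M" if "0 \<le> s" for s using levy that by (simp add: levy_process_def)
  define \<kappa> where "\<kappa> = t powr (1 / \<alpha>)"
  have \<kappa>: "0 < \<kappa>" "\<kappa> powr \<alpha> = t" using t \<alpha> by (simp_all add: \<kappa>_def powr_powr)
  have "AE \<omega> in M. cadlag (\<lambda>t. X t \<omega>)" using levy by (simp add: levy_process_def)
  then obtain N where N: "{\<omega> \<in> space M. \<not> cadlag (\<lambda>t. X t \<omega>)} \<subseteq> N" "emeasure M N = 0" and [measurable]: "N \<in> sets M"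
    by (rule AE_E)
  \<comment> \<open>Negative times are sent to 0 as well, since \<open>levy_process\<close> says
    nothing about \<open>X\<close> there and joint measurability is claimed on the whole
    line.\<close>
  define Y where "Y s \<omega> = (if \<omega> \<notin> N \<and> 0 \<le> s then \<kappa> * X s \<omega> else 0)" for s \<omega>
  have Ys[measurable]: "Y s \<in> borel_measurable M" for s
  proof (cases "0 \<le> s")
    case True
    note [measurable] = X_meas[OF True]
    show ?thesis unfolding Y_def[abs_def] by measurable
  qed (simp add: Y_def[abs_def])
  have "N \<in> null_sets M" using N by auto
  then have YX: "AE \<omega> in M. \<forall>s\<ge>0. Y s \<omega> = \<kappa> * X s \<omega>"
    by (rule AE_not_in[THEN eventually_mono]) (simp add: Y_def)
  have rcont: "((\<lambda>t. Y t \<omega>) \<longlongrightarrow> Y s \<omega>) (at_right s)" if "\<omega> \<in> space M" "0 \<le> s" for \<omega> s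
  proof (cases "\<omega> \<in> N")
    case False
    then have "((\<lambda>t. X t \<omega>) \<longlongrightarrow> X s \<omega>) (at_right s)" using N(1) that by (auto simp: cadlag_def)
    then have "((\<lambda>t. \<kappa> * X t \<omega>) \<longlongrightarrow> Y s \<omega>) (at_right s)" using False that by (auto simp: Y_def intro!: tendsto_intros)
    moreover have "eventually (\<lambda>t. \<kappa> * X t \<omega> = Y t \<omega>) (at_right s)"
      using eventually_at_right_less[of s] by eventually_elim (use False that in \<open>simp add: Y_def\<close>)
    ultimately show ?thesis by (rule Lim_transform_eventually)
  qed (simp add: Y_def)
  have meas: "(\<lambda>(s, \<omega>). Y s \<omega>) \<in> borel_measurable (borel \<Otimes>\<^sub>M M)"
  proof (rule borel_measurable_LIMSEQ_real)
    \<comment> \<open>The next dyadic point strictly to the right of \<open>s\<close>: adding 1 to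
      the floor makes it larger than \<open>s\<close> even when \<open>s\<close> is dyadic, so
      right-continuity applies. For fixed \<open>n\<close> it takes countably many values, which
      gives joint measurability.\<close>
    let ?r = "\<lambda>(n::nat) (s::real). real_of_int (\<lfloor>s * 2 ^ n\<rfloor> + 1) / 2 ^ n"
    show "(\<lambda>n. case p of (s, \<omega>) \<Rightarrow> indicator {0..} s * Y (?r n s) \<omega>) \<longlonglongrightarrow> (case p of (s, \<omega>) \<Rightarrow> Y s \<omega>)"
      if p: "p \<in> space (borel \<Otimes>\<^sub>M M)" for p
    proof -
      obtain s \<omega> where p': "p = (s, \<omega>)" "\<omega> \<in> space M" using p by (auto simp: space_pair_measure)
      show ?thesis
      proof (cases "0 \<le> s")
        case True
        have r: "s < ?r n s" "?r n s \<le> s + 1 / 2 ^ n" for n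
          by (simp_all add: field_simps) linarith+
        have "(\<lambda>n. ?r n s) \<longlonglongrightarrow> s"
        proof (rule tendsto_sandwich[of "\<lambda>_. s" _ _ "\<lambda>n. s + 1 / 2 ^ n"])
          show "(\<lambda>n. s + 1 / 2 ^ n) \<longlonglongrightarrow> s" by real_asymp
        qed (use r in \<open>auto intro!: always_eventually less_imp_le\<close>)
        then have "filterlim (\<lambda>n. ?r n s) (at_right s) sequentially"
          unfolding filterlim_at using r(1) by (intro conjI always_eventually allI) (auto simp only: less_irrefl greaterThan_iff UNIV_I, metis less_irrefl)
        from filterlim_compose[OF rcont[OF p'(2) True] this] show ?thesis using True by (simp add: p')
      qed (simp add: p' Y_def)
    qed
    show "(\<lambda>p. case p of (s, \<omega>) \<Rightarrow> indicator {0..} s * Y (?r n s) \<omega>) \<in> borel_measurable (borel \<Otimes>\<^sub>M M)" for n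
    proof -
      have "(\<lambda>p :: real \<times> 'a. Y (real_of_int (\<lfloor>fst p * 2 ^ n\<rfloor> + 1) / 2 ^ n) (snd p)) \<in> borel_measurable (borel \<Otimes>\<^sub>M M)"
        by (rule measurable_compose_countable[where f="\<lambda>i p. Y (real_of_int (i + 1) / 2 ^ n) (snd p)" and g="\<lambda>p. \<lfloor>fst p * 2 ^ n\<rfloor>"]) measurable
      then show ?thesis unfolding case_prod_beta' by measurable
    qed
  qed
  have markov: "(\<integral>\<^sup>+\<omega>. indicator B (\<lambda>j\<in>{..k}. Y (real j * h) \<omega>) * g (Y (real k * h + s) \<omega>) \<partial>M) =
      (\<integral>\<^sup>+\<omega>. indicator B (\<lambda>j\<in>{..k}. Y (real j * h) \<omega>) * (\<integral>\<^sup>+\<omega>'. g (Y (real k * h) \<omega> + Y s \<omega>') \<partial>M) \<partial>M)"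
    if hs: "0 < h" "0 \<le> s" and B[measurable]: "B \<in> sets (Pi\<^sub>M {..k} (\<lambda>_. borel))" and g[measurable]: "g \<in> borel_measurable borel"
    for h s k B and g :: "real \<Rightarrow> ennreal"
  proof -
    define B' where "B' = {f \<in> space (Pi\<^sub>M {..k} (\<lambda>_. borel)). (\<lambda>j\<in>{..k}. \<kappa> * f j) \<in> B}"
    have "(\<lambda>f. \<lambda>j\<in>{..k}. \<kappa> * f j) \<in> measurable (Pi\<^sub>M {..k} (\<lambda>_. borel)) (Pi\<^sub>M {..k} (\<lambda>_. borel))" by measurable
    from measurable_sets[OF this B] have B': "B' \<in> sets (Pi\<^sub>M {..k} (\<lambda>_. borel))"
      unfolding B'_def by (simp add: vimage_def Int_def conj_commute)
    have IB: "AE \<omega> in M. indicator B (\<lambda>j\<in>{..k}. Y (real j * h) \<omega>) = (indicator B' (\<lambda>j\<in>{..k}. X (real j * h) \<omega>) :: ennreal)"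
      using YX
    proof eventually_elim
      fix \<omega> assume Y: "\<forall>s\<ge>0. Y s \<omega> = \<kappa> * X s \<omega>"
      have "(\<lambda>j\<in>{..k}. Y (real j * h) \<omega>) = (\<lambda>j\<in>{..k}. \<kappa> * (\<lambda>j\<in>{..k}. X (real j * h) \<omega>) j)"
        using Y hs by (auto simp: restrict_def fun_eq_iff)
      then show "indicator B (\<lambda>j\<in>{..k}. Y (real j * h) \<omega>) = (indicator B' (\<lambda>j\<in>{..k}. X (real j * h) \<omega>) :: ennreal)"
        by (simp add: B'_def indicator_def space_PiM)
    qed
    have kh: "0 \<le> real k * h" using hs by simp
    have "(\<integral>\<^sup>+\<omega>. indicator B (\<lambda>j\<in>{..k}. Y (real j * h) \<omega>) * g (Y (real k * h + s) \<omega>) \<partial>M) =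
      (\<integral>\<^sup>+\<omega>. indicator B' (\<lambda>j\<in>{..k}. X (real j * h) \<omega>) * g (\<kappa> * X (real k * h + s) \<omega>) \<partial>M)"
      using YX IB by (intro nn_integral_cong_AE, eventually_elim) (use kh hs in simp)
    also have "\<dots> = (\<integral>\<^sup>+\<omega>. indicator B' (\<lambda>j\<in>{..k}. X (real j * h) \<omega>) * (\<integral>\<^sup>+\<omega>'. g (\<kappa> * (X (real k * h) \<omega> + X s \<omega>')) \<partial>M) \<partial>M)"
      by (rule levy_markov[OF levy hs B']) measurable
    also have "\<dots> = (\<integral>\<^sup>+\<omega>. indicator B (\<lambda>j\<in>{..k}. Y (real j * h) \<omega>) * (\<integral>\<^sup>+\<omega>'. g (Y (real k * h) \<omega> + Y s \<omega>') \<partial>M) \<partial>M)"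
    proof -
      have inner: "(\<integral>\<^sup>+\<omega>'. g (a + Y s \<omega>') \<partial>M) = (\<integral>\<^sup>+\<omega>'. g (a + \<kappa> * X s \<omega>') \<partial>M)" for a
        using YX by (intro nn_integral_cong_AE, eventually_elim) (use hs in simp)
      show ?thesis
        unfolding inner using YX IB by (intro nn_integral_cong_AE, eventually_elim) (use kh in \<open>simp add: distrib_left\<close>)
    qed
    finally show ?thesis .
  qed
  have char_Y: "char (distr M borel (Y s)) z = exp (- (of_real (t * c * s) * stable_exponent \<alpha> z))" if s: "0 \<le> s" and z: "0 < z" for s z
  proof -
    have "char (distr M borel (Y s)) z = (CLINT \<omega>|M. iexp (z * Y s \<omega>))"
      unfolding char_def by (subst integral_distr) auto
    also have "\<dots> = (CLINT \<omega>|M. iexp ((\<kappa> * z) * X s \<omega>))"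
    proof (rule integral_cong_AE)
      show "(\<lambda>\<omega>. iexp (\<kappa> * z * X s \<omega>)) \<in> borel_measurable M" using X_meas[OF s] by measurable
      show "AE \<omega> in M. iexp (z * Y s \<omega>) = iexp (\<kappa> * z * X s \<omega>)"
        using YX by eventually_elim (use s in \<open>simp add: mult_ac\<close>)
    qed measurable
    also have "\<dots> = char (distr M borel (X s)) (\<kappa> * z)"
      unfolding char_def using X_meas[OF s] by (subst integral_distr) auto
    also have "\<dots> = exp (- (of_real (s * c) * stable_exponent \<alpha> (\<kappa> * z)))" using \<kappa> z s by (intro par) simp_all
    also have "stable_exponent \<alpha> (\<kappa> * z) = of_real t * stable_exponent \<alpha> z"
      using \<kappa> z imag_powr(2)[of "\<kappa> * z" \<alpha>] imag_powr(2)[OF z, of \<alpha>] by (simp add: stable_exponent_def powr_mult)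
    finally show ?thesis by (simp add: mult_ac)
  qed
  have "stable_exit M Y (t * c) \<alpha>"
    by unfold_locales (use meas rcont markov char_Y t par(1) \<alpha> in auto)
  then show ?thesis using YX that by (simp add: \<kappa>_def)
qed

section \<open>The confluent hypergeometric function\<close>

text \<open>The substitution \<open>s = z * u\<close> gives the Beta integral with parameters
  \<open>1 - \<alpha>\<close> and \<open>k + 1\<close>, whose Gamma factors form the Pochhammer
  symbol of \<open>2 - \<alpha>\<close>.\<close>

lemma nn_integral_Beta:
  assumes \<alpha>: "0 < \<alpha>" "\<alpha> < 1" and z: "0 < (z::real)"
  shows "(\<integral>\<^sup>+s. ennreal (s powr (- \<alpha>) * (z - s) ^ k / fact k) * indicator {0<..<z} s \<partial>lborel) =
    ennreal (Gamma (1 - \<alpha>) * z powr (1 - \<alpha>) / Gamma (2 - \<alpha>) * (z ^ k / pochhammer (2 - \<alpha>) k))"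
proof -
  let ?F = "\<lambda>u. ennreal ((z * u) powr (- \<alpha>) * (z - z * u) ^ k / fact k) * indicator {0<..<z} (z * u)"
  let ?G = "\<lambda>u. ennreal (z powr (- \<alpha>) * z ^ k / fact k) * (ennreal (u powr ((1 - \<alpha>) - 1) * (1 - u) powr (real (Suc k) - 1)) * indicator {0..1} u)"
  have "(\<integral>\<^sup>+s. ennreal (s powr (- \<alpha>) * (z - s) ^ k / fact k) * indicator {0<..<z} s \<partial>lborel) =
    ennreal z * (\<integral>\<^sup>+u. ?F u \<partial>lborel)"
    using z by (subst nn_integral_real_affine[where c=z and t=0]) auto
  also have "(\<integral>\<^sup>+u. ?F u \<partial>lborel)
    = (\<integral>\<^sup>+u. ?G u \<partial>lborel)"
  proof (rule nn_integral_cong_AE)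
    show "AE u in lborel. ?F u
      = ?G u"
      using AE_lborel_singleton[of 0] AE_lborel_singleton[of 1]
    proof eventually_elim
      fix u :: real assume u: "u \<noteq> 0" "u \<noteq> 1"
      show "?F u
        = ?G u"
      proof (cases "0 < u \<and> u < 1")
        case True
        then have ind: "z * u \<in> {0<..<z}" "u \<in> {0..1}" using z by auto
        have "(z * u) powr (- \<alpha>) * (z - z * u) ^ k / fact k = (z powr (- \<alpha>) * z ^ k / fact k) * (u powr ((1 - \<alpha>) - 1) * (1 - u) powr (real (Suc k) - 1))"
        proof -
          have "(z - z * u) ^ k = z ^ k * (1 - u) ^ k" unfolding power_mult_distrib[symmetric] by (simp add: right_diff_distrib)
          moreover have "(1 - u) powr (real (Suc k) - 1) = (1 - u) ^ k" using True by (simp add: powr_realpow)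
          ultimately show ?thesis using z True by (simp add: powr_mult)
        qed
        then show ?thesis using ind z by (simp only: indicator_simps mult_1_right) (rule ennreal_mult, auto)
      next
        case False
        then have "z * u \<notin> {0<..<z}" "u \<notin> {0..1}" using z u by (auto simp: zero_less_mult_iff)
        then show ?thesis by simp
      qed
    qed
  qed
  also have "\<dots> = ennreal (z powr (- \<alpha>) * z ^ k / fact k) * ennreal (Beta (1 - \<alpha>) (real (Suc k)))"
    using nn_integral_has_integral_lebesgue'[OF _ has_integral_Beta_real[of "1 - \<alpha>" "real (Suc k)"]] \<alpha>
    by (subst nn_integral_cmult) auto
  also have "ennreal z * \<dots> = ennreal (z * (z powr (- \<alpha>) * z ^ k / fact k * Beta (1 - \<alpha>) (real (Suc k))))"
  proof -
    have "0 \<le> Beta (1 - \<alpha>) (real (Suc k))" using \<alpha> by (simp add: Beta_def Gamma_real_pos less_imp_le)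
    then show ?thesis using z by (simp only: ennreal_mult less_imp_le mult_nonneg_nonneg powr_ge_zero zero_le_power divide_nonneg_nonneg fact_ge_zero)
  qed
  also have "z * (z powr (- \<alpha>) * z ^ k / fact k * Beta (1 - \<alpha>) (real (Suc k))) =
      Gamma (1 - \<alpha>) * z powr (1 - \<alpha>) / Gamma (2 - \<alpha>) * (z ^ k / pochhammer (2 - \<alpha>) k)"
  proof -
    have "2 - \<alpha> \<notin> \<int>\<^sub>\<le>\<^sub>0" using \<alpha> by (auto elim!: nonpos_Ints_cases)
    then have p: "pochhammer (2 - \<alpha>) k = Gamma (2 - \<alpha> + real k) / Gamma (2 - \<alpha>)" by (rule pochhammer_Gamma)
    have G: "Gamma (real (Suc k)) = fact k" by (simp add: Gamma_fact)
    have G2: "0 < Gamma (2 - \<alpha>)" "0 < Gamma (2 - \<alpha> + real k)" using \<alpha> by (auto intro!: Gamma_real_pos)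
    have B: "Beta (1 - \<alpha>) (real (Suc k)) = Gamma (1 - \<alpha>) * fact k / Gamma (2 - \<alpha> + real k)"
      unfolding Beta_def G by (simp add: algebra_simps)
    have zz: "z powr (1 - \<alpha>) = z * z powr (- \<alpha>)" using z by (simp add: powr_diff powr_minus_divide)
    show ?thesis unfolding B p zz using G2 by simp
  qed
  finally show ?thesis .
qed

text \<open>The integral is \<open>exp z\<close> times the lower incomplete Gamma function.
  Expanding \<open>exp (z - s)\<close> in powers of \<open>z - s\<close> and integrating termwise
  gives the hypergeometric series, in which \<open>pochhammer 1 k\<close> cancels
  \<open>fact k\<close>.\<close>

lemma hypergeom_1F1_lower_Gamma:
  assumes \<alpha>: "0 < \<alpha>" "\<alpha> < 1" and z: "0 < (z::real)"
  shows "(\<integral>\<^sup>+s. ennreal (s powr (- \<alpha>) * exp (z - s)) * indicator {0<..<z} s \<partial>lborel) =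
    ennreal (Gamma (1 - \<alpha>) * z powr (1 - \<alpha>) / Gamma (2 - \<alpha>) * hypergeom_1F1 1 (2 - \<alpha>) z)"
    and "0 \<le> hypergeom_1F1 1 (2 - \<alpha>) z"
proof -
  define C where "C = Gamma (1 - \<alpha>) * z powr (1 - \<alpha>) / Gamma (2 - \<alpha>)"
  have C: "0 < C" using \<alpha> z by (auto simp: C_def intro!: divide_pos_pos mult_pos_pos Gamma_real_pos)
  define a where "a k = z ^ k / pochhammer (2 - \<alpha>) k" for k
  have a: "0 \<le> a k" for k using \<alpha> z by (auto simp: a_def intro!: divide_nonneg_nonneg pochhammer_nonneg)
  let ?I = "\<integral>\<^sup>+s. ennreal (s powr (- \<alpha>) * exp (z - s)) * indicator {0<..<z} s \<partial>lborel"
  have "?I = (\<integral>\<^sup>+s. (\<Sum>k. ennreal (s powr (- \<alpha>) * (z - s) ^ k / fact k) * indicator {0<..<z} s) \<partial>lborel)"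
  proof (rule nn_integral_cong)
    fix s :: real
    show "ennreal (s powr (- \<alpha>) * exp (z - s)) * indicator {0<..<z} s = (\<Sum>k. ennreal (s powr (- \<alpha>) * (z - s) ^ k / fact k) * indicator {0<..<z} s)"
    proof (cases "s \<in> {0<..<z}")
      case True
      have "(\<lambda>k. s powr (- \<alpha>) * ((z - s) ^ k / fact k)) sums (s powr (- \<alpha>) * exp (z - s))"
        using exp_converges[of "z - s"] by (intro sums_mult) (simp add: divide_inverse mult.commute)
      then have "(\<lambda>k. ennreal (s powr (- \<alpha>) * ((z - s) ^ k / fact k))) sums ennreal (s powr (- \<alpha>) * exp (z - s))"
        using True by (subst sums_ennreal) auto
      then show ?thesis using True by (simp add: sums_iff)
    qed simp
  qed
  also have "\<dots> = (\<Sum>k. ennreal (C * a k))"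
    by (subst nn_integral_suminf) (auto simp: nn_integral_Beta[OF \<alpha> z] C_def a_def)
  finally have I: "?I = (\<Sum>k. ennreal (C * a k))" .
  \<comment> \<open>\<open>hypergeom_1F1\<close> is a real \<open>suminf\<close>, meaningful only
    for a convergent series; convergence is inferred from the finiteness of the integral, bounded
    here by a full Gamma integral.\<close>
  have "?I \<le> (\<integral>\<^sup>+s. ennreal (exp z) * (ennreal (s powr ((1 - \<alpha>) - 1) * exp (- 1 * s)) * indicator {0<..} s) \<partial>lborel)"
  proof (rule nn_integral_mono)
    fix s :: real
    have "s powr (- \<alpha>) * exp (z - s) = exp z * (s powr ((1 - \<alpha>) - 1) * exp (- 1 * s))"
      by (simp add: exp_diff exp_minus divide_inverse)
    then show "ennreal (s powr (- \<alpha>) * exp (z - s)) * indicator {0<..<z} s \<le> ennreal (exp z) * (ennreal (s powr ((1 - \<alpha>) - 1) * exp (- 1 * s)) * indicator {0<..} s)"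
      by (auto simp: indicator_def simp flip: ennreal_mult')
  qed
  also have "\<dots> = ennreal (exp z) * ennreal (Gamma (1 - \<alpha>) * 1 powr (- (1 - \<alpha>)))"
    using nn_integral_powr_exp[of "1 - \<alpha>" 1] \<alpha> by (subst nn_integral_cmult) auto
  also have "\<dots> < top" by (simp add: ennreal_mult_less_top)
  finally have fin: "(\<Sum>k. ennreal (C * a k)) \<noteq> top" unfolding I by simp
  have sm: "summable (\<lambda>k. C * a k)"
    by (rule summable_suminf_not_top[OF _ fin]) (use C a in auto)
  have sa: "summable a" using sm C by (simp add: summable_cmult_iff)
  have a_eq: "a = (\<lambda>k. pochhammer 1 k * z ^ k / (pochhammer (2 - \<alpha>) k * fact k))"
    by (simp add: a_def fun_eq_iff pochhammer_fact[symmetric])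
  show "0 \<le> hypergeom_1F1 1 (2 - \<alpha>) z"
    using suminf_nonneg[OF sa a] unfolding hypergeom_1F1_def a_eq .
  have "(\<Sum>k. C * a k) = C * hypergeom_1F1 1 (2 - \<alpha>) z"
    using suminf_mult[OF sa, of C] unfolding hypergeom_1F1_def a_eq .
  then have "(\<Sum>k. ennreal (C * a k)) = ennreal (C * hypergeom_1F1 1 (2 - \<alpha>) z)"
  proof -
    have "0 \<le> C * a k" for k using C a[of k] by simp
    from suminf_ennreal2[OF this sm] show ?thesis using \<open>(\<Sum>k. C * a k) = C * hypergeom_1F1 1 (2 - \<alpha>) z\<close> by (simp only:)
  qed
  then show "?I = ennreal (Gamma (1 - \<alpha>) * z powr (1 - \<alpha>) / Gamma (2 - \<alpha>) * hypergeom_1F1 1 (2 - \<alpha>) z)"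
    unfolding I C_def .
qed

text \<open>\<open>Gamma (1 - \<alpha>)\<close> is the sum of the lower and upper incomplete Gamma
  functions at \<open>z\<close>, the former known from \<open>hypergeom_1F1_lower_Gamma\<close>. The
  reflection formula identifies \<open>sin (\<alpha> * pi) / pi * Gamma \<alpha>\<close> with
  \<open>1 / Gamma (1 - \<alpha>)\<close>.\<close>

lemma exit_laplace_hypergeom:
  assumes \<alpha>: "0 < \<alpha>" "\<alpha> < 1" and z: "0 < z"
  shows "exit_laplace \<alpha> z = exp z - z powr (1 - \<alpha>) * (hypergeom_1F1 1 (2 - \<alpha>) z / Gamma (2 - \<alpha>))"
proof -
  let ?F = "\<lambda>s. ennreal (exp z) * (ennreal (s powr ((1 - \<alpha>) - 1) * exp (- 1 * s)) * indicator {0<..} s)"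
  let ?G = "\<lambda>s. ennreal (s powr (- \<alpha>) * exp (z - s)) * indicator {0<..<z} s"
  define H where "H = Gamma (1 - \<alpha>) * z powr (1 - \<alpha>) / Gamma (2 - \<alpha>) * hypergeom_1F1 1 (2 - \<alpha>) z"
  define U where "U = upper_incomplete_Gamma (1 - \<alpha>) z"
  have G: "0 < Gamma (1 - \<alpha>)" "0 < Gamma (2 - \<alpha>)" using \<alpha> by (auto intro!: Gamma_real_pos)
  have U: "0 \<le> U" unfolding U_def by (rule upper_incomplete_Gamma_nonneg)
  have "0 \<le> hypergeom_1F1 1 (2 - \<alpha>) z" by (rule hypergeom_1F1_lower_Gamma(2)[OF \<alpha> z])
  then have H: "0 \<le> H" using G z by (simp add: H_def)
  have "ennreal (exp z) * ennreal (Gamma (1 - \<alpha>)) = (\<integral>\<^sup>+s. ?F s \<partial>lborel)"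
    using nn_integral_powr_exp[of "1 - \<alpha>" 1] \<alpha> by (subst nn_integral_cmult) auto
  also have "\<dots> = (\<integral>\<^sup>+s. ?G s + ennreal (exp z) * (ennreal (s powr ((1 - \<alpha>) - 1) * exp (- s)) * indicator {z<..} s) \<partial>lborel)"
  proof (rule nn_integral_cong_AE)
    show "AE s in lborel. ?F s
      = ?G s + ennreal (exp z) * (ennreal (s powr ((1 - \<alpha>) - 1) * exp (- s)) * indicator {z<..} s)"
      using AE_lborel_singleton[of z]
    proof eventually_elim
      fix s :: real assume s: "s \<noteq> z"
      have "s powr (- \<alpha>) * exp (z - s) = exp z * (s powr ((1 - \<alpha>) - 1) * exp (- s))"
        by (simp add: exp_diff exp_minus divide_inverse)
      then have eq: "ennreal (s powr (- \<alpha>) * exp (z - s)) = ennreal (exp z) * ennreal (s powr ((1 - \<alpha>) - 1) * exp (- s))"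
        by (simp only: ennreal_mult' exp_ge_zero)
      show "?F s
        = ?G s + ennreal (exp z) * (ennreal (s powr ((1 - \<alpha>) - 1) * exp (- s)) * indicator {z<..} s)"
        unfolding eq using s z by (cases "s < z") (auto simp: indicator_def)
    qed
  qed
  also have "\<dots> = ennreal H + ennreal (exp z) * ennreal U"
    using z \<alpha> by (simp add: nn_integral_add nn_integral_cmult hypergeom_1F1_lower_Gamma(1) H_def U_def upper_incomplete_Gamma_eq_nn)
  finally have "ennreal (exp z * Gamma (1 - \<alpha>)) = ennreal (H + exp z * U)"
    using G H U by (simp add: ennreal_mult ennreal_plus)
  then have eq: "exp z * Gamma (1 - \<alpha>) = H + exp z * U"
    using G H U by (subst (asm) ennreal_inj) auto
  have "sin (\<alpha> * pi) / pi * Gamma \<alpha> = 1 / Gamma (1 - \<alpha>)"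
    using Gamma_reflection_real[of \<alpha>] G sin_pi_mult_pos[OF \<alpha>] by (simp add: field_simps)
  then have "exit_laplace \<alpha> z = exp z * U / Gamma (1 - \<alpha>)" by (simp add: exit_laplace_def U_def)
  also have "\<dots> = (exp z * Gamma (1 - \<alpha>) - H) / Gamma (1 - \<alpha>)" using eq by simp
  also have "\<dots> = exp z - z powr (1 - \<alpha>) * (hypergeom_1F1 1 (2 - \<alpha>) z / Gamma (2 - \<alpha>))"
    using G by (simp add: H_def diff_divide_distrib)
  finally show ?thesis .
qed

section \<open>The law of the exit time\<close>

text \<open>Moves expectations of the exit time, which is measurable only for the completion, to an
  almost surely equal function that is measurable for \<open>M\<close>.\<close>

lemma integral_completion_AE:
  fixes f g :: "'a \<Rightarrow> real"
  assumes [measurable]: "g \<in> borel_measurable M" and eq: "AE \<omega> in M. f \<omega> = g \<omega>"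
  shows "integral\<^sup>L (completion M) f = integral\<^sup>L M g"
proof -
  have g: "g \<in> borel_measurable (completion M)" by (rule measurable_completion) simp
  have f: "f \<in> borel_measurable (completion M)"
  proof (rule measurableI)
    fix A :: "real set" assume A: "A \<in> sets borel"
    show "f -` A \<inter> space (completion M) \<in> sets (completion M)"
    proof (rule completion.in_sets_AE)
      show "AE \<omega> in completion M. \<omega> \<in> g -` A \<inter> space (completion M) \<longleftrightarrow> \<omega> \<in> f -` A \<inter> space (completion M)"
        using AE_completion[OF eq] by eventually_elim simp
      show "g -` A \<inter> space (completion M) \<in> sets (completion M)" by (rule measurable_sets[OF g A])
    qed simp
  qed simp
  have "integral\<^sup>L (completion M) f = integral\<^sup>L (completion M) g"
    by (rule integral_cong_AE[OF f g AE_completion[OF eq]])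
  then show ?thesis by (simp add: integral_completion)
qed

text \<open>Every \<open>t\<close> has its own rescaled process and its own hitting time, but each
  of these is almost surely equal to the exit time of \<open>1 + X\<close>. One representative
  \<open>T\<close>, taken from \<open>t = 1\<close>, therefore serves all \<open>t\<close>.\<close>

lemma exit_time_law:
  fixes M :: "'a measure"
  assumes \<alpha>: "1 / 2 \<le> \<alpha>" "\<alpha> < 1" and X: "strictly_stable_process M X \<alpha> \<beta> \<sigma>"
    and pos: "1 - positivity_coefficient M X = 1 / \<alpha> - 1" and c: "c = exponent_modulus \<alpha> \<beta> \<sigma>"
  obtains T where "T \<in> borel_measurable M" "\<And>\<omega>. 0 \<le> T \<omega>" "AE \<omega> in M. exit_time (\<lambda>t \<omega>. 1 + X t \<omega>) \<omega> = T \<omega>"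
    "\<And>t. 0 < t \<Longrightarrow> (\<integral>\<^sup>+\<omega>. ennreal (exp_minus (ereal t * (ereal c * T \<omega>))) \<partial>M) = ennreal (exit_laplace \<alpha> (t powr (1 / \<alpha>)))"
proof -
  let ?\<tau> = "\<lambda>\<omega>. exit_time (\<lambda>t \<omega>. 1 + X t \<omega>) \<omega>"
  have version: "\<exists>T \<in> borel_measurable M. (\<forall>\<omega>. 0 \<le> T \<omega>) \<and> (AE \<omega> in M. ?\<tau> \<omega> = T \<omega>) \<and>
      (\<integral>\<^sup>+\<omega>. ennreal (exp_minus (ereal (t * c) * T \<omega>)) \<partial>M) = ennreal (exit_laplace \<alpha> (t powr (1 / \<alpha>)))" if t: "0 < t" for t
  proof -
    obtain Y where Y: "stable_exit M Y (t * c) \<alpha>" and YX: "AE \<omega> in M. \<forall>s\<ge>0. Y s \<omega> = t powr (1 / \<alpha>) * X s \<omega>"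
      by (rule stable_exit_version[OF \<alpha> X pos c t])
    interpret stable_exit M Y "t * c" \<alpha> by (rule Y)
    define \<kappa> where "\<kappa> = t powr (1 / \<alpha>)"
    have \<kappa>: "0 < \<kappa>" using t by (simp add: \<kappa>_def)
    \<comment> \<open>Scaling does not move the exit: \<open>\<kappa> + Y s\<close> is the positive
      multiple \<open>\<kappa> * (1 + X s)\<close>.\<close>
    have "AE \<omega> in M. ?\<tau> \<omega> = hitting_time \<kappa> \<omega>"
      using AE_exit_time_eq[OF \<kappa>] YX
    proof eventually_elim
      fix \<omega> assume h: "exit_time (\<lambda>t \<omega>. \<kappa> + Y t \<omega>) \<omega> = hitting_time \<kappa> \<omega>" and YX: "\<forall>s\<ge>0. Y s \<omega> = t powr (1 / \<alpha>) * X s \<omega>"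
      have "\<kappa> + Y s \<omega> = \<kappa> * (1 + X s \<omega>)" if "0 \<le> s" for s using YX that by (simp add: \<kappa>_def distrib_left)
      then have "(\<kappa> + Y s \<omega> \<notin> {0<..}) = (1 + X s \<omega> \<notin> {0<..})" if "0 \<le> s" for s
        using \<kappa> that by (simp add: zero_less_mult_iff)
      then have "?\<tau> \<omega> = exit_time (\<lambda>t \<omega>. \<kappa> + Y t \<omega>) \<omega>"
        unfolding exit_time_def by (intro arg_cong[where f=Inf]) blast
      then show "?\<tau> \<omega> = hitting_time \<kappa> \<omega>" using h by simp
    qed
    then show ?thesis
      using hitting_time_laplace[OF \<kappa>] hitting_time_nonneg by (intro bexI[of _ "hitting_time \<kappa>"]) (auto simp: \<kappa>_def)
  qed
  obtain T where T: "T \<in> borel_measurable M" "\<And>\<omega>. 0 \<le> T \<omega>" "AE \<omega> in M. ?\<tau> \<omega> = T \<omega>"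
    using version[of 1] by auto
  have "(\<integral>\<^sup>+\<omega>. ennreal (exp_minus (ereal t * (ereal c * T \<omega>))) \<partial>M) = ennreal (exit_laplace \<alpha> (t powr (1 / \<alpha>)))" if t: "0 < t" for t
  proof -
    obtain T' where T': "AE \<omega> in M. ?\<tau> \<omega> = T' \<omega>"
      "(\<integral>\<^sup>+\<omega>. ennreal (exp_minus (ereal (t * c) * T' \<omega>)) \<partial>M) = ennreal (exit_laplace \<alpha> (t powr (1 / \<alpha>)))"
      using version[OF t] by auto
    have "AE \<omega> in M. T \<omega> = T' \<omega>" using T(3) T'(1) by eventually_elim simp
    then have "(\<integral>\<^sup>+\<omega>. ennreal (exp_minus (ereal t * (ereal c * T \<omega>))) \<partial>M) = (\<integral>\<^sup>+\<omega>. ennreal (exp_minus (ereal (t * c) * T' \<omega>)) \<partial>M)"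
      by (intro nn_integral_cong_AE) (auto simp: mult.assoc[symmetric] elim!: eventually_mono)
    then show ?thesis using T'(2) by simp
  qed
  with T show ?thesis by (rule that)
qed

lemma exp_minus_nonneg: "0 \<le> exp_minus s"
  by (simp add: exp_minus_def)

lemma exp_minus_measurable[measurable]: "exp_minus \<in> borel_measurable borel"
  unfolding exp_minus_def[abs_def] by measurable

lemma exit_laplace_measurable[measurable]: "exit_laplace \<alpha> \<in> borel_measurable borel"
proof -
  have eq: "upper_incomplete_Gamma (1 - \<alpha>) = (\<lambda>z. LINT t|lborel. (if z < t then t powr (1 - \<alpha> - 1) * exp (- t) else 0))"
    unfolding upper_incomplete_Gamma_def[abs_def] set_lebesgue_integral_def
    by (intro ext Bochner_Integration.integral_cong) (auto simp: indicator_def)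
  have [measurable]: "upper_incomplete_Gamma (1 - \<alpha>) \<in> borel_measurable borel"
    unfolding eq by measurable
  show ?thesis unfolding exit_laplace_def[abs_def] by measurable
qed

text \<open>The link from the first formula to the second. It includes
  \<open>s = \<infinity>\<close>, where both sides are 0: the indicator excludes
  \<open>t = 0\<close>, where \<open>0 * \<infinity> = 0\<close> would give \<open>exp_minus\<close>
  the value 1.\<close>

lemma inverse_eq_nn_integral_exp_minus:
  assumes x: "0 < x" and c: "0 < c" and s: "0 \<le> s"
  shows "ennreal (real_of_ereal (1 / (ereal x + ereal c * s))) =
    (\<integral>\<^sup>+t. ennreal (exp (- x * t)) * ennreal (exp_minus (ereal t * (ereal c * s))) * indicator {0<..} t \<partial>lborel)"
proof (cases s)
  case (real r)
  then have r: "0 \<le> r" using s by simp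
  have "ennreal (exp (- x * t)) * ennreal (exp_minus (ereal t * (ereal c * s))) = ennreal (exp (- (x + c * r) * t))" for t
  proof -
    have "exp (- (x + c * r) * t) = exp (- x * t) * exp (- (t * (c * r)))"
      unfolding exp_add[symmetric] by (simp add: algebra_simps)
    then show ?thesis using real by (simp add: exp_minus_def flip: ennreal_mult)
  qed
  moreover have "0 < x + c * r" using x c r by (simp add: add_pos_nonneg)
  moreover from this have "real_of_ereal (1 / (ereal x + ereal c * s)) = 1 / (x + c * r)"
    by (simp add: real one_ereal_def)
  ultimately show ?thesis using nn_integral_exp[of "x + c * r"] by (simp only:)
next
  case PInf
  have "ennreal (exp (- x * t)) * ennreal (exp_minus (ereal t * (ereal c * s))) * indicator {0<..} t = 0" for t
    using PInf c by (cases "0 < t") (simp_all add: exp_minus_def)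
  moreover have "real_of_ereal (1 / (ereal x + ereal c * s)) = 0" using PInf c by simp
  ultimately show ?thesis by (simp only: ennreal_0 nn_integral_const mult_zero_left)
qed (use s in simp)

lemma exit_resolvent_integral:
  assumes \<alpha>: "0 < \<alpha>" "\<alpha> < 1" and x: "0 < x"
  shows "(\<integral>\<^sup>+t. ennreal (exp (- x * t)) * ennreal (exit_laplace \<alpha> (t powr (1 / \<alpha>))) * indicator {0<..} t \<partial>lborel) =
    (\<integral>\<^sup>+u. ennreal (indicator {0<..} u * (exp (- u) * (exit_laplace \<alpha> (u powr (1 / \<alpha>) * x powr (- 1 / \<alpha>)) / x))) \<partial>lborel)"
proof -
  let ?F = "\<lambda>u. ennreal (1 / x) * (ennreal (exp (- x * (1 / x * u))) * ennreal (exit_laplace \<alpha> ((1 / x * u) powr (1 / \<alpha>))) * indicator {0<..} (1 / x * u))"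
  let ?G = "\<lambda>u. ennreal (indicator {0<..} u * (exp (- u) * (exit_laplace \<alpha> (u powr (1 / \<alpha>) * x powr (- 1 / \<alpha>)) / x)))"
  have "(\<integral>\<^sup>+t. ennreal (exp (- x * t)) * ennreal (exit_laplace \<alpha> (t powr (1 / \<alpha>))) * indicator {0<..} t \<partial>lborel)
    = ennreal (1 / x) * (\<integral>\<^sup>+u. ennreal (exp (- x * (1 / x * u))) * ennreal (exit_laplace \<alpha> ((1 / x * u) powr (1 / \<alpha>))) * indicator {0<..} (1 / x * u) \<partial>lborel)"
    using x by (subst nn_integral_real_affine[where c="1 / x" and t=0]) auto
  also have "\<dots> = (\<integral>\<^sup>+u. ?F u \<partial>lborel)"
    by (rule nn_integral_cmult[symmetric]) measurable
  also have "\<dots> = (\<integral>\<^sup>+u. ?G u \<partial>lborel)"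
  proof (rule nn_integral_cong)
    fix u :: real
    show "?F u
      = ?G u"
    proof (cases "0 < u")
      case True
      have "(1 / x * u) powr (1 / \<alpha>) = u powr (1 / \<alpha>) * x powr (- 1 / \<alpha>)"
        using True x by (simp add: powr_divide powr_minus_divide)
      then show ?thesis using True x exit_laplace_nonneg[OF \<alpha>]
        by (simp add: zero_less_mult_iff mult_ac flip: ennreal_mult)
    qed (use x in \<open>simp add: indicator_def zero_less_divide_iff\<close>)
  qed
  finally show ?thesis .
qed

theorem proposition7:
  fixes M :: "'a measure" and X :: "real \<Rightarrow> 'a \<Rightarrow> real" and \<alpha> \<beta> \<sigma> c :: real
  assumes "1 / 2 \<le> \<alpha>" and "\<alpha> < 1"
    and "strictly_stable_process M X \<alpha> \<beta> \<sigma>"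
    and "1 - positivity_coefficient M X = 1 / \<alpha> - 1"
    and "c = exponent_modulus \<alpha> \<beta> \<sigma>"
  shows "(\<forall>t>0. exit_expectation M X 1 (\<lambda>\<tau>. exp_minus (ereal t * (ereal c * \<tau>))) =
            sin (\<alpha> * pi) / pi * Gamma \<alpha> *
              upper_incomplete_Gamma (1 - \<alpha>) (t powr (1 / \<alpha>)) * exp (t powr (1 / \<alpha>))) \<and>
         (\<forall>x>0. exit_expectation M X 1 (\<lambda>\<tau>. real_of_ereal (1 / (ereal x + ereal c * \<tau>))) =
            (LINT u:{0<..}|lborel. exp (- u) *
               (exp (u powr (1 / \<alpha>) * x powr (- 1 / \<alpha>)) / x -
                u powr (1 / \<alpha> - 1) / x powr (1 / \<alpha>) *
                  (hypergeom_1F1 1 (2 - \<alpha>) (u powr (1 / \<alpha>) * x powr (- 1 / \<alpha>)) /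
                     Gamma (2 - \<alpha>)))))"
proof -
  have \<alpha>: "0 < \<alpha>" "\<alpha> < 1" using assms(1,2) by auto
  have c: "0 < c" by (rule stable_exponent_parameters(1)[OF assms])
  have levy: "levy_process M X" using assms(3) by (simp add: strictly_stable_process_def)
  interpret prob_space M using levy by (simp add: levy_process_def)
  obtain T where T[measurable]: "T \<in> borel_measurable M" and T0: "\<And>\<omega>. 0 \<le> T \<omega>"
    and exit: "AE \<omega> in M. exit_time (\<lambda>t \<omega>. 1 + X t \<omega>) \<omega> = T \<omega>"
    and law: "\<And>t. 0 < t \<Longrightarrow> (\<integral>\<^sup>+\<omega>. ennreal (exp_minus (ereal t * (ereal c * T \<omega>))) \<partial>M) = ennreal (exit_laplace \<alpha> (t powr (1 / \<alpha>)))"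
    by (rule exit_time_law[OF assms]) blast
  \<comment> \<open>For a nonnegative measurable function the Bochner integral is
    \<open>enn2real\<close> of the nonnegative integral even when the latter is infinite, so no
    integrability has to be checked.\<close>
  have expectation: "exit_expectation M X 1 F = enn2real (\<integral>\<^sup>+\<omega>. ennreal (F (T \<omega>)) \<partial>M)"
    if [measurable]: "F \<in> borel_measurable borel" and F: "\<And>s. 0 \<le> s \<Longrightarrow> 0 \<le> F s" for F
  proof -
    have "exit_expectation M X 1 F = (LINT \<omega>|M. F (T \<omega>))"
      unfolding exit_expectation_def by (rule integral_completion_AE) (use exit in \<open>auto elim!: eventually_mono\<close>)
    also have "\<dots> = enn2real (\<integral>\<^sup>+\<omega>. ennreal (F (T \<omega>)) \<partial>M)"
      by (rule integral_eq_nn_integral) (use F T0 in auto)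
    finally show ?thesis .
  qed
  have "exit_expectation M X 1 (\<lambda>\<tau>. exp_minus (ereal t * (ereal c * \<tau>))) = exit_laplace \<alpha> (t powr (1 / \<alpha>))" if t: "0 < t" for t
    using law[OF t] exit_laplace_nonneg[OF \<alpha>] by (subst expectation) (simp_all add: exp_minus_nonneg)
  moreover have "exit_expectation M X 1 (\<lambda>\<tau>. real_of_ereal (1 / (ereal x + ereal c * \<tau>))) =
      (LINT u:{0<..}|lborel. exp (- u) *
         (exp (u powr (1 / \<alpha>) * x powr (- 1 / \<alpha>)) / x -
          u powr (1 / \<alpha> - 1) / x powr (1 / \<alpha>) *
            (hypergeom_1F1 1 (2 - \<alpha>) (u powr (1 / \<alpha>) * x powr (- 1 / \<alpha>)) / Gamma (2 - \<alpha>))))" (is "_ = ?R") if x: "0 < x" for x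
  proof -
    let ?h = "\<lambda>u. exit_laplace \<alpha> (u powr (1 / \<alpha>) * x powr (- 1 / \<alpha>)) / x"
    interpret P: pair_sigma_finite lborel M ..
    have "exit_expectation M X 1 (\<lambda>\<tau>. real_of_ereal (1 / (ereal x + ereal c * \<tau>))) =
        enn2real (\<integral>\<^sup>+\<omega>. ennreal (real_of_ereal (1 / (ereal x + ereal c * T \<omega>))) \<partial>M)"
      using x c by (intro expectation) (auto intro!: real_of_ereal_pos divide_nonneg_nonneg add_nonneg_nonneg)
    also have "(\<integral>\<^sup>+\<omega>. ennreal (real_of_ereal (1 / (ereal x + ereal c * T \<omega>))) \<partial>M) =
      (\<integral>\<^sup>+\<omega>. \<integral>\<^sup>+t. ennreal (exp (- x * t)) * ennreal (exp_minus (ereal t * (ereal c * T \<omega>))) * indicator {0<..} t \<partial>lborel \<partial>M)"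
      by (simp add: inverse_eq_nn_integral_exp_minus x c T0)
    also have "\<dots> = (\<integral>\<^sup>+t. \<integral>\<^sup>+\<omega>. ennreal (exp (- x * t)) * ennreal (exp_minus (ereal t * (ereal c * T \<omega>))) * indicator {0<..} t \<partial>M \<partial>lborel)"
      by (rule P.Fubini') measurable
    also have "\<dots> = (\<integral>\<^sup>+t. ennreal (exp (- x * t)) * ennreal (exit_laplace \<alpha> (t powr (1 / \<alpha>))) * indicator {0<..} t \<partial>lborel)"
    proof (rule nn_integral_cong)
      fix t :: real
      show "(\<integral>\<^sup>+\<omega>. ennreal (exp (- x * t)) * ennreal (exp_minus (ereal t * (ereal c * T \<omega>))) * indicator {0<..} t \<partial>M) =
        ennreal (exp (- x * t)) * ennreal (exit_laplace \<alpha> (t powr (1 / \<alpha>))) * indicator {0<..} t"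
        using law[of t] by (cases "0 < t") (simp_all add: nn_integral_cmult)
    qed
    also have "\<dots> = (\<integral>\<^sup>+u. ennreal (indicator {0<..} u * (exp (- u) * ?h u)) \<partial>lborel)"
      by (rule exit_resolvent_integral[OF \<alpha> x])
    also have "enn2real \<dots> = (LINT u|lborel. indicator {0<..} u * (exp (- u) * ?h u))"
      using x exit_laplace_nonneg[OF \<alpha>] by (intro integral_eq_nn_integral[symmetric]) (auto intro!: AE_I2)
    also have "\<dots> = ?R"
      unfolding set_lebesgue_integral_def
    proof (rule Bochner_Integration.integral_cong)
      fix u :: real
      let ?z = "u powr (1 / \<alpha>) * x powr (- 1 / \<alpha>)"
      have "?h u = exp ?z / x - u powr (1 / \<alpha> - 1) / x powr (1 / \<alpha>) * (hypergeom_1F1 1 (2 - \<alpha>) ?z / Gamma (2 - \<alpha>))" if u: "0 < u"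
      proof -
        have z: "0 < ?z" using u x by simp
        \<comment> \<open>Dividing by \<open>x\<close> turns
          \<open>x powr (1 - 1 / \<alpha>)\<close> into \<open>1 / x powr (1 / \<alpha>)\<close>,
          the prefactor in the statement.\<close>
        have "?z powr (1 - \<alpha>) = u powr (1 / \<alpha> - 1) * x powr (1 - 1 / \<alpha>)"
        proof -
          have "1 / \<alpha> * (1 - \<alpha>) = 1 / \<alpha> - 1" "- 1 / \<alpha> * (1 - \<alpha>) = 1 - 1 / \<alpha>" using \<alpha> by (simp_all add: field_simps)
          then show ?thesis using u x by (simp only: powr_mult powr_powr)
        qed
        also have "x powr (1 - 1 / \<alpha>) = x / x powr (1 / \<alpha>)" using x by (simp add: powr_diff)
        finally have "?z powr (1 - \<alpha>) / x = u powr (1 / \<alpha> - 1) / x powr (1 / \<alpha>)" using x by simp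
        moreover have "?z powr (1 - \<alpha>) * H / x = ?z powr (1 - \<alpha>) / x * H" for H by simp
        ultimately show ?thesis unfolding exit_laplace_hypergeom[OF \<alpha> z] diff_divide_distrib by (simp only:)
      qed
      then show "indicator {0<..} u * (exp (- u) * ?h u) = indicator {0<..} u *\<^sub>R (exp (- u) *
         (exp ?z / x - u powr (1 / \<alpha> - 1) / x powr (1 / \<alpha>) * (hypergeom_1F1 1 (2 - \<alpha>) ?z / Gamma (2 - \<alpha>))))"
        by (cases "0 < u") simp_all
    qed simp
    finally show ?thesis .
  qed
  ultimately show ?thesis unfolding exit_laplace_def by blast
qed

end
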